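(* Let $(R,\mathfrak m)$ be a one-dimensional Cohen-Macaulay local ring possessing the canonical module $K_R$, and let $\mathfrak a$ be an $\mathfrak m$-primary ideal of $R$. If $R$ is a GGL ring with respect to $\mathfrak a$ and $R$ is not a Gorenstein ring, then $\mathfrak a=\operatorname{tr}_R(K_R)$.
   Context: All rings are commutative Noetherian. For an $R$-module $M$, $\operatorname{tr}_R(M)=\sum_{f\in\operatorname{Hom}_R(M,R)}\operatorname{Im} f$. A finitely generated $R$-module $C$ is an Ulrich $R$-module with respect to an $\mathfrak m$-primary ideal $\mathfrak a$ if $C$ is a nonzero Cohen-Macaulay module ($\operatorname{depth}_R C=\dim_R C$), $e_{\mathfrak a}^0(C)=\ell_R(C/\mathfrak aC)$ (where $e_{\mathfrak a}^0(C)$ is the multiplicity of $C$ with respect to $\mathfrak a$ and $\ell_R$ is length), and $C/\mathfrak aC$ is a free $R/\mathfrak a$-module. $R$ is a GGL (generalized Gorenstein local) ring with respect to $\mathfrak a$ if there is an exact sequence $0\to R\to K_R\to C\to 0$ of $R$-modules such that (i) $C$ is an Ulrich $R$-module with respect to $\mathfrak a$ and (ii) $K_R/\mathfrak aK_R$ is $R/\mathfrak a$-free. *)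

theory Defs
  imports "HOL-Algebra.Module" "HOL-Algebra.Ring_Divisibility" "HOL-Algebra.Ideal_Product"
    "HOL-Library.Extended_Nat" "HOL-Library.FuncSet"
begin

section \<open>Rings\<close>

text \<open>The standing hypothesis that rings are commutative Noetherian is part of this notion.\<close>

definition noetherian_local_ring :: "('a, 'r) ring_scheme \<Rightarrow> 'a set \<Rightarrow> bool" where
  "noetherian_local_ring R \<mm> \<longleftrightarrow>
     cring R \<and> noetherian_ring R \<and> maximalideal \<mm> R \<and> (\<forall>\<nn>. maximalideal \<nn> R \<longrightarrow> \<nn> = \<mm>)"

text \<open>The supremum of the lengths of strictly increasing chains of prime ideals.\<close>

definition krull_dim :: "('a, 'r) ring_scheme \<Rightarrow> enat" where
  "krull_dim R = Sup {enat n |n. \<exists>P. (\<forall>i\<le>n. primeideal (P i) R) \<and> (\<forall>i<n. P i \<subset> P (Suc i))}"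

definition radical_of :: "('a, 'r) ring_scheme \<Rightarrow> 'a set \<Rightarrow> 'a set" where
  "radical_of R I = {x \<in> carrier R. \<exists>n::nat. x [^]\<^bsub>R\<^esub> n \<in> I}"

definition primary_ideal :: "('a, 'r) ring_scheme \<Rightarrow> 'a set \<Rightarrow> bool" where
  "primary_ideal R I \<longleftrightarrow> ideal I R \<and> I \<noteq> carrier R \<and>
     (\<forall>x\<in>carrier R. \<forall>y\<in>carrier R. x \<otimes>\<^bsub>R\<^esub> y \<in> I \<longrightarrow> x \<in> I \<or> (\<exists>n::nat. y [^]\<^bsub>R\<^esub> n \<in> I))"

definition m_primary :: "('a, 'r) ring_scheme \<Rightarrow> 'a set \<Rightarrow> 'a set \<Rightarrow> bool" where
  "m_primary R \<mm> \<aa> \<longleftrightarrow> primary_ideal R \<aa> \<and> radical_of R \<aa> = \<mm>"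


section \<open>Modules and homomorphisms\<close>

text \<open>The record type of modules extends that of rings. Its fields \<open>mult\<close> and \<open>one\<close> play no role
  for modules and are left unspecified in the constructions below.\<close>

definition self_module :: "('a, 'r) ring_scheme \<Rightarrow> ('a, 'a) module" where
  "self_module R = \<lparr>carrier = carrier R, mult = undefined, one = undefined,
     zero = \<zero>\<^bsub>R\<^esub>, add = add R, smult = mult R\<rparr>"

definition module_homs ::
  "('a, 'r) ring_scheme \<Rightarrow> ('a, 'b, 'p) module_scheme \<Rightarrow> ('a, 'c, 'q) module_scheme \<Rightarrow> ('b \<Rightarrow> 'c) set"
  where
  "module_homs R M N = {f \<in> carrier M \<rightarrow> carrier N.
     (\<forall>x\<in>carrier M. \<forall>y\<in>carrier M. f (x \<oplus>\<^bsub>M\<^esub> y) = f x \<oplus>\<^bsub>N\<^esub> f y) \<and>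
     (\<forall>a\<in>carrier R. \<forall>x\<in>carrier M. f (a \<odot>\<^bsub>M\<^esub> x) = a \<odot>\<^bsub>N\<^esub> f x)}"

definition mod_kernel ::
  "('a, 'b, 'p) module_scheme \<Rightarrow> ('a, 'c, 'q) module_scheme \<Rightarrow> ('b \<Rightarrow> 'c) \<Rightarrow> 'b set" where
  "mod_kernel M N f = {x \<in> carrier M. f x = \<zero>\<^bsub>N\<^esub>}"

definition submodule_span ::
  "('a, 'r) ring_scheme \<Rightarrow> ('a, 'b, 'p) module_scheme \<Rightarrow> 'b set \<Rightarrow> 'b set" where
  "submodule_span R M S = \<Inter>{N. submodule N R M \<and> S \<subseteq> N}"

definition fin_gen_module :: "('a, 'r) ring_scheme \<Rightarrow> ('a, 'b, 'p) module_scheme \<Rightarrow> bool" where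
  "fin_gen_module R M \<longleftrightarrow> module R M \<and>
     (\<exists>S. finite S \<and> S \<subseteq> carrier M \<and> submodule_span R M S = carrier M)"

definition ideal_smult ::
  "('a, 'r) ring_scheme \<Rightarrow> 'a set \<Rightarrow> ('a, 'b, 'p) module_scheme \<Rightarrow> 'b set" where
  "ideal_smult R I M = submodule_span R M {a \<odot>\<^bsub>M\<^esub> x |a x. a \<in> I \<and> x \<in> carrier M}"

definition annihilator :: "('a, 'r) ring_scheme \<Rightarrow> ('a, 'b, 'p) module_scheme \<Rightarrow> 'a set" where
  "annihilator R M = {a \<in> carrier R. \<forall>x\<in>carrier M. a \<odot>\<^bsub>M\<^esub> x = \<zero>\<^bsub>M\<^esub>}"

definition quot_module ::
  "('a, 'b, 'p) module_scheme \<Rightarrow> 'b set \<Rightarrow> ('a, 'b set) module" where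
  "quot_module M N = \<lparr>carrier = a_rcosets\<^bsub>M\<^esub> N, mult = undefined, one = undefined,
     zero = N, add = set_add M, smult = (\<lambda>a X. \<Union>x\<in>X. N +>\<^bsub>M\<^esub> (a \<odot>\<^bsub>M\<^esub> x))\<rparr>"

text \<open>\<open>M / IM\<close> as a module over \<open>R Quot I\<close>; the scalars are cosets.\<close>

definition reduction_module ::
  "('a, 'r) ring_scheme \<Rightarrow> 'a set \<Rightarrow> ('a, 'b, 'p) module_scheme \<Rightarrow> ('a set, 'b set) module" where
  "reduction_module R I M = (let N = ideal_smult R I M in
     \<lparr>carrier = a_rcosets\<^bsub>M\<^esub> N, mult = undefined, one = undefined,
      zero = N, add = set_add M, smult = (\<lambda>A X. \<Union>a\<in>A. \<Union>x\<in>X. N +>\<^bsub>M\<^esub> (a \<odot>\<^bsub>M\<^esub> x))\<rparr>)"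

text \<open>A basis is a subset through which every element has a unique expression as a linear
  combination with finitely many nonzero coefficients.\<close>

definition free_module :: "('a, 'r) ring_scheme \<Rightarrow> ('a, 'b, 'p) module_scheme \<Rightarrow> bool" where
  "free_module R M \<longleftrightarrow> module R M \<and> (\<exists>B\<subseteq>carrier M. \<forall>x\<in>carrier M.
     \<exists>!c. c \<in> B \<rightarrow>\<^sub>E carrier R \<and> finite {b \<in> B. c b \<noteq> \<zero>\<^bsub>R\<^esub>} \<and>
          x = (\<Oplus>\<^bsub>M\<^esub>b\<in>{b \<in> B. c b \<noteq> \<zero>\<^bsub>R\<^esub>}. c b \<odot>\<^bsub>M\<^esub> b))"

definition module_length :: "('a, 'r) ring_scheme \<Rightarrow> ('a, 'b, 'p) module_scheme \<Rightarrow> enat" where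
  "module_length R M =
     Sup {enat n |n. \<exists>N. (\<forall>i\<le>n. submodule (N i) R M) \<and> (\<forall>i<n. N i \<subset> N (Suc i))}"

text \<open>The sum of the images of all linear forms, i.e. the ideal generated by their union.\<close>

definition trace_ideal :: "('a, 'r) ring_scheme \<Rightarrow> ('a, 'b, 'p) module_scheme \<Rightarrow> 'a set" where
  "trace_ideal R M = genideal R (\<Union>f\<in>module_homs R M (self_module R). f ` carrier M)"


section \<open>Dimension, depth, Cohen-Macaulay modules\<close>

text \<open>For the zero module this gives \<open>0\<close>; the notion is used for nonzero modules only.\<close>

definition module_dim :: "('a, 'r) ring_scheme \<Rightarrow> ('a, 'b, 'p) module_scheme \<Rightarrow> enat" where
  "module_dim R M = krull_dim (R Quot annihilator R M)"

text \<open>\<open>xs ! i\<close> is a nonzerodivisor on \<open>M / (xs ! 0, \<dots>, xs ! (i - 1)) M\<close> for each \<open>i\<close>, and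
  \<open>M / (xs) M\<close> is nonzero.\<close>

definition regular_sequence ::
  "('a, 'r) ring_scheme \<Rightarrow> ('a, 'b, 'p) module_scheme \<Rightarrow> 'a list \<Rightarrow> bool" where
  "regular_sequence R M xs \<longleftrightarrow> set xs \<subseteq> carrier R \<and>
     (\<forall>i<length xs. \<forall>y\<in>carrier M.
        xs ! i \<odot>\<^bsub>M\<^esub> y \<in> ideal_smult R (genideal R (set (take i xs))) M \<longrightarrow>
        y \<in> ideal_smult R (genideal R (set (take i xs))) M) \<and>
     ideal_smult R (genideal R (set xs)) M \<noteq> carrier M"

definition depth :: "('a, 'r) ring_scheme \<Rightarrow> 'a set \<Rightarrow> ('a, 'b, 'p) module_scheme \<Rightarrow> enat" where
  "depth R \<mm> M = Sup {enat (length xs) |xs. set xs \<subseteq> \<mm> \<and> regular_sequence R M xs}"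

definition cm_module :: "('a, 'r) ring_scheme \<Rightarrow> 'a set \<Rightarrow> ('a, 'b, 'p) module_scheme \<Rightarrow> bool" where
  "cm_module R \<mm> M \<longleftrightarrow>
     fin_gen_module R M \<and> carrier M \<noteq> {\<zero>\<^bsub>M\<^esub>} \<and> depth R \<mm> M = module_dim R M"

definition cm_local_ring :: "('a, 'r) ring_scheme \<Rightarrow> 'a set \<Rightarrow> bool" where
  "cm_local_ring R \<mm> \<longleftrightarrow> noetherian_local_ring R \<mm> \<and> cm_module R \<mm> (self_module R)"


section \<open>Injective resolutions, Ext, canonical modules\<close>

text \<open>HOL cannot quantify over all modules inside a formula, so injective modules and injective
  resolutions are formed in the category of \<open>R\<close>-modules carried by subsets of one type, depending
  only on the type of the elements of \<open>R\<close>. It contains copies of \<open>R\<close> and its ideals, so by Baer's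
  criterion an injective object of it is an injective module in the absolute sense. The minimal
  injective resolution of a finitely generated module over a Noetherian ring \<open>R\<close> has terms of
  cardinality at most the maximum of that of \<open>R\<close> and of the natural numbers, so it can be
  realised on this type.\<close>

type_synonym 'a universe = "nat \<Rightarrow> 'a"

definition injective_module :: "('a, 'r) ring_scheme \<Rightarrow> ('a, 'b, 'p) module_scheme \<Rightarrow> bool" where
  "injective_module R E \<longleftrightarrow> module R E \<and>
     (\<forall>(N :: ('a, 'a universe) module) (L :: ('a, 'a universe) module) i g.
        module R N \<and> module R L \<and> i \<in> module_homs R N L \<and> inj_on i (carrier N) \<and>
        g \<in> module_homs R N E \<longrightarrow>
        (\<exists>h\<in>module_homs R L E. \<forall>x\<in>carrier N. h (i x) = g x))"

text \<open>Exactness of \<open>0 \<rightarrow> M \<rightarrow> I 0 \<rightarrow> I 1 \<rightarrow> \<dots>\<close> with all \<open>I j\<close> injective.\<close>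

definition injective_resolution ::
  "('a, 'r) ring_scheme \<Rightarrow> ('a, 'b, 'p) module_scheme \<Rightarrow> (nat \<Rightarrow> ('a, 'a universe) module) \<Rightarrow>
   ('b \<Rightarrow> 'a universe) \<Rightarrow> (nat \<Rightarrow> 'a universe \<Rightarrow> 'a universe) \<Rightarrow> bool" where
  "injective_resolution R M I e d \<longleftrightarrow>
     (\<forall>j. injective_module R (I j)) \<and>
     e \<in> module_homs R M (I 0) \<and> inj_on e (carrier M) \<and>
     (\<forall>j. d j \<in> module_homs R (I j) (I (Suc j))) \<and>
     e ` carrier M = mod_kernel (I 0) (I 1) (d 0) \<and>
     (\<forall>j. d j ` carrier (I j) = mod_kernel (I (Suc j)) (I (Suc (Suc j))) (d (Suc j)))"

definition finite_inj_dim :: "('a, 'r) ring_scheme \<Rightarrow> ('a, 'b, 'p) module_scheme \<Rightarrow> bool" where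
  "finite_inj_dim R M \<longleftrightarrow>
     (\<exists>I e d n. injective_resolution R M I e d \<and> (\<forall>j>n. carrier (I j) = {\<zero>\<^bsub>I j\<^esub>}))"

definition gorenstein_local_ring :: "('a, 'r) ring_scheme \<Rightarrow> 'a set \<Rightarrow> bool" where
  "gorenstein_local_ring R \<mm> \<longleftrightarrow> noetherian_local_ring R \<mm> \<and> finite_inj_dim R (self_module R)"

definition hom_module ::
  "('a, 'r) ring_scheme \<Rightarrow> ('a, 'b, 'p) module_scheme \<Rightarrow> ('a, 'c, 'q) module_scheme \<Rightarrow>
   ('a, 'b \<Rightarrow> 'c) module" where
  "hom_module R M N = \<lparr>carrier = module_homs R M N \<inter> extensional (carrier M),
     mult = undefined, one = undefined,
     zero = (\<lambda>x\<in>carrier M. \<zero>\<^bsub>N\<^esub>), add = (\<lambda>f g. \<lambda>x\<in>carrier M. f x \<oplus>\<^bsub>N\<^esub> g x),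
     smult = (\<lambda>a f. \<lambda>x\<in>carrier M. a \<odot>\<^bsub>N\<^esub> f x)\<rparr>"

text \<open>\<open>ext_module R N I d i\<close> is the \<open>i\<close>-th cohomology of the complex \<open>Hom(N, I 0) \<rightarrow> Hom(N, I 1) \<rightarrow> \<dots>\<close>,
  hence \<open>Ext\<^sup>i(N, M)\<close> if \<open>(I, d)\<close> belongs to an injective resolution of \<open>M\<close>.\<close>

definition ext_cocycles ::
  "('a, 'r) ring_scheme \<Rightarrow> ('a, 'b, 'p) module_scheme \<Rightarrow> (nat \<Rightarrow> ('a, 'e) module) \<Rightarrow>
   (nat \<Rightarrow> 'e \<Rightarrow> 'e) \<Rightarrow> nat \<Rightarrow> ('b \<Rightarrow> 'e) set" where
  "ext_cocycles R N I d i =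
     {f \<in> carrier (hom_module R N (I i)). \<forall>x\<in>carrier N. d i (f x) = \<zero>\<^bsub>I (Suc i)\<^esub>}"

fun ext_coboundaries ::
  "('a, 'r) ring_scheme \<Rightarrow> ('a, 'b, 'p) module_scheme \<Rightarrow> (nat \<Rightarrow> ('a, 'e) module) \<Rightarrow>
   (nat \<Rightarrow> 'e \<Rightarrow> 'e) \<Rightarrow> nat \<Rightarrow> ('b \<Rightarrow> 'e) set" where
  "ext_coboundaries R N I d 0 = {\<zero>\<^bsub>hom_module R N (I 0)\<^esub>}"
| "ext_coboundaries R N I d (Suc i) = compose (carrier N) (d i) ` carrier (hom_module R N (I i))"

definition ext_module ::
  "('a, 'r) ring_scheme \<Rightarrow> ('a, 'b, 'p) module_scheme \<Rightarrow> (nat \<Rightarrow> ('a, 'e) module) \<Rightarrow>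
   (nat \<Rightarrow> 'e \<Rightarrow> 'e) \<Rightarrow> nat \<Rightarrow> ('a, ('b \<Rightarrow> 'e) set) module" where
  "ext_module R N I d i =
     quot_module (hom_module R N (I i)\<lparr>carrier := ext_cocycles R N I d i\<rparr>)
       (ext_coboundaries R N I d i)"

text \<open>The Cohen-Macaulay type of \<open>M\<close> is the dimension of \<open>Ext\<^sup>t(R/\<mm>, M)\<close> over \<open>R/\<mm>\<close>, where \<open>t\<close> is the
  depth of \<open>M\<close>. This Ext module is killed by \<open>\<mm>\<close>, so its dimension over \<open>R/\<mm>\<close> is its length
  over \<open>R\<close>.\<close>

definition has_cm_type ::
  "('a, 'r) ring_scheme \<Rightarrow> 'a set \<Rightarrow> ('a, 'b, 'p) module_scheme \<Rightarrow> nat \<Rightarrow> bool" where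
  "has_cm_type R \<mm> M r \<longleftrightarrow> (\<exists>I e d t. injective_resolution R M I e d \<and> depth R \<mm> M = enat t \<and>
     module_length R (ext_module R (quot_module (self_module R) \<mm>) I d t) = enat r)"

text \<open>A canonical module of a Cohen-Macaulay local ring is a maximal Cohen-Macaulay module of
  type one and of finite injective dimension (Bruns and Herzog).\<close>

definition canonical_module ::
  "('a, 'r) ring_scheme \<Rightarrow> 'a set \<Rightarrow> ('a, 'b, 'p) module_scheme \<Rightarrow> bool" where
  "canonical_module R \<mm> K \<longleftrightarrow> cm_local_ring R \<mm> \<and> cm_module R \<mm> K \<and>
     module_dim R K = krull_dim R \<and> has_cm_type R \<mm> K 1 \<and> finite_inj_dim R K"


section \<open>Multiplicity, Ulrich modules, generalized Gorenstein local rings\<close>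

text \<open>With \<open>s\<close> the dimension of \<open>M\<close> (not of \<open>R\<close>), there are unique integers \<open>c 0, \<dots>, c s\<close> such that
  the length of \<open>M / \<aa>\<^sup>n\<^sup>+\<^sup>1 M\<close> is the sum of the \<open>(-1)\<^sup>i c i (n + s - i choose s - i)\<close> for all large \<open>n\<close>.
  The multiplicity is \<open>c 0\<close>.\<close>

definition multiplicity_wrt ::
  "('a, 'r) ring_scheme \<Rightarrow> 'a set \<Rightarrow> ('a, 'b, 'p) module_scheme \<Rightarrow> nat" where
  "multiplicity_wrt R \<aa> M = (THE e. \<exists>(s::nat) (c :: nat \<Rightarrow> int).
     module_dim R M = enat s \<and> c 0 = int e \<and>
     (\<exists>n0. \<forall>n\<ge>n0. \<exists>l.
        module_length R
          (quot_module M (ideal_smult R (\<aa> [^]\<^bsub>ideals_set R\<^esub> Suc n) M)) = enat l \<and>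
        int l = (\<Sum>i\<le>s. (- 1) ^ i * c i * int ((n + s - i) choose (s - i)))))"

definition ulrich_module ::
  "('a, 'r) ring_scheme \<Rightarrow> 'a set \<Rightarrow> 'a set \<Rightarrow> ('a, 'b, 'p) module_scheme \<Rightarrow> bool" where
  "ulrich_module R \<mm> \<aa> C \<longleftrightarrow> cm_module R \<mm> C \<and>
     enat (multiplicity_wrt R \<aa> C) = module_length R (quot_module C (ideal_smult R \<aa> C)) \<and>
     free_module (R Quot \<aa>) (reduction_module R \<aa> C)"

text \<open>\<open>K\<close> is the canonical module of \<open>R\<close>. Requiring the cokernel \<open>C\<close> to live on the type
  \<open>'b set\<close> is no restriction, as every cokernel of a map into \<open>K\<close> is isomorphic to a module of
  cosets in \<open>K\<close>.\<close>

definition ggl_ring ::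
  "('a, 'r) ring_scheme \<Rightarrow> 'a set \<Rightarrow> ('a, 'b, 'p) module_scheme \<Rightarrow> 'a set \<Rightarrow> bool" where
  "ggl_ring R \<mm> K \<aa> \<longleftrightarrow> (\<exists>(C :: ('a, 'b set) module) f g.
     module R C \<and>
     f \<in> module_homs R (self_module R) K \<and> g \<in> module_homs R K C \<and>
     inj_on f (carrier R) \<and> f ` carrier R = mod_kernel K C g \<and> g ` carrier K = carrier C \<and>
     ulrich_module R \<mm> \<aa> C \<and>
     free_module (R Quot \<aa>) (reduction_module R \<aa> K))"

end

theory Submission
  imports Defs
begin

text \<open>Let \<open>\<omega>\<close> be the image of \<open>1\<close> under the embedding \<open>f\<close> of \<open>R\<close> into \<open>K\<close>, and let \<open>C = K/R\<omega>\<close>.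

\<^emph>\<open>The cokernel has finite length.\<close> Otherwise, as \<open>C\<close> is Cohen-Macaulay, some \<open>d \<in> \<mm>\<close> is
\<open>C\<close>-regular. Choose a \<open>K\<close>-regular \<open>x \<in> \<mm>\<close>. It is \<open>R\<close>-regular, so \<open>R/xR\<close> has finite length \<open>l\<close>
because \<open>R\<close> has dimension one; hence \<open>x\<close> divides a power of \<open>d\<close> and is \<open>C\<close>-regular as well, and
therefore \<open>R/xR\<close> embeds into \<open>K/xK\<close>. Since \<open>K\<close> has type one, \<open>K/xK\<close> has a simple socle
(\<open>ext_length_one_simple_socle\<close>). The annihilators in \<open>K/xK\<close> of the members of a composition series
of \<open>R/xR\<close> have successive quotients that embed into that socle, so the length of \<open>K/xK\<close> is at most
\<open>l\<close>. The embedding is then onto, that is \<open>K = R\<omega> + xK\<close>, so \<open>C = xC\<close> and \<open>C = 0\<close> by Nakayama's lemma;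
but Ulrich modules are nonzero (\<open>cokernel_zero_if_regular\<close>).

\<^emph>\<open>The ideal is the annihilator of the cokernel.\<close> In dimension zero the multiplicity is the length,
so the Ulrich condition says that \<open>C\<close> and \<open>C/\<aa>C\<close> have the same finite length, which forces
\<open>\<aa>C = 0\<close> (\<open>ideal_smult_zero_of_multiplicity\<close>). So \<open>C\<close> is a nonzero free module over \<open>R/\<aa>\<close>, and
\<open>\<aa> = {r. rK \<subseteq> R\<omega>}\<close> (\<open>free_reduction_annihilator\<close>).

\<^emph>\<open>If \<open>y\<omega> \<in> \<aa>K\<close> then \<open>y \<in> \<aa>\<close>.\<close> Both \<open>K/\<aa>K\<close> and its quotient \<open>C\<close> are free over \<open>R/\<aa>\<close>. If a nonzero
element of \<open>R/\<aa>\<close> kills the class of \<open>\<omega>\<close>, then no coordinate of that class is a unit, so it lies in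
\<open>\<mm>(K/\<aa>K)\<close>; as \<open>C\<close> is free, the submodule generated by the class is a direct summand and hence
vanishes by Nakayama's lemma (\<open>free_reduction_kernel\<close>). But \<open>\<omega> \<in> \<aa>K \<subseteq> R\<omega>\<close> would make some \<open>ak\<close> with
\<open>a \<in> \<aa>\<close> a unit multiple of \<open>\<omega>\<close>; then \<open>K = Rk\<close> is isomorphic to \<open>R\<close>
(\<open>cyclic_of_generator_mem_ideal_smult\<close>) and \<open>R\<close> would be Gorenstein.

\<^emph>\<open>The trace.\<close> For \<open>a \<in> \<aa>\<close> the form \<open>k \<mapsto> f\<^sup>-\<^sup>1(ak)\<close> takes the value \<open>a\<close> at \<open>\<omega>\<close>. Conversely let \<open>\<phi>\<close> be a form
on \<open>K\<close> and \<open>q = \<phi>(\<omega>)\<close>. A power of \<open>x\<close> maps \<open>K\<close> into \<open>R\<omega>\<close>, so \<open>f\<phi>(k) = qk\<close> for all \<open>k\<close>. Hence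
\<open>qK \<subseteq> R\<omega>\<close>, so \<open>q \<in> \<aa>\<close> and \<open>\<phi>(k)\<omega> = qk \<in> \<aa>K\<close>, which gives \<open>\<phi>(k) \<in> \<aa>\<close> (\<open>trace_ideal_eq\<close>).\<close>


section \<open>Submodules and homomorphisms\<close>

lemma submodule_zero_mem: "submodule N R M \<Longrightarrow> \<zero>\<^bsub>M\<^esub> \<in> N"
  using subgroup.one_closed[OF submodule.axioms(1)] by fastforce

lemma (in module) submodule_minus_mem:
  assumes "submodule N R M" "x \<in> N" "y \<in> N"
  shows "x \<ominus>\<^bsub>M\<^esub> y \<in> N"
  using submoduleE[OF assms(1)] assms(2,3) by (simp add: a_minus_def)

lemma (in module) submodule_zero_submodule: "submodule {\<zero>\<^bsub>M\<^esub>} R M"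
  by (rule submoduleI) auto

lemma (in module) submodule_mem_of_diff:
  assumes "submodule N R M" "y \<in> N" "x \<in> carrier M" "x \<ominus>\<^bsub>M\<^esub> y \<in> N"
  shows "x \<in> N"
proof -
  have y: "y \<in> carrier M" using submoduleE(1)[OF assms(1)] assms(2) by auto
  have "(x \<ominus>\<^bsub>M\<^esub> y) \<oplus>\<^bsub>M\<^esub> y = x"
    using y assms(3) by (simp add: a_minus_def M.add.m_assoc M.l_neg)
  then show ?thesis using submoduleE(5)[OF assms(1) assms(4) assms(2)] by simp
qed

lemma (in module) diff_eq_zero_iff:
  assumes "x \<in> carrier M" "y \<in> carrier M"
  shows "x \<ominus>\<^bsub>M\<^esub> y = \<zero>\<^bsub>M\<^esub> \<longleftrightarrow> x = y"
  using assms by (simp add: a_minus_def M.add.inv_solve_right')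

lemma (in module) smult_diff_distr:
  assumes "a \<in> carrier R" "x \<in> carrier M" "y \<in> carrier M"
  shows "a \<odot>\<^bsub>M\<^esub> (x \<ominus>\<^bsub>M\<^esub> y) = a \<odot>\<^bsub>M\<^esub> x \<ominus>\<^bsub>M\<^esub> a \<odot>\<^bsub>M\<^esub> y"
  using assms by (simp add: a_minus_def smult_r_distr smult_r_minus)

lemma (in module) diff_smult_distr:
  assumes "a \<in> carrier R" "b \<in> carrier R" "x \<in> carrier M"
  shows "(a \<ominus> b) \<odot>\<^bsub>M\<^esub> x = a \<odot>\<^bsub>M\<^esub> x \<ominus>\<^bsub>M\<^esub> b \<odot>\<^bsub>M\<^esub> x"
  using assms by (simp add: a_minus_def smult_l_distr smult_l_minus)

lemma (in module) smult_commute: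
  assumes "a \<in> carrier R" "b \<in> carrier R" "x \<in> carrier M"
  shows "a \<odot>\<^bsub>M\<^esub> (b \<odot>\<^bsub>M\<^esub> x) = b \<odot>\<^bsub>M\<^esub> (a \<odot>\<^bsub>M\<^esub> x)"
  using assms by (metis R.m_comm smult_assoc1)

lemma (in module) unit_smult_mem:
  assumes "submodule N R M" "a \<in> Units R" "x \<in> carrier M" "a \<odot>\<^bsub>M\<^esub> x \<in> N"
  shows "x \<in> N"
proof -
  have "inv a \<odot>\<^bsub>M\<^esub> (a \<odot>\<^bsub>M\<^esub> x) \<in> N"
    using submoduleE(4)[OF assms(1)] assms by blast
  then show ?thesis using assms by (simp add: smult_assoc1[symmetric] R.Units_closed)
qed


subsection \<open>Homomorphisms\<close>

lemma module_homsD: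
  assumes "f \<in> module_homs R M N"
  shows "x \<in> carrier M \<Longrightarrow> f x \<in> carrier N"
    and "x \<in> carrier M \<Longrightarrow> y \<in> carrier M \<Longrightarrow> f (x \<oplus>\<^bsub>M\<^esub> y) = f x \<oplus>\<^bsub>N\<^esub> f y"
    and "a \<in> carrier R \<Longrightarrow> x \<in> carrier M \<Longrightarrow> f (a \<odot>\<^bsub>M\<^esub> x) = a \<odot>\<^bsub>N\<^esub> f x"
  using assms by (auto simp: module_homs_def)

lemma module_homsI:
  assumes "\<And>x. x \<in> carrier M \<Longrightarrow> f x \<in> carrier N"
    and "\<And>x y. x \<in> carrier M \<Longrightarrow> y \<in> carrier M \<Longrightarrow> f (x \<oplus>\<^bsub>M\<^esub> y) = f x \<oplus>\<^bsub>N\<^esub> f y"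
    and "\<And>a x. a \<in> carrier R \<Longrightarrow> x \<in> carrier M \<Longrightarrow> f (a \<odot>\<^bsub>M\<^esub> x) = a \<odot>\<^bsub>N\<^esub> f x"
  shows "f \<in> module_homs R M N"
  using assms by (auto simp: module_homs_def)

lemma module_hom_zero:
  assumes "module R M" "module R N" "f \<in> module_homs R M N"
  shows "f \<zero>\<^bsub>M\<^esub> = \<zero>\<^bsub>N\<^esub>"
proof -
  interpret M: module R M by fact
  interpret N: module R N by fact
  have "f (\<zero>\<^bsub>R\<^esub> \<odot>\<^bsub>M\<^esub> \<zero>\<^bsub>M\<^esub>) = \<zero>\<^bsub>R\<^esub> \<odot>\<^bsub>N\<^esub> f \<zero>\<^bsub>M\<^esub>"
    by (rule module_homsD(3)[OF assms(3)]) auto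
  then show ?thesis using module_homsD(1)[OF assms(3)] by simp
qed

lemma module_hom_neg:
  assumes "module R M" "module R N" "f \<in> module_homs R M N" "x \<in> carrier M"
  shows "f (\<ominus>\<^bsub>M\<^esub> x) = \<ominus>\<^bsub>N\<^esub> f x"
proof -
  interpret M: module R M by fact
  interpret N: module R N by fact
  have "f x \<oplus>\<^bsub>N\<^esub> f (\<ominus>\<^bsub>M\<^esub> x) = \<zero>\<^bsub>N\<^esub>"
    using module_homsD(2)[OF assms(3), of x "\<ominus>\<^bsub>M\<^esub> x"] assms(4) module_hom_zero[OF assms(1-3)]
    by (simp add: M.M.r_neg)
  then show ?thesis using module_homsD(1)[OF assms(3)] assms(4)
    by (metis M.M.a_inv_closed N.M.add.inv_equality N.M.add.m_comm)
qed

lemma module_hom_diff: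
  assumes "module R M" "module R N" "f \<in> module_homs R M N" "x \<in> carrier M" "y \<in> carrier M"
  shows "f (x \<ominus>\<^bsub>M\<^esub> y) = f x \<ominus>\<^bsub>N\<^esub> f y"
proof -
  interpret M: module R M by fact
  interpret N: module R N by fact
  show ?thesis using assms module_homsD(2)[OF assms(3)] module_hom_neg[OF assms(1-3)]
    by (simp add: a_minus_def)
qed

lemma module_homs_image_submodule:
  assumes "module R M" "module R N" "f \<in> module_homs R M N" "submodule P R M"
  shows "submodule (f ` P) R N"
proof -
  interpret M: module R M by fact
  interpret N: module R N by fact
  note P = M.submoduleE[OF assms(4)]
  note f = module_homsD[OF assms(3)]
  have sub: "\<And>x. x \<in> P \<Longrightarrow> x \<in> carrier M" using P(1) by auto
  show ?thesis
  proof (rule N.submoduleI)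
    show "f ` P \<subseteq> carrier N" using sub f(1) by auto
    show "\<zero>\<^bsub>N\<^esub> \<in> f ` P"
      using submodule_zero_mem[OF assms(4)] module_hom_zero[OF assms(1-3)] by (metis imageI)
  next
    fix a assume "a \<in> f ` P"
    then obtain x where "x \<in> P" "a = f x" by auto
    then show "\<ominus>\<^bsub>N\<^esub> a \<in> f ` P"
      using module_hom_neg[OF assms(1-3), of x] P(3)[of x] sub[of x] by (metis imageI)
  next
    fix a b assume "a \<in> f ` P" "b \<in> f ` P"
    then obtain x y where "x \<in> P" "y \<in> P" "a = f x" "b = f y" by auto
    then show "a \<oplus>\<^bsub>N\<^esub> b \<in> f ` P"
      using f(2)[of x y] sub P(5) by (metis imageI)
  next
    fix a x assume "a \<in> carrier R" "x \<in> f ` P"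
    then obtain y where "y \<in> P" "x = f y" by auto
    then show "a \<odot>\<^bsub>N\<^esub> x \<in> f ` P"
      using f(3)[of a y] sub P(4) \<open>a \<in> carrier R\<close> by (metis imageI)
  qed
qed

lemma module_homs_vimage_submodule:
  assumes "module R M" "module R N" "f \<in> module_homs R M N" "submodule P R N"
  shows "submodule {x \<in> carrier M. f x \<in> P} R M"
proof -
  interpret M: module R M by fact
  interpret N: module R N by fact
  note P = N.submoduleE[OF assms(4)]
  note f = module_homsD[OF assms(3)]
  show ?thesis
    by (rule M.submoduleI)
       (simp_all add: subset_iff f(1) f(2) f(3) P(3) P(4) P(5) submodule_zero_mem[OF assms(4)]
          module_hom_zero[OF assms(1-3)] module_hom_neg[OF assms(1-3)])
qed

lemma (in module) smult_hom:
  assumes "a \<in> carrier R"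
  shows "(\<lambda>x. a \<odot>\<^bsub>M\<^esub> x) \<in> module_homs R M M"
  using assms by (auto intro!: module_homsI simp: smult_r_distr smult_commute)

lemma (in module) submodule_Inter:
  assumes "\<And>N. N \<in> \<N> \<Longrightarrow> submodule N R M" "\<N> \<noteq> {}"
  shows "submodule (\<Inter>\<N>) R M"
proof (rule submoduleI)
  show "\<Inter>\<N> \<subseteq> carrier M" using assms submoduleE(1) by blast
qed (use submodule_zero_mem[OF assms(1)] submoduleE(3-5)[OF assms(1)] in auto)

lemma (in module) submodule_colon:
  assumes "submodule N R M" "I \<subseteq> carrier R"
  shows "submodule {x \<in> carrier M. \<forall>a\<in>I. a \<odot>\<^bsub>M\<^esub> x \<in> N} R M"
proof (rule submoduleI)
  note N = submoduleE[OF assms(1)]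
  have I: "\<And>a. a \<in> I \<Longrightarrow> a \<in> carrier R" using assms(2) by auto
  show "\<zero>\<^bsub>M\<^esub> \<in> {x \<in> carrier M. \<forall>a\<in>I. a \<odot>\<^bsub>M\<^esub> x \<in> N}"
    using submodule_zero_mem[OF assms(1)] I by auto
  fix x assume x: "x \<in> {x \<in> carrier M. \<forall>a\<in>I. a \<odot>\<^bsub>M\<^esub> x \<in> N}"
  then show "\<ominus>\<^bsub>M\<^esub> x \<in> {x \<in> carrier M. \<forall>a\<in>I. a \<odot>\<^bsub>M\<^esub> x \<in> N}"
    using N I by (auto simp: smult_r_minus)
  {
    fix y assume "y \<in> {x \<in> carrier M. \<forall>a\<in>I. a \<odot>\<^bsub>M\<^esub> x \<in> N}"
    then show "x \<oplus>\<^bsub>M\<^esub> y \<in> {x \<in> carrier M. \<forall>a\<in>I. a \<odot>\<^bsub>M\<^esub> x \<in> N}"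
      using x N I by (auto simp: smult_r_distr)
  }
  fix b assume "b \<in> carrier R"
  then show "b \<odot>\<^bsub>M\<^esub> x \<in> {x \<in> carrier M. \<forall>a\<in>I. a \<odot>\<^bsub>M\<^esub> x \<in> N}"
    using x N I by (auto simp: smult_commute[of _ b])
qed auto


subsection \<open>The ring as a module over itself\<close>

lemma self_module_simps [simp]:
  "carrier (self_module R) = carrier R" "\<zero>\<^bsub>self_module R\<^esub> = \<zero>\<^bsub>R\<^esub>"
  "x \<oplus>\<^bsub>self_module R\<^esub> y = x \<oplus>\<^bsub>R\<^esub> y" "a \<odot>\<^bsub>self_module R\<^esub> y = a \<otimes>\<^bsub>R\<^esub> y"
  by (simp_all add: self_module_def)

lemma self_module_minus [simp]:
  "\<ominus>\<^bsub>self_module R\<^esub> y = \<ominus>\<^bsub>R\<^esub> y" "x \<ominus>\<^bsub>self_module R\<^esub> y = x \<ominus>\<^bsub>R\<^esub> y"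
  by (simp_all add: a_minus_def a_inv_def m_inv_def)

lemma self_module_module:
  assumes "cring R" shows "module R (self_module R)"
proof -
  interpret cring R by fact
  show ?thesis
  proof (rule moduleI)
    show "abelian_group (self_module R)"
      by (rule abelian_groupI) (auto simp: a_assoc intro: a_comm l_neg)
  qed (simp_all add: assms l_distr r_distr m_assoc)
qed

lemma submodule_self_module_iff:
  assumes "cring R"
  shows "submodule I R (self_module R) \<longleftrightarrow> ideal I R"
proof -
  interpret cring R by fact
  interpret S: module R "self_module R" by (rule self_module_module[OF assms])
  show ?thesis
  proof
    assume I: "submodule I R (self_module R)"
    note I' = S.submoduleE[OF I] submodule_zero_mem[OF I]
    have "subgroup I (add_monoid R)"
      by (rule subgroup.intro) (use I' in \<open>auto simp flip: a_inv_def\<close>)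
    then show "ideal I R"
    proof (rule idealI[OF ring_axioms])
      fix a x assume "a \<in> I" "x \<in> carrier R"
      then show "x \<otimes>\<^bsub>R\<^esub> a \<in> I" "a \<otimes>\<^bsub>R\<^esub> x \<in> I" using I'(4)[of x a] I'(1) by (auto simp: m_comm)
    qed
  next
    assume I: "ideal I R"
    interpret I: ideal I R by fact
    show "submodule I R (self_module R)"
      by (rule S.submoduleI) (use I.Icarr I.I_l_closed in auto)
  qed
qed

lemma ideal_submodule: "cring R \<Longrightarrow> ideal I R \<Longrightarrow> submodule I R (self_module R)"
  by (simp add: submodule_self_module_iff)

lemma (in module) smult_element_hom:
  assumes "x \<in> carrier M"
  shows "(\<lambda>a. a \<odot>\<^bsub>M\<^esub> x) \<in> module_homs R (self_module R) M"
  using assms by (auto intro!: module_homsI simp: smult_l_distr smult_assoc1)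


abbreviation multiples :: "('a, 'b, 'p) module_scheme \<Rightarrow> 'a \<Rightarrow> 'b set" where
  "multiples M a \<equiv> (\<lambda>x. a \<odot>\<^bsub>M\<^esub> x) ` carrier M"


subsection \<open>Spans\<close>

lemma (in module) submodule_span_submodule:
  assumes "S \<subseteq> carrier M"
  shows "submodule (submodule_span R M S) R M"
  unfolding submodule_span_def
  by (rule submodule_Inter) (use carrier_is_submodule assms in auto)

lemma submodule_span_superset: "S \<subseteq> submodule_span R M S"
  by (auto simp: submodule_span_def)

lemma submodule_span_minimal: "submodule N R M \<Longrightarrow> S \<subseteq> N \<Longrightarrow> submodule_span R M S \<subseteq> N"
  by (auto simp: submodule_span_def)

lemma submodule_set_add:
  assumes "module R M" "submodule N R M" "submodule P R M"
  shows "submodule (N <+>\<^bsub>M\<^esub> P) R M"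
proof -
  interpret module R M by fact
  have "additive_subgroup (N <+>\<^bsub>M\<^esub> P) M"
    by (rule M.add_additive_subgroups) (rule additive_subgroupI, rule submodule.axioms(1), rule assms)+
  then have "subgroup (N <+>\<^bsub>M\<^esub> P) (add_monoid M)" by (rule additive_subgroup.a_subgroup)
  moreover have "a \<odot>\<^bsub>M\<^esub> x \<in> N <+>\<^bsub>M\<^esub> P" if a: "a \<in> carrier R" and x: "x \<in> N <+>\<^bsub>M\<^esub> P" for a x
  proof -
    obtain n p where n: "n \<in> N" "p \<in> P" "x = n \<oplus>\<^bsub>M\<^esub> p" using x by (auto simp: set_add_def')
    have "a \<odot>\<^bsub>M\<^esub> x = a \<odot>\<^bsub>M\<^esub> n \<oplus>\<^bsub>M\<^esub> a \<odot>\<^bsub>M\<^esub> p"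
      unfolding n(3) by (rule smult_r_distr) (use n a submoduleE(1)[OF assms(2)] submoduleE(1)[OF assms(3)] in auto)
    moreover have "a \<odot>\<^bsub>M\<^esub> n \<in> N" "a \<odot>\<^bsub>M\<^esub> p \<in> P"
      using n a submoduleE(4)[OF assms(2)] submoduleE(4)[OF assms(3)] by auto
    ultimately show ?thesis by (auto simp: set_add_def')
  qed
  ultimately show ?thesis by (simp add: submodule_def submodule_axioms_def)
qed

definition adjoin_element ::
  "('a, 'r) ring_scheme \<Rightarrow> ('a, 'b, 'p) module_scheme \<Rightarrow> 'b set \<Rightarrow> 'b \<Rightarrow> 'b set" where
  "adjoin_element R M N u = {n \<oplus>\<^bsub>M\<^esub> a \<odot>\<^bsub>M\<^esub> u |n a. n \<in> N \<and> a \<in> carrier R}"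

lemma (in module) adjoin_element_submodule:
  assumes N: "submodule N R M" and u: "u \<in> carrier M"
  shows "submodule (adjoin_element R M N u) R M"
proof -
  note S = self_module_module[OF R.is_cring]
  have "adjoin_element R M N u = N <+>\<^bsub>M\<^esub> (\<lambda>a. a \<odot>\<^bsub>M\<^esub> u) ` carrier (self_module R)"
    by (auto simp: adjoin_element_def set_add_def')
  then show ?thesis
    using submodule_set_add[OF module_axioms N module_homs_image_submodule[OF S module_axioms
        smult_element_hom[OF u] module.carrier_is_submodule[OF S]]] by simp
qed

lemma (in module) adjoin_element_superset:
  assumes N: "submodule N R M" and u: "u \<in> carrier M"
  shows "N \<subseteq> adjoin_element R M N u" "u \<in> adjoin_element R M N u"
proof -
  have sub: "\<And>x. x \<in> N \<Longrightarrow> x \<in> carrier M" using submoduleE(1)[OF N] by auto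
  have "x = x \<oplus>\<^bsub>M\<^esub> \<zero> \<odot>\<^bsub>M\<^esub> u" if "x \<in> N" for x using u sub that by simp
  then show "N \<subseteq> adjoin_element R M N u"
    unfolding adjoin_element_def by blast
  have "u = \<zero>\<^bsub>M\<^esub> \<oplus>\<^bsub>M\<^esub> \<one> \<odot>\<^bsub>M\<^esub> u" using u by simp
  then show "u \<in> adjoin_element R M N u"
    unfolding adjoin_element_def using submodule_zero_mem[OF N] by blast
qed

lemma (in module) adjoin_element_minimal:
  assumes "submodule P R M" "N \<subseteq> P" "u \<in> P"
  shows "adjoin_element R M N u \<subseteq> P"
  using submoduleE[OF assms(1)] assms(2,3) by (auto simp: adjoin_element_def)

section \<open>Noetherian modules\<close>

definition noetherian_module :: "('a, 'r) ring_scheme \<Rightarrow> ('a, 'b, 'p) module_scheme \<Rightarrow> bool" where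
  "noetherian_module R M \<longleftrightarrow> (\<forall>\<S>. \<S> \<noteq> {} \<and> (\<forall>N\<in>\<S>. submodule N R M) \<longrightarrow>
     (\<exists>N\<in>\<S>. \<forall>N'\<in>\<S>. N \<subseteq> N' \<longrightarrow> N' = N))"

lemma noetherian_ring_maximal_ideal:
  assumes "noetherian_ring R" "\<S> \<noteq> {}" "\<And>I. I \<in> \<S> \<Longrightarrow> ideal I R"
  shows "\<exists>I\<in>\<S>. \<forall>J\<in>\<S>. I \<subseteq> J \<longrightarrow> J = I"
proof (rule subset_Zorn_nonempty[OF assms(2)])
  fix C assume C: "C \<noteq> {}" "subset.chain \<S> C"
  then have "subset.chain {I. ideal I R} C"
    using assms(3) by (auto simp: subset.chain_def)
  then have "\<Union>C \<in> C" by (rule noetherian_ring.ideal_chain_is_trivial[OF assms(1) C(1)])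
  then show "\<Union>C \<in> \<S>" using C by (auto simp: subset.chain_def)
qed

lemma (in module) coefficient_ideal:
  assumes "submodule N R M" "c \<in> carrier M"
  shows "ideal {r \<in> carrier R. r \<odot>\<^bsub>M\<^esub> c \<in> N} R"
  using module_homs_vimage_submodule[OF self_module_module[OF R.is_cring] module_axioms
      smult_element_hom[OF assms(2)] assms(1)]
  by (simp add: submodule_self_module_iff[OF R.is_cring])

text \<open>By induction on the number of generators. Let \<open>T\<close> be the span of all but the last generator \<open>c\<close>. The
ideal of the coefficients of \<open>c\<close> in the elements of \<open>N\<close>, together with \<open>N \<inter> T\<close>, determines \<open>N\<close> among
comparable submodules; so choose a member of the family for which this ideal is maximal and,
among the members with that ideal, one with maximal \<open>N \<inter> T\<close>. In order to stay inside one module, maximality is only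
claimed for the intersection with the span of the generators considered so far.\<close>

theorem fin_gen_noetherian_module:
  assumes "noetherian_ring R" "fin_gen_module R M"
  shows "noetherian_module R M"
proof -
  interpret module R M using assms(2) by (simp add: fin_gen_module_def)
  obtain S where S: "finite S" "S \<subseteq> carrier M" "submodule_span R M S = carrier M"
    using assms(2) by (auto simp: fin_gen_module_def)
  have "\<forall>\<S>. \<S> \<noteq> {} \<and> (\<forall>N\<in>\<S>. submodule N R M) \<longrightarrow>
     (\<exists>N\<in>\<S>. \<forall>N'\<in>\<S>. N \<subseteq> N' \<longrightarrow> N' \<inter> submodule_span R M S \<subseteq> N)"
    using S(1,2)
  proof (induction S)
    case empty
    have "submodule_span R M {} \<subseteq> {\<zero>\<^bsub>M\<^esub>}"
      by (rule submodule_span_minimal[OF submodule_zero_submodule]) simp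
    then have "N' \<inter> submodule_span R M {} \<subseteq> N" if "submodule N R M" for N N'
      using submodule_zero_mem[OF that] by auto
    then show ?case by (meson ex_in_conv)
  next
    case (insert c S)
    let ?T = "submodule_span R M S"
    have c: "c \<in> carrier M" and Sc: "S \<subseteq> carrier M" using insert.prems by auto
    have T: "submodule ?T R M" by (rule submodule_span_submodule[OF Sc])
    have Tc: "\<And>s. s \<in> ?T \<Longrightarrow> s \<in> carrier M" using submoduleE(1)[OF T] by auto
    define I where "I N = {r \<in> carrier R. r \<odot>\<^bsub>M\<^esub> c \<in> N <+>\<^bsub>M\<^esub> ?T}" for N
    show ?case
    proof (intro allI impI)
      fix \<S> assume \<S>: "\<S> \<noteq> {} \<and> (\<forall>N\<in>\<S>. submodule N R M)"
      have "\<exists>J\<in>I ` \<S>. \<forall>J'\<in>I ` \<S>. J \<subseteq> J' \<longrightarrow> J' = J"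
        by (rule noetherian_ring_maximal_ideal[OF assms(1)])
           (use \<S> coefficient_ideal[OF submodule_set_add[OF module_axioms _ T] c] in \<open>auto simp: I_def\<close>)
      then obtain N1 where N1: "N1 \<in> \<S>" "\<And>N. N \<in> \<S> \<Longrightarrow> I N1 \<subseteq> I N \<Longrightarrow> I N = I N1" by auto
      let ?\<S>' = "{N \<in> \<S>. I N = I N1}"
      have "?\<S>' \<noteq> {} \<and> (\<forall>N\<in>?\<S>'. submodule N R M)" using N1 \<S> by auto
      then have "\<exists>N\<in>?\<S>'. \<forall>N'\<in>?\<S>'. N \<subseteq> N' \<longrightarrow> N' \<inter> ?T \<subseteq> N"
        by (rule insert.IH[OF Sc, rule_format])
      then obtain N2 where N2: "N2 \<in> ?\<S>'"
        "\<And>N. N \<in> ?\<S>' \<Longrightarrow> N2 \<subseteq> N \<Longrightarrow> N \<inter> ?T \<subseteq> N2"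
        by (elim bexE) auto
      have "N \<inter> submodule_span R M (insert c S) \<subseteq> N2" if N: "N \<in> \<S>" "N2 \<subseteq> N" for N
      proof
        fix u assume u: "u \<in> N \<inter> submodule_span R M (insert c S)"
        have "I N2 \<subseteq> I N" using N(2) unfolding I_def set_add_def' by blast
        then have IN: "I N = I N1" using N1(2)[OF N(1)] N2(1) by auto
        have sN: "submodule N R M" "submodule N2 R M" using \<S> N(1) N2(1) by auto
        have "submodule_span R M (insert c S) \<subseteq> adjoin_element R M ?T c"
          by (rule submodule_span_minimal[OF adjoin_element_submodule[OF T c]])
             (use adjoin_element_superset[OF T c] submodule_span_superset[of S R M] in auto)
        then obtain s r where s: "s \<in> ?T" "r \<in> carrier R" "u = s \<oplus>\<^bsub>M\<^esub> r \<odot>\<^bsub>M\<^esub> c"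
          using u by (auto simp: adjoin_element_def)
        have uc: "u \<in> carrier M" using s Tc c by simp
        have "r \<odot>\<^bsub>M\<^esub> c = u \<oplus>\<^bsub>M\<^esub> \<ominus>\<^bsub>M\<^esub> s"
          using s Tc c by (simp add: M.add.m_comm[of s] M.add.m_assoc M.r_neg)
        then have "r \<in> I N" using u s(2) submoduleE(3)[OF T s(1)] unfolding I_def set_add_def' by blast
        then have "r \<in> I N2" using IN N2(1) by auto
        then obtain n t where t: "n \<in> N2" "t \<in> ?T" "r \<odot>\<^bsub>M\<^esub> c = n \<oplus>\<^bsub>M\<^esub> t"
          unfolding I_def set_add_def' by blast
        have nc: "n \<in> carrier M" using submoduleE(1)[OF sN(2)] t(1) by auto
        have eq: "u \<ominus>\<^bsub>M\<^esub> n = s \<oplus>\<^bsub>M\<^esub> t"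
          unfolding s(3) t(3) using s(1) t(2) Tc nc
          by (simp add: a_minus_def M.add.m_lcomm[of s n t] M.add.m_comm[of n] M.add.m_assoc M.r_neg)
        have "u \<ominus>\<^bsub>M\<^esub> n \<in> N" by (rule submodule_minus_mem[OF sN(1)]) (use u t N(2) in auto)
        then have "u \<ominus>\<^bsub>M\<^esub> n \<in> N \<inter> ?T" using eq submoduleE(5)[OF T s(1) t(2)] by simp
        then have "u \<ominus>\<^bsub>M\<^esub> n \<in> N2" using N2(2)[of N] N IN by auto
        then show "u \<in> N2" by (rule submodule_mem_of_diff[OF sN(2) t(1) uc])
      qed
      then show "\<exists>N\<in>\<S>. \<forall>N'\<in>\<S>. N \<subseteq> N' \<longrightarrow> N' \<inter> submodule_span R M (insert c S) \<subseteq> N"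
        using N2(1) by blast
    qed
  qed
  then have max: "\<exists>N\<in>\<S>. \<forall>N'\<in>\<S>. N \<subseteq> N' \<longrightarrow> N' \<inter> carrier M \<subseteq> N"
    if "\<S> \<noteq> {}" "\<forall>N\<in>\<S>. submodule N R M" for \<S>
    using that S(3) by auto
  show ?thesis
    unfolding noetherian_module_def
  proof (intro allI impI, elim conjE)
    fix \<S> assume \<S>: "\<S> \<noteq> {}" "\<forall>N\<in>\<S>. submodule N R M"
    from max[OF \<S>] show "\<exists>N\<in>\<S>. \<forall>N'\<in>\<S>. N \<subseteq> N' \<longrightarrow> N' = N"
    proof (rule bexE)
      fix N assume N: "N \<in> \<S>" "\<forall>N'\<in>\<S>. N \<subseteq> N' \<longrightarrow> N' \<inter> carrier M \<subseteq> N"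
      have "N' = N" if N': "N' \<in> \<S>" "N \<subseteq> N'" for N'
      proof -
        have "N' \<subseteq> carrier M" using submoduleE(1) \<S>(2) N'(1) by blast
        moreover have "N' \<inter> carrier M \<subseteq> N" using N(2) N' by simp
        ultimately show ?thesis using N'(2) by auto
      qed
      then show ?thesis using N(1) by (intro bexI[of _ N]) auto
    qed
  qed
qed

lemma noetherian_self_module:
  assumes "cring R" "noetherian_ring R"
  shows "noetherian_module R (self_module R)"
  unfolding noetherian_module_def
  using noetherian_ring_maximal_ideal[OF assms(2)] submodule_self_module_iff[OF assms(1)] by simp


section \<open>Local rings\<close>

lemma noetherian_local_ringD:
  assumes "noetherian_local_ring R \<mm>"
  shows "cring R" "noetherian_ring R" "maximalideal \<mm> R" "ideal \<mm> R" "\<mm> \<subseteq> carrier R" "\<mm> \<noteq> carrier R"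
    "primeideal \<mm> R"
proof -
  show R: "cring R" "noetherian_ring R" and m: "maximalideal \<mm> R"
    using assms by (auto simp: noetherian_local_ring_def)
  show i: "ideal \<mm> R" by (rule maximalideal.axioms(1)[OF m])
  show "\<mm> \<subseteq> carrier R" using ideal.Icarr[OF i] by auto
  show "\<mm> \<noteq> carrier R" using maximalideal.I_notcarr[OF m] by auto
  show "primeideal \<mm> R" by (rule cring.maximalideal_prime[OF R(1) m])
qed

text \<open>A nonunit generates a proper ideal, and a maximal one among the proper ideals above it is the
maximal ideal of the ring.\<close>

lemma local_ring_unit:
  fixes R (structure)
  assumes "noetherian_local_ring R \<mm>" "a \<in> carrier R" "a \<notin> \<mm>"
  shows "a \<in> Units R"
proof (rule ccontr)
  assume na: "a \<notin> Units R"
  note R = noetherian_local_ringD[OF assms(1)]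
  interpret cring R by (rule R(1))
  let ?\<S> = "{J. ideal J R \<and> PIdl a \<subseteq> J \<and> J \<noteq> carrier R}"
  have "PIdl a \<noteq> carrier R"
  proof
    assume "PIdl a = carrier R"
    then obtain b where "b \<in> carrier R" "\<one> = b \<otimes> a"
      using one_closed unfolding cgenideal_def by blast
    then show False using na assms(2) by (auto simp: Units_def m_comm)
  qed
  then have "?\<S> \<noteq> {}" using cgenideal_ideal[OF assms(2)] by auto
  then have "\<exists>J\<in>?\<S>. \<forall>J'\<in>?\<S>. J \<subseteq> J' \<longrightarrow> J' = J"
    by (rule noetherian_ring_maximal_ideal[OF R(2)]) auto
  then obtain J where J: "J \<in> ?\<S>" "\<And>J'. J' \<in> ?\<S> \<Longrightarrow> J \<subseteq> J' \<Longrightarrow> J' = J"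
    by (elim bexE) auto
  have "maximalideal J R"
  proof (rule maximalidealI)
    fix J' assume J': "ideal J' R" "J \<subseteq> J'" "J' \<subseteq> carrier R"
    show "J' = J \<or> J' = carrier R" using J(2)[of J'] J(1) J' by blast
  qed (use J in auto)
  then have "J = \<mm>" using assms(1) by (auto simp: noetherian_local_ring_def)
  then show False using J(1) cgenideal_self[OF assms(2)] assms(3) by auto
qed

lemma local_ring_one_not_mem:
  assumes "noetherian_local_ring R \<mm>"
  shows "\<one>\<^bsub>R\<^esub> \<notin> \<mm>"
  using noetherian_local_ringD[OF assms] ideal.one_imp_carrier by metis

lemma local_ring_proper_ideal:
  fixes R (structure)
  assumes "noetherian_local_ring R \<mm>" "ideal J R" "J \<noteq> carrier R"
  shows "J \<subseteq> \<mm>"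
proof
  interpret cring R by (rule noetherian_local_ringD[OF assms(1)])
  fix a assume a: "a \<in> J"
  then have ac: "a \<in> carrier R" using ideal.Icarr[OF assms(2)] by auto
  show "a \<in> \<mm>"
  proof (rule ccontr)
    assume "a \<notin> \<mm>"
    then have "a \<in> Units R" using local_ring_unit[OF assms(1) ac] by auto
    then have "\<one> \<in> J" using ideal.I_l_closed[OF assms(2) a, of "inv a"] by simp
    then show False using ideal.one_imp_carrier[OF assms(2)] assms(3) by auto
  qed
qed

lemma local_ring_one_minus_unit:
  fixes R (structure)
  assumes "noetherian_local_ring R \<mm>" "t \<in> \<mm>"
  shows "\<one>\<^bsub>R\<^esub> \<ominus>\<^bsub>R\<^esub> t \<in> Units R"
proof (rule local_ring_unit[OF assms(1)])
  note R = noetherian_local_ringD[OF assms(1)]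
  interpret cring R by (rule R(1))
  interpret S: module R "self_module R" by (rule self_module_module[OF R(1)])
  have t: "t \<in> carrier R" using R(5) assms(2) by auto
  then show "\<one> \<ominus> t \<in> carrier R" by auto
  show "\<one> \<ominus> t \<notin> \<mm>"
    using S.submodule_mem_of_diff[OF ideal_submodule[OF R(1) R(4)] assms(2), of \<one>]
      local_ring_one_not_mem[OF assms(1)] by auto
qed


section \<open>Prime ideals\<close>

text \<open>The usual associated prime of \<open>M/N\<close>: a maximal one among the proper colon ideals is prime.\<close>

lemma (in module) exists_prime_colon:
  assumes "noetherian_ring R" "submodule N R M" "N \<noteq> carrier M"
  shows "\<exists>c\<in>carrier M - N. primeideal {r \<in> carrier R. r \<odot>\<^bsub>M\<^esub> c \<in> N} R"
proof -
  define P where "P c = {r \<in> carrier R. r \<odot>\<^bsub>M\<^esub> c \<in> N}" for c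
  note N = submoduleE[OF assms(2)] submodule_zero_mem[OF assms(2)]
  have Pid: "ideal (P c) R" if "c \<in> carrier M" for c
    unfolding P_def by (rule coefficient_ideal[OF assms(2) that])
  have "P ` (carrier M - N) \<noteq> {}" using assms(3) N(1) by auto
  then have "\<exists>I\<in>P ` (carrier M - N). \<forall>J\<in>P ` (carrier M - N). I \<subseteq> J \<longrightarrow> J = I"
    by (rule noetherian_ring_maximal_ideal[OF assms(1)]) (use Pid in auto)
  then obtain c where c: "c \<in> carrier M - N"
    "\<And>d. d \<in> carrier M - N \<Longrightarrow> P c \<subseteq> P d \<Longrightarrow> P d = P c"
    by blast
  have "primeideal (P c) R"
  proof (rule primeidealI[OF Pid R.is_cring])
    show "carrier R \<noteq> P c"
    proof
      assume "carrier R = P c"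
      then have "\<one> \<in> P c" using R.one_closed by metis
      then show False using c(1) by (simp add: P_def)
    qed
    fix a b assume ab: "a \<in> carrier R" "b \<in> carrier R" "a \<otimes> b \<in> P c"
    show "a \<in> P c \<or> b \<in> P c"
    proof (rule disjCI)
      assume "b \<notin> P c"
      then have "b \<odot>\<^bsub>M\<^esub> c \<in> carrier M - N" using ab c(1) by (auto simp: P_def)
      moreover have "P c \<subseteq> P (b \<odot>\<^bsub>M\<^esub> c)"
        using N(4) ab c(1) by (auto simp: P_def smult_commute[of _ b])
      ultimately have "P (b \<odot>\<^bsub>M\<^esub> c) = P c" using c(2) by blast
      moreover have "a \<in> P (b \<odot>\<^bsub>M\<^esub> c)"
        using ab c(1) by (simp add: P_def smult_assoc1)
      ultimately show "a \<in> P c" by simp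
    qed
  qed (use c in auto)
  then show ?thesis using c(1) by (auto simp: P_def)
qed

text \<open>The multiplicative set generated by \<open>x\<close> and the complement of \<open>P\<close> avoids \<open>0\<close> because \<open>x\<close> is
regular. An ideal that is maximal among those disjoint from it is prime, is contained in \<open>P\<close>, and
does not contain \<open>x\<close>.\<close>

lemma regular_element_not_in_minimal_prime:
  fixes R (structure)
  assumes "cring R" "noetherian_ring R" "x \<in> carrier R"
    and reg: "\<And>y. y \<in> carrier R \<Longrightarrow> x \<otimes>\<^bsub>R\<^esub> y = \<zero>\<^bsub>R\<^esub> \<Longrightarrow> y = \<zero>\<^bsub>R\<^esub>"
    and P: "primeideal P R" "x \<in> P"
  shows "\<exists>Q. primeideal Q R \<and> Q \<subset> P"
proof -
  interpret cring R by fact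
  interpret P: primeideal P R by fact
  interpret S: module R "self_module R" by (rule self_module_module[OF assms(1)])
  define S where "S = {x [^] n \<otimes> s |(n::nat) s. s \<in> carrier R - P}"
  have pow: "y = \<zero>" if "y \<in> carrier R" "x [^] n \<otimes> y = \<zero>" for y and n :: nat
    using that
  proof (induction n arbitrary: y)
    case (Suc n)
    have "x [^] n \<otimes> (x \<otimes> y) = \<zero>" using Suc.prems assms(3) by (simp add: m_assoc)
    then have "x \<otimes> y = \<zero>" using Suc.IH[of "x \<otimes> y"] Suc.prems(1) assms(3) by auto
    then show ?case using reg Suc.prems(1) by auto
  qed simp
  have zS: "\<zero> \<notin> S"
  proof
    assume "\<zero> \<in> S"
    then obtain n :: nat and s where s: "s \<in> carrier R - P" "\<zero> = x [^] n \<otimes> s" by (auto simp: S_def)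
    then have "s = \<zero>" using pow[of s n] by auto
    then show False using s P.zero_closed by auto
  qed
  have mS: "s \<otimes> t \<in> S" if st: "s \<in> S" "t \<in> S" for s t
  proof -
    obtain n :: nat and s' where s: "s' \<in> carrier R - P" "s = x [^] n \<otimes> s'" using st(1) by (auto simp: S_def)
    obtain m :: nat and t' where t: "t' \<in> carrier R - P" "t = x [^] m \<otimes> t'" using st(2) by (auto simp: S_def)
    have "s \<otimes> t = x [^] (n + m) \<otimes> (s' \<otimes> t')"
      using s t assms(3) by (simp add: nat_pow_mult[symmetric] m_ac)
    moreover have "s' \<otimes> t' \<in> carrier R - P" using s t P.I_prime by auto
    ultimately show ?thesis by (auto simp: S_def)
  qed
  have notP: "s \<in> S" if "s \<in> carrier R" "s \<notin> P" for s
  proof -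
    have "s = x [^] (0::nat) \<otimes> s" using that by simp
    then show ?thesis using that unfolding S_def by blast
  qed
  have oneP: "\<one> \<notin> P" using P.one_imp_carrier P.I_notcarr by auto
  let ?\<S> = "{J. ideal J R \<and> J \<inter> S = {}}"
  have "{\<zero>} \<in> ?\<S>" using zS zeroideal by auto
  then have "\<exists>J\<in>?\<S>. \<forall>J'\<in>?\<S>. J \<subseteq> J' \<longrightarrow> J' = J"
    by (intro noetherian_ring_maximal_ideal[OF assms(2)]) auto
  then obtain Q where Q: "ideal Q R" "Q \<inter> S = {}"
    and max: "\<And>J. ideal J R \<Longrightarrow> J \<inter> S = {} \<Longrightarrow> Q \<subseteq> J \<Longrightarrow> J = Q"
    by (elim bexE) auto
  interpret Q: ideal Q R by fact
  have meets: "\<exists>q\<in>Q. \<exists>r\<in>carrier R. q \<oplus> r \<otimes> a \<in> S" if a: "a \<in> carrier R" "a \<notin> Q" for a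
  proof -
    let ?J = "adjoin_element R (self_module R) Q a"
    have sQ: "submodule Q R (self_module R)" by (rule ideal_submodule[OF assms(1) Q(1)])
    have "ideal ?J R"
      using S.adjoin_element_submodule[OF sQ, of a] a by (simp add: submodule_self_module_iff[OF assms(1)])
    moreover have "Q \<subseteq> ?J" "?J \<noteq> Q"
      using S.adjoin_element_superset[OF sQ, of a] a by auto
    ultimately have "?J \<inter> S \<noteq> {}" using max by blast
    then obtain j where "j \<in> ?J" "j \<in> S" by auto
    then show ?thesis by (auto simp: adjoin_element_def)
  qed
  have "primeideal Q R"
  proof (rule primeidealI[OF Q(1) assms(1)])
    show "carrier R \<noteq> Q" using notP[OF one_closed oneP] Q(2) by auto
    fix a b assume ab: "a \<in> carrier R" "b \<in> carrier R" "a \<otimes> b \<in> Q"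
    show "a \<in> Q \<or> b \<in> Q"
    proof (rule ccontr)
      assume "\<not> (a \<in> Q \<or> b \<in> Q)"
      then obtain q r q' r' where q: "q \<in> Q" "r \<in> carrier R" "q \<oplus> r \<otimes> a \<in> S"
        and q': "q' \<in> Q" "r' \<in> carrier R" "q' \<oplus> r' \<otimes> b \<in> S"
        using meets ab by meson
      have "(q \<oplus> r \<otimes> a) \<otimes> (q' \<oplus> r' \<otimes> b) =
        q \<otimes> (q' \<oplus> r' \<otimes> b) \<oplus> ((r \<otimes> a) \<otimes> q' \<oplus> (r \<otimes> r') \<otimes> (a \<otimes> b))"
        using q q' ab Q.Icarr by (simp add: l_distr r_distr m_ac)
      also have "\<dots> \<in> Q"
        using q q' ab Q.Icarr Q.I_l_closed Q.I_r_closed by (intro Q.a_closed) auto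
      finally show False using mS[OF q(3) q'(3)] Q(2) by auto
    qed
  qed
  moreover have "Q \<subseteq> P" using notP Q(2) Q.Icarr by blast
  moreover have "x \<notin> Q"
  proof -
    have "x = x [^] (1::nat) \<otimes> \<one>" using assms(3) by simp
    then have "x \<in> S" unfolding S_def using oneP by blast
    then show ?thesis using Q(2) by auto
  qed
  ultimately show ?thesis using P(2) by auto
qed

lemma krull_dim_ge:
  assumes "\<And>i. i \<le> n \<Longrightarrow> primeideal (P i) R" "\<And>i. i < n \<Longrightarrow> P i \<subset> P (Suc i)"
  shows "enat n \<le> krull_dim R"
  unfolding krull_dim_def by (rule Sup_upper) (use assms in auto)

lemma prime_over_regular_element:
  assumes "noetherian_local_ring R \<mm>" "krull_dim R = 1" "x \<in> carrier R"
    and reg: "\<And>y. y \<in> carrier R \<Longrightarrow> x \<otimes>\<^bsub>R\<^esub> y = \<zero>\<^bsub>R\<^esub> \<Longrightarrow> y = \<zero>\<^bsub>R\<^esub>"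
    and P: "primeideal P R" "x \<in> P"
  shows "P = \<mm>"
proof (rule ccontr)
  assume "P \<noteq> \<mm>"
  note R = noetherian_local_ringD[OF assms(1)]
  interpret P: primeideal P R by fact
  have Pm: "P \<subset> \<mm>"
    using local_ring_proper_ideal[OF assms(1) P.is_ideal] P.I_notcarr \<open>P \<noteq> \<mm>\<close> by auto
  obtain Q where Q: "primeideal Q R" "Q \<subset> P"
    using regular_element_not_in_minimal_prime[OF R(1,2) assms(3) reg P] by blast
  define C where "C i = (if i = 0 then Q else if i = 1 then P else \<mm>)" for i :: nat
  have "enat 2 \<le> krull_dim R"
    by (rule krull_dim_ge[of 2 C]) (use Q P R(7) Pm in \<open>auto simp: C_def\<close>)
  then show False using assms(2) by (simp add: one_enat_def)
qed

lemma quotient_primeideal: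
  fixes R (structure)
  assumes "cring R" "ideal I R" "primeideal P R" "I \<subseteq> P"
  shows "primeideal ((+>\<^bsub>R\<^esub>) I ` P) (R Quot I)"
proof -
  interpret cring R by fact
  interpret I: ideal I R by fact
  interpret P: primeideal P R by fact
  have mem: "a \<in> P" if a: "a \<in> carrier R" "I +> a \<in> (+>) I ` P" for a
  proof -
    obtain p where p: "p \<in> P" "I +> a = I +> p" using a by auto
    have "a \<in> I +> p" using I.a_rcos_self[OF a(1)] p(2) by simp
    then obtain i where "i \<in> I" "a = i \<oplus> p" by (auto simp: a_r_coset_def')
    then show ?thesis using assms(4) p(1) by auto
  qed
  show ?thesis
  proof (rule primeidealI)
    show "ideal ((+>) I ` P) (R Quot I)"
      by (rule ring_ideal_imp_quot_ideal[OF assms(2) P.is_ideal])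
    show "cring (R Quot I)" by (rule I.quotient_is_cring[OF assms(1)])
    show "carrier (R Quot I) \<noteq> (+>) I ` P"
    proof
      assume "carrier (R Quot I) = (+>) I ` P"
      moreover have "I +> \<one> \<in> carrier (R Quot I)" by (auto simp: FactRing_def A_RCOSETS_def')
      ultimately have "\<one> \<in> P" using mem[of \<one>] by auto
      then show False using P.one_imp_carrier P.I_notcarr by auto
    qed
    fix X Y assume XY: "X \<in> carrier (R Quot I)" "Y \<in> carrier (R Quot I)"
      "X \<otimes>\<^bsub>R Quot I\<^esub> Y \<in> (+>) I ` P"
    then obtain a b where ab: "a \<in> carrier R" "b \<in> carrier R" "X = I +> a" "Y = I +> b"
      by (auto simp: FactRing_def A_RCOSETS_def')
    then have "I +> (a \<otimes> b) \<in> (+>) I ` P"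
      using XY(3) I.rcoset_mult_add[of a b] by (simp add: FactRing_def)
    then have "a \<otimes> b \<in> P" by (rule mem[rotated]) (use ab in simp)
    then have "a \<in> P \<or> b \<in> P" by (rule P.I_prime[OF ab(1,2)])
    then show "X \<in> (+>) I ` P \<or> Y \<in> (+>) I ` P" using ab by auto
  qed
qed

lemma prime_over_ideal_dim_zero:
  fixes R (structure)
  assumes "noetherian_local_ring R \<mm>" "ideal I R" "krull_dim (R Quot I) = 0"
    and P: "primeideal P R" "I \<subseteq> P"
  shows "P = \<mm>"
proof (rule ccontr)
  assume "P \<noteq> \<mm>"
  note R = noetherian_local_ringD[OF assms(1)]
  interpret cring R by (rule R(1))
  interpret I: ideal I R by fact
  interpret P: primeideal P R by fact
  have Pm: "P \<subset> \<mm>"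
    using local_ring_proper_ideal[OF assms(1) P.is_ideal] P.I_notcarr \<open>P \<noteq> \<mm>\<close> by auto
  obtain x where x: "x \<in> \<mm>" "x \<notin> P" using Pm by auto
  have "I +> x \<notin> (+>) I ` P"
  proof
    assume "I +> x \<in> (+>) I ` P"
    then obtain p where p: "p \<in> P" "I +> x = I +> p" by auto
    have "x \<in> I +> p" using I.a_rcos_self[of x] x(1) R(5) p(2) by auto
    then obtain i where "i \<in> I" "x = i \<oplus> p" by (auto simp: a_r_coset_def')
    then show False using P(2) p(1) x(2) by auto
  qed
  then have "(+>) I ` P \<subset> (+>) I ` \<mm>" using x(1) Pm by blast
  moreover have "primeideal ((+>) I ` P) (R Quot I)" "primeideal ((+>) I ` \<mm>) (R Quot I)"
    using quotient_primeideal[OF R(1) assms(2)] P R(7) Pm by auto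
  ultimately have "enat 1 \<le> krull_dim (R Quot I)"
    by (intro krull_dim_ge[of 1 "\<lambda>i. if i = 0 then (+>) I ` P else (+>) I ` \<mm>"]) auto
  then show False using assms(3) by (simp add: zero_enat_def)
qed


section \<open>Series with simple steps\<close>

text \<open>A composition series, described by one new generator for each step that is multiplied by the
maximal ideal into the preceding member.\<close>

definition simple_series ::
  "('a, 'r) ring_scheme \<Rightarrow> 'a set \<Rightarrow> ('a, 'b, 'p) module_scheme \<Rightarrow> (nat \<Rightarrow> 'b set) \<Rightarrow> nat \<Rightarrow> bool" where
  "simple_series R \<mm> M E l \<longleftrightarrow> (\<forall>i\<le>l. submodule (E i) R M) \<and>
     (\<forall>i<l. \<exists>u\<in>carrier M - E i. E (Suc i) = adjoin_element R M (E i) u \<and> (\<forall>a\<in>\<mm>. a \<odot>\<^bsub>M\<^esub> u \<in> E i))"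

text \<open>The hypothesis on primes says that \<open>M/N\<close> is supported at the maximal ideal only. As long as a series
has not reached \<open>M\<close>, an associated prime of the remaining quotient, necessarily \<open>\<mm>\<close>, yields one more
step; the Noetherian property ends this.\<close>

lemma (in module) simple_series_exists:
  assumes R: "noetherian_local_ring R \<mm>" and M: "noetherian_module R M" and N: "submodule N R M"
    and P: "\<And>P. primeideal P R \<Longrightarrow> {r \<in> carrier R. \<forall>y\<in>carrier M. r \<odot>\<^bsub>M\<^esub> y \<in> N} \<subseteq> P \<Longrightarrow> P = \<mm>"
  shows "\<exists>E l. simple_series R \<mm> M E l \<and> E 0 = N \<and> E l = carrier M"
proof -
  let ?\<S> = "{Q. submodule Q R M \<and> N \<subseteq> Q \<and> (\<exists>E l. simple_series R \<mm> M E l \<and> E 0 = N \<and> E l = Q)}"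
  have "simple_series R \<mm> M (\<lambda>_. N) 0" using N by (auto simp: simple_series_def)
  then have "N \<in> ?\<S>" using N by blast
  then have ne: "?\<S> \<noteq> {} \<and> (\<forall>Q\<in>?\<S>. submodule Q R M)" by blast
  have "\<exists>Q\<in>?\<S>. \<forall>Q'\<in>?\<S>. Q \<subseteq> Q' \<longrightarrow> Q' = Q"
    using M[unfolded noetherian_module_def, rule_format, OF ne] .
  then obtain Q where Q: "Q \<in> ?\<S>" and max: "\<forall>Q'\<in>?\<S>. Q \<subseteq> Q' \<longrightarrow> Q' = Q" by (rule bexE)
  then have sQ: "submodule Q R M" and NQ: "N \<subseteq> Q" by auto
  obtain E l where E: "simple_series R \<mm> M E l" "E 0 = N" "E l = Q" using Q by auto
  have "Q = carrier M"
  proof (rule ccontr)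
    assume "Q \<noteq> carrier M"
    then obtain c where c: "c \<in> carrier M - Q" "primeideal {r \<in> carrier R. r \<odot>\<^bsub>M\<^esub> c \<in> Q} R"
      using exists_prime_colon[OF noetherian_local_ringD(2)[OF R] sQ] by auto
    have "{r \<in> carrier R. r \<odot>\<^bsub>M\<^esub> c \<in> Q} = \<mm>" using NQ c(1) by (intro P[OF c(2)]) auto
    then have mc: "\<forall>a\<in>\<mm>. a \<odot>\<^bsub>M\<^esub> c \<in> Q" by auto
    let ?Q' = "adjoin_element R M Q c"
    let ?E = "E(Suc l := ?Q')"
    have c': "c \<in> carrier M" using c(1) by auto
    note Q' = adjoin_element_submodule[OF sQ c'] adjoin_element_superset[OF sQ c']
    have "simple_series R \<mm> M ?E (Suc l)"
      unfolding simple_series_def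
    proof (intro conjI allI impI)
      fix i assume "i \<le> Suc l"
      then show "submodule (?E i) R M" using E(1) Q'(1) by (auto simp: simple_series_def)
    next
      fix i assume "i < Suc l"
      show "\<exists>u\<in>carrier M - ?E i. ?E (Suc i) = adjoin_element R M (?E i) u \<and> (\<forall>a\<in>\<mm>. a \<odot>\<^bsub>M\<^esub> u \<in> ?E i)"
      proof (cases "i = l")
        case True
        then show ?thesis using c(1) mc E(3) by (intro bexI[of _ c]) auto
      next
        case False
        then have "i < l" using \<open>i < Suc l\<close> by auto
        then show ?thesis using E(1) by (auto simp: simple_series_def)
      qed
    qed
    moreover have "?E 0 = N" "?E (Suc l) = ?Q'" using E(2) by auto
    ultimately have "?Q' \<in> ?\<S>" using Q' NQ by blast
    then have "?Q' = Q" using max Q'(2) by blast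
    then show False using Q'(3) c(1) by auto
  qed
  then show ?thesis using E by auto
qed

text \<open>That \<open>N'/N\<close> is zero or simple, stated elementwise so that it can be checked without forming quotients.
The descending chain of annihilators in the proof below has steps of this form, where the
quotient may be zero.\<close>

definition simple_step ::
  "('a, 'r) ring_scheme \<Rightarrow> ('a, 'b, 'p) module_scheme \<Rightarrow> 'b set \<Rightarrow> 'b set \<Rightarrow> bool" where
  "simple_step R M N N' \<longleftrightarrow> N \<subseteq> N' \<and> (\<forall>v\<in>N' - N. \<forall>u\<in>N'. \<exists>r\<in>carrier R. u \<ominus>\<^bsub>M\<^esub> r \<odot>\<^bsub>M\<^esub> v \<in> N)"

lemma (in module) simple_step_adjoin:
  assumes R: "noetherian_local_ring R \<mm>" and N: "submodule N R M" and c: "c \<in> carrier M"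
    and mc: "\<forall>a\<in>\<mm>. a \<odot>\<^bsub>M\<^esub> c \<in> N"
  shows "simple_step R M N (adjoin_element R M N c)"
  unfolding simple_step_def
proof (intro conjI ballI)
  note N' = submoduleE[OF N]
  have sub: "\<And>x. x \<in> N \<Longrightarrow> x \<in> carrier M" using N'(1) by auto
  show "N \<subseteq> adjoin_element R M N c" by (rule adjoin_element_superset[OF N c])
  fix v u assume v: "v \<in> adjoin_element R M N c - N" and u: "u \<in> adjoin_element R M N c"
  obtain n a where n: "n \<in> N" "a \<in> carrier R" "v = n \<oplus>\<^bsub>M\<^esub> a \<odot>\<^bsub>M\<^esub> c"
    using v by (auto simp: adjoin_element_def)
  obtain n' a' where n': "n' \<in> N" "a' \<in> carrier R" "u = n' \<oplus>\<^bsub>M\<^esub> a' \<odot>\<^bsub>M\<^esub> c"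
    using u by (auto simp: adjoin_element_def)
  have "a \<notin> \<mm>" using mc v n N'(5) by auto
  then have a: "a \<in> Units R" using local_ring_unit[OF R n(2)] by auto
  define r where "r = a' \<otimes> inv a"
  have r: "r \<in> carrier R" "r \<otimes> a = a'" using a n' n by (auto simp: r_def R.m_assoc)
  have rv: "r \<odot>\<^bsub>M\<^esub> v = r \<odot>\<^bsub>M\<^esub> n \<oplus>\<^bsub>M\<^esub> a' \<odot>\<^bsub>M\<^esub> c"
    using n sub c r by (simp add: smult_r_distr smult_assoc1[symmetric])
  have "u \<ominus>\<^bsub>M\<^esub> r \<odot>\<^bsub>M\<^esub> v = n' \<ominus>\<^bsub>M\<^esub> r \<odot>\<^bsub>M\<^esub> n"
  proof -
    have "a' \<odot>\<^bsub>M\<^esub> c \<oplus>\<^bsub>M\<^esub> (\<ominus>\<^bsub>M\<^esub> (r \<odot>\<^bsub>M\<^esub> n) \<oplus>\<^bsub>M\<^esub> \<ominus>\<^bsub>M\<^esub> (a' \<odot>\<^bsub>M\<^esub> c)) = \<ominus>\<^bsub>M\<^esub> (r \<odot>\<^bsub>M\<^esub> n)"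
      using n n' r sub c by (simp add: M.add.m_lcomm[of "a' \<odot>\<^bsub>M\<^esub> c"] M.r_neg)
    then show ?thesis
      unfolding rv n'(3) using n n' r sub c by (simp add: a_minus_def M.minus_add M.add.m_assoc)
  qed
  also have "\<dots> \<in> N" by (rule submodule_minus_mem[OF N n'(1)]) (use N'(4) n r in auto)
  finally show "\<exists>r\<in>carrier R. u \<ominus>\<^bsub>M\<^esub> r \<odot>\<^bsub>M\<^esub> v \<in> N" using r by auto
qed

lemma (in module) simple_series_simple_step:
  assumes "noetherian_local_ring R \<mm>" "simple_series R \<mm> M E l" "i < l"
  shows "simple_step R M (E i) (E (Suc i))"
proof -
  obtain u where "u \<in> carrier M" "E (Suc i) = adjoin_element R M (E i) u" "\<forall>a\<in>\<mm>. a \<odot>\<^bsub>M\<^esub> u \<in> E i"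
    using assms(2,3) unfolding simple_series_def by blast
  moreover have "submodule (E i) R M" using assms(2,3) by (auto simp: simple_series_def)
  ultimately show ?thesis using simple_step_adjoin[OF assms(1)] by simp
qed

text \<open>The part of Schreier's refinement theorem that is needed: refining the chain \<open>P\<close> by \<open>E\<close>, each
inclusion of \<open>P\<close> uses up at least one step of \<open>E\<close>.\<close>

theorem (in module) chain_length_le:
  assumes E: "\<And>i. i \<le> l \<Longrightarrow> submodule (E i) R M"
    and step: "\<And>i. i < l \<Longrightarrow> simple_step R M (E i) (E (Suc i))"
    and P: "\<And>i. i \<le> n \<Longrightarrow> submodule (P i) R M"
    and strict: "\<And>i. i < n \<Longrightarrow> P i \<subset> P (Suc i)"
    and "E 0 \<subseteq> P 0" "P n \<subseteq> E l"
  shows "n \<le> l"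
proof -
  \<comment> \<open>the steps of \<open>E\<close> that are filled by elements of \<open>P i\<close>\<close>
  define F where "F i = {j. j < l \<and> (\<exists>v\<in>P i \<inter> E (Suc j). v \<notin> E j)}" for i
  have fin: "finite (F i)" for i by (rule finite_subset[of _ "{..<l}"]) (auto simp: F_def)
  have mono: "P 0 \<subseteq> P i" if "i \<le> n" for i
    using that
  proof (induction i)
    case (Suc i)
    then show ?case using strict[of i] by auto
  qed simp
  have Pl: "P i \<subseteq> E l" if "i \<le> n" for i
    using that
  proof (induction rule: inc_induct)
    case (step i)
    then show ?case using strict[of i] by auto
  qed (use assms(6) in simp)
  have Fs: "F i \<subset> F (Suc i)" if i: "i < n" for i
  proof (rule ccontr)
    assume "\<not> F i \<subset> F (Suc i)"
    moreover have "F i \<subseteq> F (Suc i)" using strict[OF i] by (auto simp: F_def)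
    ultimately have eq: "F i = F (Suc i)" by auto
    have sP: "submodule (P i) R M" "submodule (P (Suc i)) R M" using P i by auto
    have "P (Suc i) \<inter> E j \<subseteq> P i" if "j \<le> l" for j
      using that
    proof (induction j)
      case 0
      then show ?case using assms(5) mono[of i] i by auto
    next
      case (Suc j)
      have IH: "P (Suc i) \<inter> E j \<subseteq> P i" using Suc by auto
      show ?case
      proof
        fix u assume u: "u \<in> P (Suc i) \<inter> E (Suc j)"
        have uc: "u \<in> carrier M" using u submoduleE(1)[OF sP(2)] by auto
        show "u \<in> P i"
        proof (cases "u \<in> E j")
          case False
          then have "j \<in> F (Suc i)" using u Suc.prems by (auto simp: F_def)
          then obtain v where v: "v \<in> P i" "v \<in> E (Suc j)" "v \<notin> E j" using eq by (auto simp: F_def)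
          then obtain r where r: "r \<in> carrier R" "u \<ominus>\<^bsub>M\<^esub> r \<odot>\<^bsub>M\<^esub> v \<in> E j"
            using step[of j] Suc.prems u unfolding simple_step_def by auto blast
          have rv: "r \<odot>\<^bsub>M\<^esub> v \<in> P i" using submoduleE(4)[OF sP(1) r(1) v(1)] .
          then have "u \<ominus>\<^bsub>M\<^esub> r \<odot>\<^bsub>M\<^esub> v \<in> P (Suc i)"
            using submodule_minus_mem[OF sP(2)] u strict[OF i] by blast
          then have "u \<ominus>\<^bsub>M\<^esub> r \<odot>\<^bsub>M\<^esub> v \<in> P i" using r(2) IH by auto
          then show ?thesis by (rule submodule_mem_of_diff[OF sP(1) rv uc])
        qed (use IH u in auto)
      qed
    qed
    from this[of l] have "P (Suc i) \<subseteq> P i" using Pl[of "Suc i"] i by auto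
    then show False using strict[OF i] by auto
  qed
  have "i \<le> card (F i)" if "i \<le> n" for i
    using that
  proof (induction i)
    case (Suc i)
    then have "card (F i) < card (F (Suc i))" using Fs[of i] fin by (intro psubset_card_mono) auto
    then show ?case using Suc by auto
  qed simp
  then have "n \<le> card (F n)" by auto
  also have "\<dots> \<le> card {..<l}" by (rule card_mono) (auto simp: F_def)
  finally show ?thesis by simp
qed


section \<open>Quotient modules and length\<close>

lemma (in module) submodule_abelian_subgroup:
  assumes "submodule N R M"
  shows "abelian_subgroup N M"
  by (rule abelian_subgroupI3[OF additive_subgroupI[OF submodule.axioms(1)[OF assms]]
        M.abelian_group_axioms])

lemma (in module) coset_eq_iff:
  assumes "submodule N R M" "x \<in> carrier M" "y \<in> carrier M"
  shows "N +>\<^bsub>M\<^esub> x = N +>\<^bsub>M\<^esub> y \<longleftrightarrow> x \<ominus>\<^bsub>M\<^esub> y \<in> N"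
proof -
  interpret N: abelian_subgroup N M by (rule submodule_abelian_subgroup[OF assms(1)])
  have "x \<in> N +>\<^bsub>M\<^esub> y \<longleftrightarrow> x \<ominus>\<^bsub>M\<^esub> y \<in> N"
    unfolding a_minus_def by (rule N.a_rcos_module[OF assms(3,2)])
  moreover have "x \<in> N +>\<^bsub>M\<^esub> y \<longleftrightarrow> N +>\<^bsub>M\<^esub> x = N +>\<^bsub>M\<^esub> y"
    using N.a_repr_independence'[OF _ assms(3), of x] N.a_rcos_self[OF assms(2)] by auto
  ultimately show ?thesis by simp
qed

lemma (in module) coset_eq_self_iff:
  assumes "submodule N R M" "x \<in> carrier M"
  shows "N +>\<^bsub>M\<^esub> x = N \<longleftrightarrow> x \<in> N"
proof -
  have "N +>\<^bsub>M\<^esub> \<zero>\<^bsub>M\<^esub> = N" using submoduleE(1)[OF assms(1)] by simp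
  moreover have z: "\<ominus>\<^bsub>M\<^esub> \<zero>\<^bsub>M\<^esub> = \<zero>\<^bsub>M\<^esub>"
    by (rule trans[OF M.l_zero[OF M.a_inv_closed[OF M.zero_closed], symmetric] M.r_neg[OF M.zero_closed]])
  ultimately show ?thesis using coset_eq_iff[OF assms, of "\<zero>\<^bsub>M\<^esub>"] assms(2)
    by (simp add: a_minus_def z)
qed

lemma (in module) mem_coset_iff:
  assumes "submodule N R M" "x \<in> carrier M" "y \<in> carrier M"
  shows "y \<in> N +>\<^bsub>M\<^esub> x \<longleftrightarrow> N +>\<^bsub>M\<^esub> y = N +>\<^bsub>M\<^esub> x"
proof -
  interpret N: abelian_subgroup N M by (rule submodule_abelian_subgroup[OF assms(1)])
  show ?thesis using N.a_repr_independence'[OF _ assms(2), of y] N.a_rcos_self[OF assms(3)] by auto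
qed

lemma (in module) coset_subset:
  assumes "submodule N R M" "x \<in> carrier M"
  shows "N +>\<^bsub>M\<^esub> x \<subseteq> carrier M" "x \<in> N +>\<^bsub>M\<^esub> x"
proof -
  interpret N: abelian_subgroup N M by (rule submodule_abelian_subgroup[OF assms(1)])
  show "N +>\<^bsub>M\<^esub> x \<subseteq> carrier M" using N.a_elemrcos_carrier[OF assms(2)] by auto
  show "x \<in> N +>\<^bsub>M\<^esub> x" by (rule N.a_rcos_self[OF assms(2)])
qed

lemma (in module) coset_smult:
  assumes "submodule N R M" "x \<in> carrier M" "a \<in> carrier R"
  shows "(\<Union>y\<in>N +>\<^bsub>M\<^esub> x. N +>\<^bsub>M\<^esub> (a \<odot>\<^bsub>M\<^esub> y)) = N +>\<^bsub>M\<^esub> (a \<odot>\<^bsub>M\<^esub> x)"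
proof -
  have "N +>\<^bsub>M\<^esub> (a \<odot>\<^bsub>M\<^esub> y) = N +>\<^bsub>M\<^esub> (a \<odot>\<^bsub>M\<^esub> x)" if "y \<in> N +>\<^bsub>M\<^esub> x" for y
  proof -
    have y: "y \<in> carrier M" using coset_subset(1)[OF assms(1,2)] that by auto
    then have "y \<ominus>\<^bsub>M\<^esub> x \<in> N"
      using that mem_coset_iff[OF assms(1,2) y] coset_eq_iff[OF assms(1) y assms(2)] by simp
    then have "a \<odot>\<^bsub>M\<^esub> (y \<ominus>\<^bsub>M\<^esub> x) \<in> N" using submoduleE(4)[OF assms(1) assms(3)] by auto
    then show ?thesis
      using coset_eq_iff[OF assms(1), of "a \<odot>\<^bsub>M\<^esub> y" "a \<odot>\<^bsub>M\<^esub> x"] smult_diff_distr y assms by simp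
  qed
  then show ?thesis using coset_subset(2)[OF assms(1,2)] by blast
qed

lemma (in module) coset_add:
  assumes "submodule N R M" "x \<in> carrier M" "y \<in> carrier M"
  shows "(N +>\<^bsub>M\<^esub> x) <+>\<^bsub>M\<^esub> (N +>\<^bsub>M\<^esub> y) = N +>\<^bsub>M\<^esub> (x \<oplus>\<^bsub>M\<^esub> y)"
  by (rule abelian_subgroup.a_rcos_sum[OF submodule_abelian_subgroup[OF assms(1)] assms(2,3)])

lemma (in module) quot_module_simps:
  assumes "submodule N R M"
  shows "carrier (quot_module M N) = (\<lambda>x. N +>\<^bsub>M\<^esub> x) ` carrier M"
    and "\<zero>\<^bsub>quot_module M N\<^esub> = N +>\<^bsub>M\<^esub> \<zero>\<^bsub>M\<^esub>"
    and "x \<in> carrier M \<Longrightarrow> y \<in> carrier M \<Longrightarrow>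
      (N +>\<^bsub>M\<^esub> x) \<oplus>\<^bsub>quot_module M N\<^esub> (N +>\<^bsub>M\<^esub> y) = N +>\<^bsub>M\<^esub> (x \<oplus>\<^bsub>M\<^esub> y)"
    and "a \<in> carrier R \<Longrightarrow> x \<in> carrier M \<Longrightarrow>
      a \<odot>\<^bsub>quot_module M N\<^esub> (N +>\<^bsub>M\<^esub> x) = N +>\<^bsub>M\<^esub> (a \<odot>\<^bsub>M\<^esub> x)"
  using coset_add[OF assms] coset_smult[OF assms] submoduleE(1)[OF assms]
  by (auto simp: quot_module_def A_RCOSETS_def')

lemma (in module) quot_module_module:
  assumes "submodule N R M"
  shows "module R (quot_module M N)"
proof (rule moduleI)
  note q = quot_module_simps[OF assms]
  show "cring R" by (rule R.is_cring)
  show "abelian_group (quot_module M N)"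
  proof (rule abelian_groupI)
    fix X assume "X \<in> carrier (quot_module M N)"
    then obtain x where "x \<in> carrier M" "X = N +>\<^bsub>M\<^esub> x" by (auto simp: q)
    then show "\<exists>Y\<in>carrier (quot_module M N). Y \<oplus>\<^bsub>quot_module M N\<^esub> X = \<zero>\<^bsub>quot_module M N\<^esub>"
      by (intro bexI[of _ "N +>\<^bsub>M\<^esub> (\<ominus>\<^bsub>M\<^esub> x)"]) (auto simp: q M.l_neg)
  qed (auto simp: q M.add.m_ac)
qed (use quot_module_simps[OF assms] in \<open>auto simp: smult_l_distr smult_r_distr smult_assoc1\<close>)

lemma (in module) quot_module_proj_hom:
  assumes "submodule N R M"
  shows "(\<lambda>x. N +>\<^bsub>M\<^esub> x) \<in> module_homs R M (quot_module M N)"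
  by (rule module_homsI) (auto simp: quot_module_simps[OF assms])

text \<open>The correspondence of submodules; it lets all later length computations take place in \<open>M\<close>.\<close>

theorem (in module) module_length_quot_module:
  assumes N: "submodule N R M"
  shows "module_length R (quot_module M N) = Sup {enat n |n. \<exists>P. (\<forall>i\<le>n. submodule (P i) R M) \<and>
    (\<forall>i<n. P i \<subset> P (Suc i)) \<and> N \<subseteq> P 0}"
proof -
  let ?Q = "quot_module M N"
  let ?p = "\<lambda>x. N +>\<^bsub>M\<^esub> x"
  note q = quot_module_simps[OF N]
  note Q = quot_module_module[OF N]
  note p = quot_module_proj_hom[OF N]
  have "(\<exists>P. (\<forall>i\<le>n. submodule (P i) R M) \<and> (\<forall>i<n. P i \<subset> P (Suc i)) \<and> N \<subseteq> P 0) \<longleftrightarrow>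
    (\<exists>P. (\<forall>i\<le>n. submodule (P i) R ?Q) \<and> (\<forall>i<n. P i \<subset> P (Suc i)))" (is "?A \<longleftrightarrow> ?B") for n
  proof
    assume ?A
    then obtain P where P: "\<And>i. i \<le> n \<Longrightarrow> submodule (P i) R M" "\<And>i. i < n \<Longrightarrow> P i \<subset> P (Suc i)" "N \<subseteq> P 0"
      by auto
    have NP: "N \<subseteq> P i" if "i \<le> n" for i
      using that
    proof (induction i)
      case (Suc i)
      then show ?case using P(2)[of i] by auto
    qed (use P(3) in simp)
    have "?p ` P i \<subset> ?p ` P (Suc i)" if i: "i < n" for i
    proof -
      obtain x where x: "x \<in> P (Suc i)" "x \<notin> P i" using P(2)[OF i] by auto
      have xc: "x \<in> carrier M" using submoduleE(1)[OF P(1)[of "Suc i"]] i x by auto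
      have "?p x \<notin> ?p ` P i"
      proof
        assume "?p x \<in> ?p ` P i"
        then obtain y where y: "y \<in> P i" "?p x = ?p y" by auto
        have si: "submodule (P i) R M" using P(1) i by auto
        have "x \<ominus>\<^bsub>M\<^esub> y \<in> N" using y coset_eq_iff[OF N xc, of y] submoduleE(1)[OF si] by auto
        then have "x \<in> P i" using submodule_mem_of_diff[OF si y(1) xc] NP[of i] i by auto
        then show False using x by simp
      qed
      then show ?thesis using x P(2)[OF i] by blast
    qed
    moreover have "submodule (?p ` P i) R ?Q" if "i \<le> n" for i
      by (rule module_homs_image_submodule[OF module_axioms Q p P(1)[OF that]])
    ultimately show ?B by (intro exI[of _ "\<lambda>i. ?p ` P i"]) auto
  next
    assume ?B
    then obtain P where P: "\<And>i. i \<le> n \<Longrightarrow> submodule (P i) R ?Q" "\<And>i. i < n \<Longrightarrow> P i \<subset> P (Suc i)"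
      by auto
    let ?P = "\<lambda>i. {x \<in> carrier M. ?p x \<in> P i}"
    have sub: "P i \<subseteq> ?p ` carrier M" if "i \<le> n" for i
      using module.submoduleE(1)[OF Q P(1)[OF that]] by (simp add: q)
    have "?P i \<subset> ?P (Suc i)" if i: "i < n" for i
    proof -
      obtain X where X: "X \<in> P (Suc i)" "X \<notin> P i" using P(2)[OF i] by auto
      then obtain x where "x \<in> carrier M" "X = ?p x" using sub[of "Suc i"] i by auto
      then have "x \<in> ?P (Suc i)" "x \<notin> ?P i" using X by auto
      moreover have "?P i \<subseteq> ?P (Suc i)" using P(2)[OF i] by auto
      ultimately show ?thesis by blast
    qed
    moreover have "submodule (?P i) R M" if "i \<le> n" for i
      by (rule module_homs_vimage_submodule[OF module_axioms Q p P(1)[OF that]])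
    moreover have "N \<subseteq> ?P 0"
    proof
      fix x assume x: "x \<in> N"
      then have xc: "x \<in> carrier M" using submoduleE(1)[OF N] by auto
      have "?p x = \<zero>\<^bsub>?Q\<^esub>" using coset_eq_self_iff[OF N xc] coset_eq_self_iff[OF N M.zero_closed] x submodule_zero_mem[OF N]
        by (simp add: q)
      then show "x \<in> ?P 0" using xc submodule_zero_mem[OF P(1)[of 0]] by simp
    qed
    ultimately show ?A by (intro exI[of _ ?P]) blast
  qed
  then show ?thesis unfolding module_length_def by simp
qed


section \<open>The socle of a canonical module modulo a regular element\<close>

lemma (in module) submodule_of_submodule:
  assumes "submodule Z R M" "submodule P R M" "P \<subseteq> Z"
  shows "submodule P R (M\<lparr>carrier := Z\<rparr>)"
proof -
  interpret Z: module R "M\<lparr>carrier := Z\<rparr>"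
    by (rule submodule.submodule_is_module[OF assms(1) module_axioms])
  show ?thesis
    by (rule Z.module_incl_imp_submodule)
       (use assms(3) submodule.submodule_is_module[OF assms(2) module_axioms] in auto)
qed

text \<open>Otherwise \<open>N\<close>, \<open>N + Rv\<close> and \<open>M\<close> would form a chain with two proper inclusions.\<close>

lemma (in module) quotient_length_one:
  assumes N: "submodule N R M" and len: "module_length R (quot_module M N) = enat 1"
    and v: "v \<in> carrier M" "v \<notin> N"
  shows "adjoin_element R M N v = carrier M"
proof (rule ccontr)
  assume ne: "adjoin_element R M N v \<noteq> carrier M"
  note a = adjoin_element_submodule[OF N v(1)] adjoin_element_superset[OF N v(1)]
  define P where "P i = (if i = 0 then N else if i = 1 then adjoin_element R M N v else carrier M)"
    for i :: nat
  have "P i \<subset> P (Suc i)" if "i < 2" for i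
  proof -
    have "i = 0 \<or> i = 1" using that by auto
    then show ?thesis using a v ne submoduleE(1)[OF a(1)] by (auto simp: P_def)
  qed
  moreover have "submodule (P i) R M" for i using N a(1) carrier_is_submodule by (auto simp: P_def)
  ultimately have "(\<forall>i\<le>2. submodule (P i) R M) \<and> (\<forall>i<2. P i \<subset> P (Suc i)) \<and> N \<subseteq> P 0"
    by (auto simp: P_def)
  then have "enat 2 \<le> module_length R (quot_module M N)"
    unfolding module_length_quot_module[OF N] by (intro Sup_upper) blast
  then show False using len by simp
qed

lemma hom_module_simps:
  "carrier (hom_module R M N) = module_homs R M N \<inter> extensional (carrier M)"
  "\<zero>\<^bsub>hom_module R M N\<^esub> = (\<lambda>x\<in>carrier M. \<zero>\<^bsub>N\<^esub>)"
  "f \<oplus>\<^bsub>hom_module R M N\<^esub> g = (\<lambda>x\<in>carrier M. f x \<oplus>\<^bsub>N\<^esub> g x)"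
  "a \<odot>\<^bsub>hom_module R M N\<^esub> f = (\<lambda>x\<in>carrier M. a \<odot>\<^bsub>N\<^esub> f x)"
  by (simp_all add: hom_module_def)

lemma hom_module_module:
  fixes R (structure)
  assumes "module R M" "module R N"
  shows "module R (hom_module R M N)"
proof -
  interpret M: module R M by fact
  interpret N: module R N by fact
  let ?H = "hom_module R M N"
  have HI: "(\<lambda>x\<in>carrier M. f x) \<in> carrier ?H"
    if f: "\<And>x. x \<in> carrier M \<Longrightarrow> f x \<in> carrier N"
      "\<And>x y. x \<in> carrier M \<Longrightarrow> y \<in> carrier M \<Longrightarrow> f (x \<oplus>\<^bsub>M\<^esub> y) = f x \<oplus>\<^bsub>N\<^esub> f y"
      "\<And>a x. a \<in> carrier R \<Longrightarrow> x \<in> carrier M \<Longrightarrow> f (a \<odot>\<^bsub>M\<^esub> x) = a \<odot>\<^bsub>N\<^esub> f x" for f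
    using f by (auto simp: hom_module_simps intro!: module_homsI)
  have H: "f x \<in> carrier N" "f \<in> extensional (carrier M)" "f \<in> module_homs R M N"
    if "f \<in> carrier ?H" "x \<in> carrier M" for f x
    using that by (auto simp: hom_module_simps dest: module_homsD(1))
  have Hext: "f \<in> extensional (carrier M)" if "f \<in> carrier ?H" for f
    using that by (simp add: hom_module_simps)
  show ?thesis
  proof (rule moduleI)
    show "cring R" by (rule M.R.is_cring)
    show "abelian_group ?H"
    proof (rule abelian_groupI)
      fix f g assume f: "f \<in> carrier ?H" and g: "g \<in> carrier ?H"
      note fh = module_homsD[OF H(3)[OF f]] and gh = module_homsD[OF H(3)[OF g]]
      show "f \<oplus>\<^bsub>?H\<^esub> g \<in> carrier ?H"
        unfolding hom_module_simps(3)
        by (rule HI) (use fh gh in \<open>auto simp: N.smult_r_distr N.M.add.m_ac\<close>)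
      show "f \<oplus>\<^bsub>?H\<^esub> g = g \<oplus>\<^bsub>?H\<^esub> f"
        unfolding hom_module_simps(3)
        by (rule restrict_ext) (use fh gh in \<open>auto simp: N.M.add.m_comm\<close>)
    next
      fix f g k assume "f \<in> carrier ?H" "g \<in> carrier ?H" "k \<in> carrier ?H"
      then show "f \<oplus>\<^bsub>?H\<^esub> g \<oplus>\<^bsub>?H\<^esub> k = f \<oplus>\<^bsub>?H\<^esub> (g \<oplus>\<^bsub>?H\<^esub> k)"
        unfolding hom_module_simps(3)
        by (intro restrict_ext) (use H(1) in \<open>auto simp: N.M.add.m_assoc\<close>)
    next
      show "\<zero>\<^bsub>?H\<^esub> \<in> carrier ?H" unfolding hom_module_simps(2) by (rule HI) auto
    next
      fix f assume f: "f \<in> carrier ?H"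
      note fh = module_homsD[OF H(3)[OF f]]
      show "\<zero>\<^bsub>?H\<^esub> \<oplus>\<^bsub>?H\<^esub> f = f"
        unfolding hom_module_simps(2,3)
        by (rule extensionalityI[OF _ Hext[OF f]]) (use H(1)[OF f] in auto)
      let ?g = "\<lambda>x\<in>carrier M. \<ominus>\<^bsub>N\<^esub> f x"
      have "?g \<in> carrier ?H"
        by (rule HI) (use fh in \<open>auto simp: N.smult_r_minus N.M.minus_add\<close>)
      moreover have "?g \<oplus>\<^bsub>?H\<^esub> f = \<zero>\<^bsub>?H\<^esub>"
        unfolding hom_module_simps(2,3)
        by (rule restrict_ext) (use H(1)[OF f] in \<open>auto simp: N.M.l_neg\<close>)
      ultimately show "\<exists>g\<in>carrier ?H. g \<oplus>\<^bsub>?H\<^esub> f = \<zero>\<^bsub>?H\<^esub>" by blast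
    qed
  next
    fix a f assume a: "a \<in> carrier R" and f: "f \<in> carrier ?H"
    note fh = module_homsD[OF H(3)[OF f]]
    show "a \<odot>\<^bsub>?H\<^esub> f \<in> carrier ?H"
      unfolding hom_module_simps(4)
      by (rule HI) (use fh a in \<open>auto simp: N.smult_r_distr N.smult_commute[of a]\<close>)
    {
      fix b assume b: "b \<in> carrier R"
      show "(a \<oplus> b) \<odot>\<^bsub>?H\<^esub> f = a \<odot>\<^bsub>?H\<^esub> f \<oplus>\<^bsub>?H\<^esub> b \<odot>\<^bsub>?H\<^esub> f"
        unfolding hom_module_simps(3,4)
        by (rule restrict_ext) (use H(1)[OF f] a b in \<open>auto simp: N.smult_l_distr\<close>)
      show "(a \<otimes> b) \<odot>\<^bsub>?H\<^esub> f = a \<odot>\<^bsub>?H\<^esub> (b \<odot>\<^bsub>?H\<^esub> f)"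
        unfolding hom_module_simps(4)
        by (rule restrict_ext) (use H(1)[OF f] a b in \<open>auto simp: N.smult_assoc1\<close>)
    }
    {
      fix g assume g: "g \<in> carrier ?H"
      show "a \<odot>\<^bsub>?H\<^esub> (f \<oplus>\<^bsub>?H\<^esub> g) = a \<odot>\<^bsub>?H\<^esub> f \<oplus>\<^bsub>?H\<^esub> a \<odot>\<^bsub>?H\<^esub> g"
        unfolding hom_module_simps(3,4)
        by (rule restrict_ext) (use H(1)[OF f] H(1)[OF g] a in \<open>auto simp: N.smult_r_distr\<close>)
    }
  next
    fix f assume f: "f \<in> carrier ?H"
    show "\<one> \<odot>\<^bsub>?H\<^esub> f = f"
      unfolding hom_module_simps(4)
      by (rule extensionalityI[OF _ Hext[OF f]]) (use H(1)[OF f] in auto)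
  qed
qed

lemma compose_hom_module_hom:
  assumes "module R N" "f \<in> module_homs R M M'"
  shows "compose (carrier N) f \<in> module_homs R (hom_module R N M) (hom_module R N M')"
proof (rule module_homsI)
  interpret N: module R N by fact
  note f = module_homsD[OF assms(2)]
  fix g assume "g \<in> carrier (hom_module R N M)"
  then have "g \<in> module_homs R N M" by (simp add: hom_module_simps)
  note g = module_homsD[OF this]
  show "compose (carrier N) f g \<in> carrier (hom_module R N M')"
    using f g by (auto simp: hom_module_simps compose_def intro!: module_homsI)
  {
    fix g' assume "g' \<in> carrier (hom_module R N M)"
    then have "g' \<in> module_homs R N M" by (simp add: hom_module_simps)
    note g' = module_homsD[OF this]
    show "compose (carrier N) f (g \<oplus>\<^bsub>hom_module R N M\<^esub> g') =
      compose (carrier N) f g \<oplus>\<^bsub>hom_module R N M'\<^esub> compose (carrier N) f g'"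
      using f(2) g(1) g'(1) by (auto simp: hom_module_simps compose_def intro!: restrict_ext)
  }
  fix a assume "a \<in> carrier R"
  then show "compose (carrier N) f (a \<odot>\<^bsub>hom_module R N M\<^esub> g) =
    a \<odot>\<^bsub>hom_module R N M'\<^esub> compose (carrier N) f g"
    using f(3) g(1) by (auto simp: hom_module_simps compose_def intro!: restrict_ext)
qed

lemma hom_from_residue_ring:
  fixes R (structure)
  assumes "cring R" "ideal I R" "module R M" "w \<in> carrier M" "\<And>a. a \<in> I \<Longrightarrow> a \<odot>\<^bsub>M\<^esub> w = \<zero>\<^bsub>M\<^esub>"
  shows "\<exists>f\<in>carrier (hom_module R (quot_module (self_module R) I) M).
    \<forall>r\<in>carrier R. f (I +>\<^bsub>self_module R\<^esub> r) = r \<odot>\<^bsub>M\<^esub> w"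
proof -
  interpret M: module R M by fact
  interpret S: module R "self_module R" by (rule self_module_module[OF assms(1)])
  have I: "submodule I R (self_module R)" by (rule ideal_submodule[OF assms(1,2)])
  let ?Q = "quot_module (self_module R) I"
  note q = S.quot_module_simps[OF I]
  define f where "f = (\<lambda>X\<in>carrier ?Q. (SOME r. r \<in> X) \<odot>\<^bsub>M\<^esub> w)"
  have f: "f (I +>\<^bsub>self_module R\<^esub> r) = r \<odot>\<^bsub>M\<^esub> w" if r: "r \<in> carrier R" for r
  proof -
    let ?X = "I +>\<^bsub>self_module R\<^esub> r"
    have rc: "r \<in> carrier (self_module R)" using r by simp
    let ?s = "SOME s. s \<in> ?X"
    have s: "?s \<in> ?X" by (rule someI[of _ r]) (rule S.coset_subset(2)[OF I rc])
    have sc: "?s \<in> carrier R" using S.coset_subset(1)[OF I rc] s by auto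
    have "?s \<ominus> r \<in> I"
      using s S.mem_coset_iff[OF I rc, of ?s] S.coset_eq_iff[OF I _ rc, of ?s] sc by simp
    then have "(?s \<ominus> r) \<odot>\<^bsub>M\<^esub> w = \<zero>\<^bsub>M\<^esub>" by (rule assms(5))
    then have "?s \<odot>\<^bsub>M\<^esub> w = r \<odot>\<^bsub>M\<^esub> w"
      using M.diff_smult_distr[OF sc r assms(4)] M.diff_eq_zero_iff sc r assms(4) by simp
    moreover have "?X \<in> carrier ?Q" using r by (simp add: q)
    ultimately show ?thesis by (simp add: f_def)
  qed
  have "f \<in> module_homs R ?Q M"
    by (rule module_homsI)
       (use f assms(4) q(3,4) in \<open>auto simp: q(1) M.smult_l_distr M.smult_assoc1\<close>)
  then have "f \<in> carrier (hom_module R ?Q M)" by (simp add: hom_module_simps f_def)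
  then show ?thesis using f by blast
qed

text \<open>The embedding \<open>e\<close> of \<open>K\<close> into the injective module \<open>I 0\<close> can be divided by the regular element \<open>x\<close>:
the map \<open>xk \<mapsto> e k\<close> on \<open>xK\<close> extends to \<open>K\<close>. As \<open>e\<close> is injective, \<open>xK\<close> and \<open>K\<close> are realised by their
images in \<open>I 0\<close>, which lie on the type over which injectivity is quantified.\<close>

lemma injective_resolution_divide:
  fixes R (structure)
  assumes K: "module R K" and x: "x \<in> carrier R"
    and reg: "\<And>y. y \<in> carrier K \<Longrightarrow> x \<odot>\<^bsub>K\<^esub> y = \<zero>\<^bsub>K\<^esub> \<Longrightarrow> y = \<zero>\<^bsub>K\<^esub>"
    and res: "injective_resolution R K I e d"
  shows "\<exists>h\<in>module_homs R K (I 0). \<forall>k\<in>carrier K. h (x \<odot>\<^bsub>K\<^esub> k) = e k"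
proof -
  interpret K: module R K by fact
  have inj: "injective_module R (I 0)" and e: "e \<in> module_homs R K (I 0)" "inj_on e (carrier K)"
    using res by (auto simp: injective_resolution_def)
  then interpret I: module R "I 0" by (simp add: injective_module_def)
  note eh = module_homsD[OF e(1)]
  let ?xK = "multiples K x"
  have sxK: "submodule ?xK R K"
    by (rule module_homs_image_submodule[OF K K K.smult_hom[OF x] K.carrier_is_submodule])
  have sL: "submodule (e ` carrier K) R (I 0)"
    by (rule module_homs_image_submodule[OF K I.module_axioms e(1) K.carrier_is_submodule])
  have sN: "submodule (e ` ?xK) R (I 0)"
    by (rule module_homs_image_submodule[OF K I.module_axioms e(1) sxK])
  let ?L = "I 0\<lparr>carrier := e ` carrier K\<rparr>" and ?N = "I 0\<lparr>carrier := e ` ?xK\<rparr>"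
  have mL: "module R ?L" by (rule submodule.submodule_is_module[OF sL I.module_axioms])
  have mN: "module R ?N" by (rule submodule.submodule_is_module[OF sN I.module_axioms])
  have xinj: "k = k'" if k: "k \<in> carrier K" "k' \<in> carrier K" and eq: "x \<odot>\<^bsub>K\<^esub> k = x \<odot>\<^bsub>K\<^esub> k'" for k k'
  proof -
    have "x \<odot>\<^bsub>K\<^esub> (k \<ominus>\<^bsub>K\<^esub> k') = \<zero>\<^bsub>K\<^esub>"
      using K.smult_diff_distr[OF x k] eq K.diff_eq_zero_iff[of "x \<odot>\<^bsub>K\<^esub> k" "x \<odot>\<^bsub>K\<^esub> k'"] k x by simp
    then show ?thesis using reg K.diff_eq_zero_iff[OF k] k by simp
  qed
  define g where "g w = e (THE k. k \<in> carrier K \<and> w = e (x \<odot>\<^bsub>K\<^esub> k))" for w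
  have g: "g (e (x \<odot>\<^bsub>K\<^esub> k)) = e k" if k: "k \<in> carrier K" for k
  proof -
    have "(THE k'. k' \<in> carrier K \<and> e (x \<odot>\<^bsub>K\<^esub> k) = e (x \<odot>\<^bsub>K\<^esub> k')) = k"
    proof (rule the_equality)
      fix k' assume k': "k' \<in> carrier K \<and> e (x \<odot>\<^bsub>K\<^esub> k) = e (x \<odot>\<^bsub>K\<^esub> k')"
      then have "x \<odot>\<^bsub>K\<^esub> k = x \<odot>\<^bsub>K\<^esub> k'" using inj_onD[OF e(2)] k x by auto
      then show "k' = k" using xinj k k' by auto
    qed (use k in auto)
    then show ?thesis by (simp add: g_def)
  qed
  have gh: "g \<in> module_homs R ?N (I 0)"
  proof (rule module_homsI)
    fix w assume "w \<in> carrier ?N"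
    then show "g w \<in> carrier (I 0)" using g eh(1) by auto
  next
    fix w v assume "w \<in> carrier ?N" "v \<in> carrier ?N"
    then obtain k k' where k: "k \<in> carrier K" "w = e (x \<odot>\<^bsub>K\<^esub> k)" "k' \<in> carrier K" "v = e (x \<odot>\<^bsub>K\<^esub> k')"
      by auto
    have "w \<oplus>\<^bsub>I 0\<^esub> v = e (x \<odot>\<^bsub>K\<^esub> (k \<oplus>\<^bsub>K\<^esub> k'))" using k x eh(2) by (simp add: K.smult_r_distr)
    then show "g (w \<oplus>\<^bsub>?N\<^esub> v) = g w \<oplus>\<^bsub>I 0\<^esub> g v" using g k eh(2) by simp
  next
    fix a w assume a: "a \<in> carrier R" and "w \<in> carrier ?N"
    then obtain k where k: "k \<in> carrier K" "w = e (x \<odot>\<^bsub>K\<^esub> k)" by auto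
    have "a \<odot>\<^bsub>I 0\<^esub> w = e (x \<odot>\<^bsub>K\<^esub> (a \<odot>\<^bsub>K\<^esub> k))"
      using k x a eh(3)[of a "x \<odot>\<^bsub>K\<^esub> k"] by (simp add: K.smult_commute[of x a])
    then show "g (a \<odot>\<^bsub>?N\<^esub> w) = a \<odot>\<^bsub>I 0\<^esub> g w" using g k eh(3) a by simp
  qed
  have "id \<in> module_homs R ?N ?L" using sxK[THEN K.submoduleE(1)] by (intro module_homsI) auto
  with inj gh mN mL obtain h where h: "h \<in> module_homs R ?L (I 0)" "\<forall>w\<in>carrier ?N. h (id w) = g w"
    unfolding injective_module_def by (metis inj_on_id)
  have "(\<lambda>k. h (e k)) \<in> module_homs R K (I 0)"
    using module_homsD[OF h(1)] eh by (intro module_homsI) auto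
  moreover have "\<forall>k\<in>carrier K. h (e (x \<odot>\<^bsub>K\<^esub> k)) = e k" using h(2) g by auto
  ultimately show ?thesis by (intro bexI[of _ "\<lambda>k. h (e k)"]) auto
qed

text \<open>This is the classical isomorphism of the socle of \<open>K/xK\<close> with \<open>Ext\<^sup>1(R/\<mm>, K)\<close>, of which
only injectivity is established. Divide \<open>e\<close> by \<open>x\<close> to obtain \<open>h\<close>. If \<open>\<mm>z \<subseteq> xK\<close>, then
\<open>h z\<close> is mapped by each \<open>a \<in> \<mm>\<close> into \<open>e(K)\<close>, so \<open>d 0 (h z)\<close> is killed by \<open>\<mm>\<close> and defines a cocycle. If
it is a coboundary, \<open>h z - w = e k\<close> with \<open>xw = 0\<close>, and multiplication by \<open>x\<close> gives \<open>e z = e (xk)\<close>.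
So two socle elements are proportional as soon as their classes in a module of length one are.\<close>

theorem ext_length_one_simple_socle:
  fixes R (structure)
  assumes R: "noetherian_local_ring R \<mm>" and K: "module R K" and x: "x \<in> \<mm>"
    and reg: "\<And>y. y \<in> carrier K \<Longrightarrow> x \<odot>\<^bsub>K\<^esub> y = \<zero>\<^bsub>K\<^esub> \<Longrightarrow> y = \<zero>\<^bsub>K\<^esub>"
    and res: "injective_resolution R K I e d"
    and len: "module_length R (ext_module R (quot_module (self_module R) \<mm>) I d 1) = enat 1"
    and z: "z \<in> carrier K" "\<forall>a\<in>\<mm>. a \<odot>\<^bsub>K\<^esub> z \<in> multiples K x"
      "z \<notin> multiples K x"
    and z': "z' \<in> carrier K" "\<forall>a\<in>\<mm>. a \<odot>\<^bsub>K\<^esub> z' \<in> multiples K x"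
  shows "\<exists>r\<in>carrier R. z' \<ominus>\<^bsub>K\<^esub> r \<odot>\<^bsub>K\<^esub> z \<in> multiples K x"
proof -
  note R' = noetherian_local_ringD[OF R]
  interpret K: module R K by fact
  have inj: "\<And>j. injective_module R (I j)" and e: "e \<in> module_homs R K (I 0)" "inj_on e (carrier K)"
    and d: "\<And>j. d j \<in> module_homs R (I j) (I (Suc j))"
    and ex0: "e ` carrier K = mod_kernel (I 0) (I 1) (d 0)"
    and ex1: "\<And>j. d j ` carrier (I j) = mod_kernel (I (Suc j)) (I (Suc (Suc j))) (d (Suc j))"
    using res by (auto simp: injective_resolution_def)
  have mI: "module R (I j)" for j using inj by (simp add: injective_module_def)
  interpret I0: module R "I 0" by (rule mI)
  interpret I1: module R "I 1" by (rule mI)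
  interpret I2: module R "I 2" by (rule mI)
  have d0: "d 0 \<in> module_homs R (I 0) (I 1)" and d1: "d 1 \<in> module_homs R (I 1) (I 2)"
    using d[of 0] d[of 1] by (simp_all add: numeral_2_eq_2)
  note eh = module_homsD[OF e(1)] and d0h = module_homsD[OF d0] and d1h = module_homsD[OF d1]
  have d1d0: "d 1 (d 0 y) = \<zero>\<^bsub>I 2\<^esub>" if "y \<in> carrier (I 0)" for y
    using ex1[of 0] that by (auto simp: mod_kernel_def numeral_2_eq_2)
  have d0e: "d 0 (e k) = \<zero>\<^bsub>I 1\<^esub>" if "k \<in> carrier K" for k
    using ex0 that by (auto simp: mod_kernel_def)
  have xc: "x \<in> carrier R" using x R'(5) by auto
  obtain h where h: "h \<in> module_homs R K (I 0)" "\<forall>k\<in>carrier K. h (x \<odot>\<^bsub>K\<^esub> k) = e k"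
    using injective_resolution_divide[OF K xc reg res] by blast
  note hh = module_homsD[OF h(1)]

  \<comment> \<open>an element of \<open>K\<close> whose class is a coboundary lies in \<open>xK\<close>\<close>
  have key: "y \<in> multiples K x"
    if y: "y \<in> carrier K" and w: "w \<in> carrier (I 0)" "x \<odot>\<^bsub>I 0\<^esub> w = \<zero>\<^bsub>I 0\<^esub>" "d 0 (h y) = d 0 w" for y w
  proof -
    have "d 0 (h y \<ominus>\<^bsub>I 0\<^esub> w) = \<zero>\<^bsub>I 1\<^esub>"
      using module_hom_diff[OF mI mI d0 hh(1)[OF y] w(1)] w(3) I1.diff_eq_zero_iff d0h(1) w(1) by simp
    then have "h y \<ominus>\<^bsub>I 0\<^esub> w \<in> e ` carrier K" using ex0 hh(1)[OF y] w(1) by (simp add: mod_kernel_def)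
    then obtain k where k: "k \<in> carrier K" "h y \<ominus>\<^bsub>I 0\<^esub> w = e k" by auto
    have "e (x \<odot>\<^bsub>K\<^esub> k) = x \<odot>\<^bsub>I 0\<^esub> (h y \<ominus>\<^bsub>I 0\<^esub> w)" using k eh(3) xc by simp
    also have "\<dots> = x \<odot>\<^bsub>I 0\<^esub> h y"
      using I0.smult_diff_distr[OF xc hh(1)[OF y] w(1)] w(2) hh(1)[OF y] xc I0.M.r_neg[OF I0.M.zero_closed]
        I0.M.l_zero[of "\<ominus>\<^bsub>I 0\<^esub> \<zero>\<^bsub>I 0\<^esub>"]
      by (metis I0.M.r_zero I0.M.zero_closed I0.M.a_inv_closed I0.smult_closed a_minus_def)
    also have "\<dots> = e y" using hh(3)[OF xc y] h(2) y by simp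
    finally have "x \<odot>\<^bsub>K\<^esub> k = y" using inj_onD[OF e(2)] k y xc by auto
    then show ?thesis using k by auto
  qed

  let ?k = "quot_module (self_module R) \<mm>"
  interpret S: module R "self_module R" by (rule self_module_module[OF R'(1)])
  have sm: "submodule \<mm> R (self_module R)" by (rule ideal_submodule[OF R'(1,4)])
  note q = S.quot_module_simps[OF sm]
  have mk: "module R ?k" by (rule S.quot_module_module[OF sm])
  let ?u = "\<mm> +>\<^bsub>self_module R\<^esub> \<one>"
  have u: "?u \<in> carrier ?k" by (auto simp: q)
  have au: "a \<odot>\<^bsub>?k\<^esub> ?u = \<zero>\<^bsub>?k\<^esub>" if "a \<in> \<mm>" for a
    using that R'(5) S.coset_eq_self_iff[OF sm, of a] S.coset_eq_self_iff[OF sm, of \<zero>]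
      submodule_zero_mem[OF sm] by (auto simp: q subset_iff)
  let ?H0 = "hom_module R ?k (I 0)" and ?H1 = "hom_module R ?k (I 1)"
  interpret H0: module R ?H0 by (rule hom_module_module[OF mk mI])
  interpret H1: module R ?H1 by (rule hom_module_module[OF mk mI])
  let ?Z = "ext_cocycles R ?k I d 1" and ?B = "ext_coboundaries R ?k I d 1"
  have Z: "?Z = {f \<in> carrier ?H1. \<forall>x\<in>carrier ?k. d 1 (f x) = \<zero>\<^bsub>I 2\<^esub>}"
    by (simp add: ext_cocycles_def numeral_2_eq_2)
  have B: "?B = compose (carrier ?k) (d 0) ` carrier ?H0" by simp
  have H1v: "f X \<in> carrier (I 1)" if "f \<in> carrier ?H1" "X \<in> carrier ?k" for f X
    using that by (auto simp: hom_module_simps dest: module_homsD(1))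
  have H0v: "f X \<in> carrier (I 0)" if "f \<in> carrier ?H0" "X \<in> carrier ?k" for f X
    using that by (auto simp: hom_module_simps dest: module_homsD(1))
  have sZ: "submodule ?Z R ?H1"
  proof -
    let ?H2 = "hom_module R ?k (I 2)"
    interpret H2: module R ?H2 by (rule hom_module_module[OF mk mI])
    note c = compose_hom_module_hom[OF mk d1]
    have "?Z = {f \<in> carrier ?H1. compose (carrier ?k) (d 1) f \<in> {\<zero>\<^bsub>?H2\<^esub>}}"
      unfolding Z by (auto simp: hom_module_simps compose_def restrict_def fun_eq_iff)
    then show ?thesis
      using module_homs_vimage_submodule[OF H1.module_axioms H2.module_axioms c H2.submodule_zero_submodule]
      by simp
  qed
  have sB: "submodule ?B R ?H1"
  proof -
    note c = compose_hom_module_hom[OF mk d0]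
    show ?thesis
      unfolding B
      by (rule module_homs_image_submodule[OF H0.module_axioms H1.module_axioms c H0.carrier_is_submodule])
  qed
  have BZ: "?B \<subseteq> ?Z"
  proof
    fix f assume f: "f \<in> ?B"
    then obtain g where g: "g \<in> carrier ?H0" "f = compose (carrier ?k) (d 0) g" unfolding B by auto
    have "f \<in> carrier ?H1" using H1.submoduleE(1)[OF sB] f by auto
    moreover have "\<forall>X\<in>carrier ?k. d 1 (f X) = \<zero>\<^bsub>I 2\<^esub>"
      using g d1d0 H0v by (auto simp: compose_def)
    ultimately show "f \<in> ?Z" unfolding Z by auto
  qed
  let ?ZM = "?H1\<lparr>carrier := ?Z\<rparr>"
  interpret ZM: module R ?ZM by (rule submodule.submodule_is_module[OF sZ H1.module_axioms])
  have sBZ: "submodule ?B R ?ZM" by (rule H1.submodule_of_submodule[OF sZ sB BZ])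
  have len': "module_length R (quot_module ?ZM ?B) = enat 1"
    using len by (simp add: ext_module_def)

  \<comment> \<open>every socle element gives a cocycle, recorded through its value at the generator of \<open>R/\<mm>\<close>\<close>
  have coc: "\<exists>f\<in>?Z. f ?u = d 0 (h y)"
    if y: "y \<in> carrier K" "\<forall>a\<in>\<mm>. a \<odot>\<^bsub>K\<^esub> y \<in> multiples K x" for y
  proof -
    have "a \<odot>\<^bsub>I 1\<^esub> d 0 (h y) = \<zero>\<^bsub>I 1\<^esub>" if a: "a \<in> \<mm>" for a
    proof -
      have ac: "a \<in> carrier R" using a R'(5) by auto
      obtain k where k: "k \<in> carrier K" "a \<odot>\<^bsub>K\<^esub> y = x \<odot>\<^bsub>K\<^esub> k" using y a by auto
      have "a \<odot>\<^bsub>I 1\<^esub> d 0 (h y) = d 0 (h (a \<odot>\<^bsub>K\<^esub> y))" using d0h(3) hh ac y by simp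
      also have "\<dots> = d 0 (e k)" using k h(2) by simp
      finally show ?thesis using d0e k by simp
    qed
    then obtain f where f: "f \<in> carrier ?H1" "\<forall>r\<in>carrier R. f (\<mm> +>\<^bsub>self_module R\<^esub> r) = r \<odot>\<^bsub>I 1\<^esub> d 0 (h y)"
      using hom_from_residue_ring[OF R'(1,4) mI[of 1], of "d 0 (h y)"] d0h(1) hh(1) y(1) by blast
    have "f ?u = d 0 (h y)" using f(2) I1.smult_one[OF d0h(1)[OF hh(1)[OF y(1)]]] by simp
    moreover have "d 1 (f X) = \<zero>\<^bsub>I 2\<^esub>" if X: "X \<in> carrier ?k" for X
    proof -
      obtain r where r: "r \<in> carrier R" "X = \<mm> +>\<^bsub>self_module R\<^esub> r" using X by (auto simp: q)
      have "d 1 (f X) = r \<odot>\<^bsub>I 2\<^esub> d 1 (d 0 (h y))" using f(2) r d1h(3) d0h(1) hh(1) y(1) by simp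
      also have "\<dots> = \<zero>\<^bsub>I 2\<^esub>" using d1d0 hh(1) y(1) r by simp
      finally show ?thesis .
    qed
    ultimately show ?thesis using f(1) unfolding Z by blast
  qed
  have cobd: "\<exists>w\<in>carrier (I 0). x \<odot>\<^bsub>I 0\<^esub> w = \<zero>\<^bsub>I 0\<^esub> \<and> f ?u = d 0 w" if f: "f \<in> ?B" for f
  proof -
    obtain g where g: "g \<in> carrier ?H0" "f = compose (carrier ?k) (d 0) g" using f unfolding B by auto
    then have gh: "g \<in> module_homs R ?k (I 0)" by (simp add: hom_module_simps)
    have "x \<odot>\<^bsub>I 0\<^esub> g ?u = \<zero>\<^bsub>I 0\<^esub>"
      using module_homsD(3)[OF gh xc u] au[OF x] module_hom_zero[OF mk mI gh] by simp
    moreover have "f ?u = d 0 (g ?u)" using g(2) u by (simp add: compose_def)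
    ultimately show ?thesis using H0v[OF g(1) u] by blast
  qed

  obtain f where f: "f \<in> ?Z" "f ?u = d 0 (h z)" using coc[OF z(1,2)] by blast
  obtain f' where f': "f' \<in> ?Z" "f' ?u = d 0 (h z')" using coc[OF z'] by blast
  have "f \<notin> ?B"
  proof
    assume "f \<in> ?B"
    then obtain w where "w \<in> carrier (I 0)" "x \<odot>\<^bsub>I 0\<^esub> w = \<zero>\<^bsub>I 0\<^esub>" "f ?u = d 0 w" using cobd by blast
    then show False using key[OF z(1)] z(3) f(2) by auto
  qed
  then have "adjoin_element R ?ZM ?B f = carrier ?ZM"
    using ZM.quotient_length_one[OF sBZ len', of f] f(1) by simp
  then have "f' \<in> adjoin_element R ?ZM ?B f" using f'(1) by simp
  then obtain b r where b: "b \<in> ?B" "r \<in> carrier R" "f' = b \<oplus>\<^bsub>?H1\<^esub> r \<odot>\<^bsub>?H1\<^esub> f"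
    by (auto simp: adjoin_element_def)
  obtain w where w: "w \<in> carrier (I 0)" "x \<odot>\<^bsub>I 0\<^esub> w = \<zero>\<^bsub>I 0\<^esub>" "b ?u = d 0 w" using cobd[OF b(1)] by blast
  have "d 0 (h z') = d 0 w \<oplus>\<^bsub>I 1\<^esub> r \<odot>\<^bsub>I 1\<^esub> d 0 (h z)"
    using b(3) f(2) f'(2) w(3) u by (simp add: hom_module_simps)
  then have "d 0 (h z') \<ominus>\<^bsub>I 1\<^esub> r \<odot>\<^bsub>I 1\<^esub> d 0 (h z) = d 0 w"
    using d0h(1) hh(1) z(1) z'(1) w(1) b(2) by (simp add: a_minus_def I1.M.add.m_assoc I1.M.r_neg del: One_nat_def)
  moreover have "d 0 (h (z' \<ominus>\<^bsub>K\<^esub> r \<odot>\<^bsub>K\<^esub> z)) = d 0 (h z') \<ominus>\<^bsub>I 1\<^esub> r \<odot>\<^bsub>I 1\<^esub> d 0 (h z)"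
    using module_hom_diff[OF K mI h(1) z'(1), of "r \<odot>\<^bsub>K\<^esub> z"] z(1) b(2) hh d0h
      module_hom_diff[OF mI mI d0, of "h z'" "r \<odot>\<^bsub>I 0\<^esub> h z"] z'(1) by simp
  ultimately have "z' \<ominus>\<^bsub>K\<^esub> r \<odot>\<^bsub>K\<^esub> z \<in> multiples K x"
    using key[OF _ w(1,2), of "z' \<ominus>\<^bsub>K\<^esub> r \<odot>\<^bsub>K\<^esub> z"] z(1) z'(1) b(2) by simp
  then show ?thesis using b(2) by blast
qed


section \<open>Depth, length and multiplicity\<close>

lemma (in module) ideal_smult_submodule:
  assumes "I \<subseteq> carrier R"
  shows "submodule (ideal_smult R I M) R M"
  unfolding ideal_smult_def by (rule submodule_span_submodule) (use assms in auto)

lemma ideal_smult_mem: "a \<in> I \<Longrightarrow> x \<in> carrier M \<Longrightarrow> a \<odot>\<^bsub>M\<^esub> x \<in> ideal_smult R I M"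
  using submodule_span_superset unfolding ideal_smult_def by fastforce

lemma ideal_smult_minimal:
  assumes "submodule P R M" "\<And>a x. a \<in> I \<Longrightarrow> x \<in> carrier M \<Longrightarrow> a \<odot>\<^bsub>M\<^esub> x \<in> P"
  shows "ideal_smult R I M \<subseteq> P"
  unfolding ideal_smult_def by (rule submodule_span_minimal[OF assms(1)]) (use assms(2) in auto)

lemma (in module) regular_element_of_depth:
  assumes "1 \<le> depth R \<mm> M"
  shows "\<exists>x\<in>\<mm>. \<forall>y\<in>carrier M. x \<odot>\<^bsub>M\<^esub> y = \<zero>\<^bsub>M\<^esub> \<longrightarrow> y = \<zero>\<^bsub>M\<^esub>"
proof -
  have "\<exists>xs. set xs \<subseteq> \<mm> \<and> regular_sequence R M xs \<and> length xs \<noteq> 0"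
  proof (rule ccontr)
    assume "\<nexists>xs. set xs \<subseteq> \<mm> \<and> regular_sequence R M xs \<and> length xs \<noteq> 0"
    then have "depth R \<mm> M \<le> 0"
      unfolding depth_def by (intro Sup_least) (auto simp: zero_enat_def)
    then show False using assms by simp
  qed
  then obtain xs where xs: "set xs \<subseteq> \<mm>" "regular_sequence R M xs" "length xs \<noteq> 0" by blast
  have "genideal R {} \<subseteq> {\<zero>}" by (rule R.genideal_minimal[OF R.zeroideal]) simp
  then have "ideal_smult R (genideal R {}) M \<subseteq> {\<zero>\<^bsub>M\<^esub>}"
    by (intro ideal_smult_minimal[OF submodule_zero_submodule]) auto
  moreover have "submodule (ideal_smult R (genideal R {}) M) R M"
    by (rule ideal_smult_submodule) (use \<open>genideal R {} \<subseteq> {\<zero>}\<close> in auto)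
  ultimately have 0: "ideal_smult R (genideal R {}) M = {\<zero>\<^bsub>M\<^esub>}" using submodule_zero_mem by blast
  have "\<forall>y\<in>carrier M. xs ! 0 \<odot>\<^bsub>M\<^esub> y \<in> ideal_smult R (genideal R (set (take 0 xs))) M \<longrightarrow>
        y \<in> ideal_smult R (genideal R (set (take 0 xs))) M"
    using xs(2,3) unfolding regular_sequence_def by blast
  then have "\<forall>y\<in>carrier M. xs ! 0 \<odot>\<^bsub>M\<^esub> y = \<zero>\<^bsub>M\<^esub> \<longrightarrow> y = \<zero>\<^bsub>M\<^esub>" by (simp add: 0)
  moreover have "xs ! 0 \<in> \<mm>" using xs(1,3) nth_mem by blast
  ultimately show ?thesis by blast
qed

text \<open>Nakayama's lemma in the form needed here: dividing the generator of a maximal cyclic submodule by \<open>x\<close>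
does not enlarge it, so that generator is zero.\<close>

lemma (in module) divisible_noetherian_zero:
  assumes R: "noetherian_local_ring R \<mm>" and M: "noetherian_module R M" and x: "x \<in> \<mm>"
    and div: "\<And>c. c \<in> carrier M \<Longrightarrow> \<exists>c'\<in>carrier M. c = x \<odot>\<^bsub>M\<^esub> c'"
  shows "carrier M = {\<zero>\<^bsub>M\<^esub>}"
proof -
  let ?C = "\<lambda>c. adjoin_element R M {\<zero>\<^bsub>M\<^esub>} c"
  have xc: "x \<in> carrier R" using x noetherian_local_ringD(5)[OF R] by auto
  have sub: "submodule (?C c) R M" "c \<in> ?C c" if "c \<in> carrier M" for c
    using adjoin_element_submodule[OF submodule_zero_submodule that]
      adjoin_element_superset(2)[OF submodule_zero_submodule that] by auto
  have "?C ` carrier M \<noteq> {} \<and> (\<forall>N\<in>?C ` carrier M. submodule N R M)" using sub by auto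
  from M[unfolded noetherian_module_def, rule_format, OF this]
  obtain c where c: "c \<in> carrier M" "\<And>c'. c' \<in> carrier M \<Longrightarrow> ?C c \<subseteq> ?C c' \<Longrightarrow> ?C c' = ?C c" by auto
  obtain c' where c': "c' \<in> carrier M" "c = x \<odot>\<^bsub>M\<^esub> c'" using div[OF c(1)] by blast
  have "c \<in> ?C c'" using submoduleE(4)[OF sub(1)[OF c'(1)] xc sub(2)[OF c'(1)]] c'(2) by simp
  then have "?C c \<subseteq> ?C c'"
    using adjoin_element_minimal[OF sub(1)[OF c'(1)]] submodule_zero_mem[OF sub(1)[OF c'(1)]] by auto
  then have "c' \<in> ?C c" using c(2)[OF c'(1)] sub(2)[OF c'(1)] by auto
  then obtain r where r: "r \<in> carrier R" "c' = r \<odot>\<^bsub>M\<^esub> (x \<odot>\<^bsub>M\<^esub> c')"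
    using c c' by (auto simp: adjoin_element_def)
  have rx: "r \<otimes> x \<in> \<mm>" using ideal.I_l_closed[OF noetherian_local_ringD(4)[OF R] x r(1)] .
  have "(\<one> \<ominus> r \<otimes> x) \<odot>\<^bsub>M\<^esub> c' = \<zero>\<^bsub>M\<^esub>"
    using diff_smult_distr[of \<one> "r \<otimes> x" c'] r xc c'(1) diff_eq_zero_iff[of c' c'] by (simp add: smult_assoc1)
  then have "c' \<in> {\<zero>\<^bsub>M\<^esub>}"
    using unit_smult_mem[OF submodule_zero_submodule local_ring_one_minus_unit[OF R rx] c'(1)] by simp
  then have c0: "c = \<zero>\<^bsub>M\<^esub>" using c'(2) xc by simp
  then have Cc: "?C c = {\<zero>\<^bsub>M\<^esub>}" by (auto simp: adjoin_element_def intro!: exI[of _ \<zero>])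
  have "d = \<zero>\<^bsub>M\<^esub>" if d: "d \<in> carrier M" for d
    using c(2)[OF d] sub(2)[OF d] submodule_zero_mem[OF sub(1)[OF d]] unfolding Cc by auto
  then show ?thesis by auto
qed

lemma (in module) simple_series_mono:
  assumes "simple_series R \<mm> M E l" "i \<le> l"
  shows "E 0 \<subseteq> E i"
  using assms(2)
proof (induction i)
  case (Suc i)
  obtain u where "u \<in> carrier M" "E (Suc i) = adjoin_element R M (E i) u"
    using assms(1) Suc.prems unfolding simple_series_def by (meson DiffD1 Suc_le_lessD)
  moreover have "submodule (E i) R M" using assms(1) Suc.prems by (auto simp: simple_series_def)
  ultimately show ?case using Suc adjoin_element_superset(1) by fastforce
qed simp

lemma (in module) simple_series_smult:
  assumes "simple_series R \<mm> M E l" "\<mm> \<subseteq> carrier R" "j \<le> l" "a \<in> \<mm>" "c \<in> E j"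
  shows "a \<odot>\<^bsub>M\<^esub> c \<in> E (j - 1)"
proof (cases j)
  case 0
  then have "submodule (E j) R M" using assms(1) by (auto simp: simple_series_def)
  then show ?thesis using 0 submoduleE(4) assms by auto
next
  case (Suc i)
  then have i: "i < l" using assms(3) by auto
  then obtain u where u: "u \<in> carrier M" "E (Suc i) = adjoin_element R M (E i) u" "\<forall>a\<in>\<mm>. a \<odot>\<^bsub>M\<^esub> u \<in> E i"
    using assms(1) unfolding simple_series_def by blast
  have s: "submodule (E i) R M" using assms(1) i by (auto simp: simple_series_def)
  obtain n r where n: "n \<in> E i" "r \<in> carrier R" "c = n \<oplus>\<^bsub>M\<^esub> r \<odot>\<^bsub>M\<^esub> u"
    using assms(5) u(2) Suc by (auto simp: adjoin_element_def)
  have ac: "a \<in> carrier R" and nc: "n \<in> carrier M" using assms(2,4) submoduleE(1)[OF s] n(1) by auto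
  have "a \<odot>\<^bsub>M\<^esub> c = a \<odot>\<^bsub>M\<^esub> n \<oplus>\<^bsub>M\<^esub> r \<odot>\<^bsub>M\<^esub> (a \<odot>\<^bsub>M\<^esub> u)"
    using n ac nc u(1) by (simp add: smult_r_distr smult_commute)
  also have "\<dots> \<in> E i" using submoduleE(4,5)[OF s] n ac u(3) assms(4) by auto
  finally show ?thesis using Suc by simp
qed

lemma (in module) pow_smult_eq_zero:
  assumes "x \<in> carrier R" "\<And>y. y \<in> carrier M \<Longrightarrow> x \<odot>\<^bsub>M\<^esub> y = \<zero>\<^bsub>M\<^esub> \<Longrightarrow> y = \<zero>\<^bsub>M\<^esub>"
    "y \<in> carrier M" "(x [^] (n::nat)) \<odot>\<^bsub>M\<^esub> y = \<zero>\<^bsub>M\<^esub>"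
  shows "y = \<zero>\<^bsub>M\<^esub>"
  using assms(4)
proof (induction n)
  case (Suc n)
  have "x \<odot>\<^bsub>M\<^esub> (x [^] n \<odot>\<^bsub>M\<^esub> y) = \<zero>\<^bsub>M\<^esub>"
    using Suc.prems assms(1,3) by (simp add: smult_assoc1 smult_commute)
  then have "x [^] n \<odot>\<^bsub>M\<^esub> y = \<zero>\<^bsub>M\<^esub>" by (rule assms(2)[rotated]) (use assms(1,3) in auto)
  then show ?case by (rule Suc.IH)
qed (use assms(3) in simp)

text \<open>The first step of the argument above; the hypothesis \<open>socle\<close> says that the socle of \<open>K/xK\<close> is simple.
All lengths are compared by means of chains of submodules of \<open>K\<close> that contain \<open>xK\<close>. The
chain \<open>P i = f(J i) + xK\<close> is strictly increasing because \<open>R/xR\<close> embeds into \<open>K/xK\<close>, and the chain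
\<open>E i = {k. (J i)k \<subseteq> xK}\<close> descends from \<open>K\<close> to \<open>xK\<close> by steps that embed into the socle.\<close>

theorem cokernel_zero_if_regular:
  fixes R (structure)
  assumes R: "noetherian_local_ring R \<mm>" "krull_dim R = 1"
    and K: "module R K" and x: "x \<in> \<mm>"
    and reg: "\<And>y. y \<in> carrier K \<Longrightarrow> x \<odot>\<^bsub>K\<^esub> y = \<zero>\<^bsub>K\<^esub> \<Longrightarrow> y = \<zero>\<^bsub>K\<^esub>"
    and socle: "\<And>z z'. z \<in> carrier K \<Longrightarrow> \<forall>a\<in>\<mm>. a \<odot>\<^bsub>K\<^esub> z \<in> multiples K x \<Longrightarrow>
      z \<notin> multiples K x \<Longrightarrow>
      z' \<in> carrier K \<Longrightarrow> \<forall>a\<in>\<mm>. a \<odot>\<^bsub>K\<^esub> z' \<in> multiples K x \<Longrightarrow>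
      \<exists>r\<in>carrier R. z' \<ominus>\<^bsub>K\<^esub> r \<odot>\<^bsub>K\<^esub> z \<in> multiples K x"
    and C: "module R C" "noetherian_module R C"
    and f: "f \<in> module_homs R (self_module R) K" "inj_on f (carrier R)"
    and g: "g \<in> module_homs R K C" "g ` carrier K = carrier C"
    and ex: "f ` carrier R = mod_kernel K C g"
    and d: "d \<in> \<mm>" "\<And>c. c \<in> carrier C \<Longrightarrow> d \<odot>\<^bsub>C\<^esub> c = \<zero>\<^bsub>C\<^esub> \<Longrightarrow> c = \<zero>\<^bsub>C\<^esub>"
  shows "carrier C = {\<zero>\<^bsub>C\<^esub>}"
proof -
  note R' = noetherian_local_ringD[OF R(1)]
  interpret K: module R K by fact
  interpret C: module R C by fact
  interpret S: module R "self_module R" by (rule self_module_module[OF R'(1)])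
  have fh: "f r \<in> carrier K" "f (r \<oplus> s) = f r \<oplus>\<^bsub>K\<^esub> f s" "f (r \<otimes> s) = r \<odot>\<^bsub>K\<^esub> f s"
    if "r \<in> carrier R" "s \<in> carrier R" for r s
    using module_homsD[OF f(1)] that by auto
  have fd: "f (r \<ominus> s) = f r \<ominus>\<^bsub>K\<^esub> f s" if "r \<in> carrier R" "s \<in> carrier R" for r s
    using module_hom_diff[OF S.module_axioms K f(1), of r s] that by simp
  have f0: "f \<zero> = \<zero>\<^bsub>K\<^esub>" using module_hom_zero[OF S.module_axioms K f(1)] by simp
  note gh = module_homsD[OF g(1)]
  have xc: "x \<in> carrier R" and dc: "d \<in> carrier R" using x d(1) R'(5) by auto
  have xreg: "y = \<zero>" if y: "y \<in> carrier R" "x \<otimes> y = \<zero>" for y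
  proof -
    have "x \<odot>\<^bsub>K\<^esub> f y = \<zero>\<^bsub>K\<^esub>" using fh(3)[OF xc y(1)] y(2) f0 by simp
    then have "f y = f \<zero>" using reg[of "f y"] fh(1)[OF y(1) y(1)] f0 by simp
    then show ?thesis using inj_onD[OF f(2)] y(1) by auto
  qed
  let ?xK = "multiples K x"
  let ?xR = "(\<lambda>r. x \<otimes> r) ` carrier R"
  have sxK: "submodule ?xK R K"
    by (rule module_homs_image_submodule[OF K K K.smult_hom[OF xc] K.carrier_is_submodule])
  have sxR: "submodule ?xR R (self_module R)"
    using module_homs_image_submodule[OF S.module_axioms S.module_axioms S.smult_hom[OF xc] S.carrier_is_submodule]
    by simp

  have "\<exists>J l. simple_series R \<mm> (self_module R) J l \<and> J 0 = ?xR \<and> J l = carrier (self_module R)"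
  proof (rule S.simple_series_exists[OF R(1) noetherian_self_module[OF R'(1,2)] sxR])
    fix P assume P: "primeideal P R"
      "{r \<in> carrier R. \<forall>y\<in>carrier (self_module R). r \<odot>\<^bsub>self_module R\<^esub> y \<in> ?xR} \<subseteq> P"
    then have "x \<in> P" using xc by auto
    then show "P = \<mm>" using prime_over_regular_element[OF R xc xreg P(1)] by auto
  qed
  then obtain J l where J: "simple_series R \<mm> (self_module R) J l" "J 0 = ?xR" "J l = carrier R"
    by auto
  have sJ: "submodule (J i) R (self_module R)" if "i \<le> l" for i
    using J(1) that by (auto simp: simple_series_def)
  have Jc: "J i \<subseteq> carrier R" if "i \<le> l" for i using S.submoduleE(1)[OF sJ[OF that]] by simp

  \<comment> \<open>\<open>d\<close> to the power \<open>l\<close> descends the whole series \<open>J\<close>, so it is a multiple of \<open>x\<close>\<close>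
  have creg: "c = \<zero>\<^bsub>C\<^esub>" if c: "c \<in> carrier C" "x \<odot>\<^bsub>C\<^esub> c = \<zero>\<^bsub>C\<^esub>" for c
  proof -
    have "d [^] n \<in> J (l - n)" for n :: nat
    proof (induction n)
      case (Suc n)
      have "d \<otimes> d [^] n \<in> J (l - n - 1)"
        using S.simple_series_smult[OF J(1) R'(5) _ d(1) Suc] by simp
      then show ?case using dc by (simp add: K.R.m_comm)
    qed (use J(3) in simp)
    from this[of l] obtain r where r: "r \<in> carrier R" "d [^] l = x \<otimes> r" using J(2) by auto
    have "d [^] l \<odot>\<^bsub>C\<^esub> c = r \<odot>\<^bsub>C\<^esub> (x \<odot>\<^bsub>C\<^esub> c)"
      using r c xc by (simp add: C.smult_assoc1 C.smult_commute[of x r])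
    also have "\<dots> = \<zero>\<^bsub>C\<^esub>" using c r by simp
    finally show ?thesis using C.pow_smult_eq_zero[OF dc d(2) c(1)] by blast
  qed
  \<comment> \<open>\<open>R/xR\<close> embeds into \<open>K/xK\<close> since \<open>x\<close> is \<open>C\<close>-regular\<close>
  have fxK: "r \<in> ?xR" if r: "r \<in> carrier R" "f r \<in> ?xK" for r
  proof -
    obtain k where k: "k \<in> carrier K" "f r = x \<odot>\<^bsub>K\<^esub> k" using r(2) by auto
    have "x \<odot>\<^bsub>C\<^esub> g k = g (f r)" using gh(3)[OF xc k(1)] k(2) by simp
    also have "\<dots> = \<zero>\<^bsub>C\<^esub>" using ex r(1) by (auto simp: mod_kernel_def)
    finally have "g k = \<zero>\<^bsub>C\<^esub>" using creg gh(1)[OF k(1)] by simp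
    then have "k \<in> f ` carrier R" using ex k(1) by (simp add: mod_kernel_def)
    then obtain s where s: "s \<in> carrier R" "k = f s" by auto
    have "f r = f (x \<otimes> s)" using k s fh(3)[OF xc s(1)] by simp
    then show ?thesis using inj_onD[OF f(2)] r(1) s(1) xc by auto
  qed

  define E where "E i = {k \<in> carrier K. \<forall>a\<in>J i. a \<odot>\<^bsub>K\<^esub> k \<in> ?xK}" for i
  have sE: "submodule (E i) R K" if "i \<le> l" for i
    unfolding E_def by (rule K.submodule_colon[OF sxK Jc[OF that]])
  have E0: "E 0 = carrier K"
  proof -
    have "(x \<otimes> r) \<odot>\<^bsub>K\<^esub> k \<in> ?xK" if "r \<in> carrier R" "k \<in> carrier K" for r k
      using that xc by (auto simp: K.smult_assoc1)
    then show ?thesis unfolding E_def J(2) by auto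
  qed
  have El: "E l = ?xK"
  proof
    show "E l \<subseteq> ?xK"
    proof
      fix k assume "k \<in> E l"
      then have "k \<in> carrier K" "\<one> \<odot>\<^bsub>K\<^esub> k \<in> ?xK" unfolding E_def J(3) by blast+
      then show "k \<in> ?xK" by simp
    qed
    show "?xK \<subseteq> E l"
      unfolding E_def J(3) using K.submoduleE(1,4)[OF sxK] by blast
  qed
  have stepE: "simple_step R K (E (Suc i)) (E i)" if i: "i < l" for i
  proof -
    obtain u where u: "u \<in> carrier R" "J (Suc i) = adjoin_element R (self_module R) (J i) u"
      "\<forall>a\<in>\<mm>. a \<otimes> u \<in> J i"
      using J(1) i unfolding simple_series_def by force
    have sJi: "submodule (J i) R (self_module R)" using sJ i by simp
    have JJ: "J i \<subseteq> J (Suc i)" "u \<in> J (Suc i)"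
      using S.adjoin_element_superset[OF sJi, of u] u by auto
    \<comment> \<open>multiplication by the new generator \<open>u\<close> embeds the step into the socle of \<open>K/xK\<close>\<close>
    have Eiff: "k \<in> E (Suc i) \<longleftrightarrow> u \<odot>\<^bsub>K\<^esub> k \<in> ?xK" if k: "k \<in> E i" for k
    proof
      assume "k \<in> E (Suc i)" then show "u \<odot>\<^bsub>K\<^esub> k \<in> ?xK" using JJ by (auto simp: E_def)
    next
      assume uk: "u \<odot>\<^bsub>K\<^esub> k \<in> ?xK"
      have kc: "k \<in> carrier K" using k by (simp add: E_def)
      have "a \<odot>\<^bsub>K\<^esub> k \<in> ?xK" if aJ: "a \<in> J (Suc i)" for a
      proof -
        obtain n r where n: "n \<in> J i" "r \<in> carrier R" "a = n \<oplus> r \<otimes> u"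
          using aJ u(2) by (auto simp: adjoin_element_def)
        then have "a \<odot>\<^bsub>K\<^esub> k = n \<odot>\<^bsub>K\<^esub> k \<oplus>\<^bsub>K\<^esub> r \<odot>\<^bsub>K\<^esub> (u \<odot>\<^bsub>K\<^esub> k)"
          using Jc[of i] i u(1) kc by (auto simp: K.smult_l_distr K.smult_assoc1)
        moreover have "n \<odot>\<^bsub>K\<^esub> k \<in> ?xK" using k n(1) by (auto simp: E_def)
        moreover have "r \<odot>\<^bsub>K\<^esub> (u \<odot>\<^bsub>K\<^esub> k) \<in> ?xK" by (rule K.submoduleE(4)[OF sxK n(2) uk])
        ultimately show ?thesis using K.submoduleE(5)[OF sxK] by simp
      qed
      then show "k \<in> E (Suc i)" using kc by (simp add: E_def)
    qed
    have soc: "\<forall>a\<in>\<mm>. a \<odot>\<^bsub>K\<^esub> (u \<odot>\<^bsub>K\<^esub> k) \<in> ?xK" if k: "k \<in> E i" for k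
    proof
      fix a assume a: "a \<in> \<mm>"
      have kc: "k \<in> carrier K" and ac: "a \<in> carrier R" using k a R'(5) by (auto simp: E_def)
      have "(a \<otimes> u) \<odot>\<^bsub>K\<^esub> k \<in> ?xK" using u(3) a k unfolding E_def by blast
      then show "a \<odot>\<^bsub>K\<^esub> (u \<odot>\<^bsub>K\<^esub> k) \<in> ?xK" using K.smult_assoc1[OF ac u(1) kc] by simp
    qed
    have "\<exists>r\<in>carrier R. w \<ominus>\<^bsub>K\<^esub> r \<odot>\<^bsub>K\<^esub> v \<in> E (Suc i)" if v: "v \<in> E i - E (Suc i)" and w: "w \<in> E i" for v w
    proof -
      have vc: "v \<in> carrier K" and wc: "w \<in> carrier K" using v w by (auto simp: E_def)
      have "u \<odot>\<^bsub>K\<^esub> v \<notin> ?xK" using v Eiff by blast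
      then obtain r where r: "r \<in> carrier R" "u \<odot>\<^bsub>K\<^esub> w \<ominus>\<^bsub>K\<^esub> r \<odot>\<^bsub>K\<^esub> (u \<odot>\<^bsub>K\<^esub> v) \<in> ?xK"
        using socle[of "u \<odot>\<^bsub>K\<^esub> v" "u \<odot>\<^bsub>K\<^esub> w"] soc v w u(1) vc wc by auto
      have "u \<odot>\<^bsub>K\<^esub> (w \<ominus>\<^bsub>K\<^esub> r \<odot>\<^bsub>K\<^esub> v) = u \<odot>\<^bsub>K\<^esub> w \<ominus>\<^bsub>K\<^esub> r \<odot>\<^bsub>K\<^esub> (u \<odot>\<^bsub>K\<^esub> v)"
        using K.smult_diff_distr[OF u(1) wc] r(1) vc u(1) by (simp add: K.smult_commute)
      moreover have "w \<ominus>\<^bsub>K\<^esub> r \<odot>\<^bsub>K\<^esub> v \<in> E i"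
        using K.submodule_minus_mem[OF sE w] K.submoduleE(4)[OF sE r(1)] v i by simp
      ultimately have "w \<ominus>\<^bsub>K\<^esub> r \<odot>\<^bsub>K\<^esub> v \<in> E (Suc i)" using Eiff r(2) by metis
      then show ?thesis using r(1) by blast
    qed
    moreover have "E (Suc i) \<subseteq> E i" using JJ by (auto simp: E_def)
    ultimately show ?thesis unfolding simple_step_def by blast
  qed

  define P where "P i = f ` J i <+>\<^bsub>K\<^esub> ?xK" for i
  have memP: "k \<in> P i \<longleftrightarrow> (\<exists>a\<in>J i. \<exists>k'\<in>carrier K. k = f a \<oplus>\<^bsub>K\<^esub> x \<odot>\<^bsub>K\<^esub> k')" for k i
    by (auto simp: P_def set_add_def')
  have sP: "submodule (P i) R K" if "i \<le> l" for i
    unfolding P_def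
    by (rule submodule_set_add[OF K module_homs_image_submodule[OF S.module_axioms K f(1) sJ[OF that]] sxK])
  have strictP: "P i \<subset> P (Suc i)" if i: "i < l" for i
  proof -
    obtain u where u: "u \<in> carrier R" "u \<notin> J i" "J (Suc i) = adjoin_element R (self_module R) (J i) u"
      using J(1) i unfolding simple_series_def by force
    have sJi: "submodule (J i) R (self_module R)" using sJ i by simp
    have JJ: "J i \<subseteq> J (Suc i)" "u \<in> J (Suc i)"
      using S.adjoin_element_superset[OF sJi, of u] u by auto
    have "f u \<in> P (Suc i)"
      unfolding memP using JJ(2) fh(1)[OF u(1) u(1)] xc by (intro bexI[of _ u] bexI[of _ "\<zero>\<^bsub>K\<^esub>"]) auto
    moreover have "f u \<notin> P i"
    proof
      assume "f u \<in> P i"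
      then obtain a k where a: "a \<in> J i" "k \<in> carrier K" "f u = f a \<oplus>\<^bsub>K\<^esub> x \<odot>\<^bsub>K\<^esub> k" unfolding memP by blast
      have ac: "a \<in> carrier R" using a(1) Jc[of i] i by auto
      have "f (u \<ominus> a) = x \<odot>\<^bsub>K\<^esub> k"
        using fd[OF u(1) ac] a(2,3) fh(1)[OF ac ac] xc
        by (simp add: a_minus_def K.M.add.m_comm[of "f a"] K.M.add.m_assoc K.M.r_neg)
      then have "u \<ominus> a \<in> ?xR" using fxK[of "u \<ominus> a"] u(1) ac a(2) by auto
      then have "u \<ominus> a \<in> J i" using S.simple_series_mono[OF J(1), of i] i J(2) by auto
      then show False using S.submodule_mem_of_diff[OF sJi a(1), of u] u(1,2) by auto
    qed
    moreover have "P i \<subseteq> P (Suc i)" using JJ(1) unfolding subset_iff memP by blast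
    ultimately show ?thesis by blast
  qed
  \<comment> \<open>otherwise \<open>K\<close> could be added to the chain \<open>P\<close>, which would then be longer than \<open>E\<close>\<close>
  have "P l = carrier K"
  proof (rule ccontr)
    assume ne: "P l \<noteq> carrier K"
    let ?P = "P(Suc l := carrier K)"
    have "Suc l \<le> l"
    proof (rule K.chain_length_le[where E = "\<lambda>i. E (l - i)" and P = ?P])
      fix i assume "i < l"
      then show "simple_step R K (E (l - i)) (E (l - Suc i))"
        using stepE[of "l - Suc i"] by (simp add: Suc_diff_Suc)
    next
      fix i assume "i < Suc l"
      then consider "i < l" | "i = l" by linarith
      then show "?P i \<subset> ?P (Suc i)"
      proof cases
        case 2
        then show ?thesis using ne K.submoduleE(1)[OF sP[of l]] by auto
      qed (use strictP in auto)
    next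
      have "?xK \<subseteq> P 0"
      proof
        fix k assume k: "k \<in> ?xK"
        have z: "\<zero> \<in> J 0" using submodule_zero_mem[OF sJ[of 0]] by simp
        show "k \<in> P 0" using k xc f0 unfolding memP by (intro bexI[OF _ z]) auto
      qed
      then show "E (l - 0) \<subseteq> ?P 0" using El by simp
    qed (use sE sP K.carrier_is_submodule E0 in auto)
    then show False by simp
  qed
  show ?thesis
  proof (rule C.divisible_noetherian_zero[OF R(1) C(2) x])
    fix c assume "c \<in> carrier C"
    then obtain k where k: "k \<in> carrier K" "c = g k" using g(2) by auto
    then obtain r k' where r: "r \<in> carrier R" "k' \<in> carrier K" "k = f r \<oplus>\<^bsub>K\<^esub> x \<odot>\<^bsub>K\<^esub> k'"
      using \<open>P l = carrier K\<close> memP[of k l] J(3) by auto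
    have "g (f r) = \<zero>\<^bsub>C\<^esub>" using ex r(1) by (auto simp: mod_kernel_def)
    then have "c = x \<odot>\<^bsub>C\<^esub> g k'" using k r gh fh(1)[OF r(1) r(1)] xc by simp
    then show "\<exists>c'\<in>carrier C. c = x \<odot>\<^bsub>C\<^esub> c'" using gh(1)[OF r(2)] by blast
  qed
qed


lemma Sup_enat_attained:
  fixes A :: "enat set"
  assumes "Sup A = enat n" "A \<noteq> {}"
  shows "enat n \<in> A"
proof -
  have "finite A"
  proof (rule ccontr)
    assume "infinite A"
    then have "Sup A = \<infinity>" using assms(2) by (simp add: Sup_enat_def)
    then show False using assms(1) by simp
  qed
  then have "Max A \<in> A" "Sup A = Max A" using assms(2) by (simp_all add: Sup_enat_def)
  then show ?thesis using assms(1) by metis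
qed

lemma (in module) length_quotient_le_series:
  assumes "noetherian_local_ring R \<mm>" "simple_series R \<mm> M E l" "E l = carrier M"
  shows "module_length R (quot_module M (E 0)) \<le> enat l"
proof -
  have s: "submodule (E i) R M" if "i \<le> l" for i using assms(2) that by (auto simp: simple_series_def)
  have "n \<le> l" if P: "\<forall>i\<le>n. submodule (P i) R M" "\<forall>i<n. P i \<subset> P (Suc i)" "E 0 \<subseteq> P 0" for n P
    by (rule chain_length_le[of l E n P])
       (use s P simple_series_simple_step[OF assms(1,2)] submoduleE(1) assms(3) in auto)
  then show ?thesis unfolding module_length_quot_module[OF s[of 0, simplified]]
    by (intro Sup_least) auto
qed

text \<open>A chain above \<open>N'\<close> that realises the length can be extended downwards by \<open>N\<close>.\<close>

lemma (in module) length_quotient_lt: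
  assumes N: "submodule N R M" "submodule N' R M" "N \<subset> N'"
    and len: "module_length R (quot_module M N') = enat n"
  shows "enat (Suc n) \<le> module_length R (quot_module M N)"
proof -
  let ?A = "{enat n |n. \<exists>P. (\<forall>i\<le>n. submodule (P i) R M) \<and> (\<forall>i<n. P i \<subset> P (Suc i)) \<and> N' \<subseteq> P 0}"
  have "enat 0 \<in> ?A" using N(2) by (auto intro!: exI[of _ "\<lambda>_. N'"])
  then have "enat n \<in> ?A"
    using Sup_enat_attained[of ?A n] len unfolding module_length_quot_module[OF N(2)] by blast
  then obtain P where P: "\<forall>i\<le>n. submodule (P i) R M" "\<forall>i<n. P i \<subset> P (Suc i)" "N' \<subseteq> P 0" by auto
  define Q where "Q i = (case i of 0 \<Rightarrow> N | Suc j \<Rightarrow> P j)" for i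
  have "(\<forall>i\<le>Suc n. submodule (Q i) R M) \<and> (\<forall>i<Suc n. Q i \<subset> Q (Suc i)) \<and> N \<subseteq> Q 0"
    using P N by (auto simp: Q_def split: nat.splits)
  then show ?thesis unfolding module_length_quot_module[OF N(1)] by (intro Sup_upper) blast
qed

text \<open>Each factor from \<open>\<aa>\<close> descends the series by one member; subtraction is truncated at \<open>0\<close>, where the
series stays.\<close>

lemma (in module) ideal_power_smult_series:
  assumes E: "simple_series R \<mm> M E l" "\<mm> \<subseteq> carrier R" "ideal \<aa> R" "\<aa> \<subseteq> \<mm>"
  shows "ideal (\<aa> [^]\<^bsub>ideals_set R\<^esub> n) R \<and>
    (\<forall>r\<in>\<aa> [^]\<^bsub>ideals_set R\<^esub> n. \<forall>j\<le>l. \<forall>c\<in>E j. r \<odot>\<^bsub>M\<^esub> c \<in> E (j - n))"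
proof -
  interpret IS: Group.comm_monoid "ideals_set R" by (rule R.ideals_set_is_comm_monoid)
  have s: "submodule (E i) R M" if "i \<le> l" for i using E(1) that by (auto simp: simple_series_def)
  have Ec: "c \<in> carrier M" if "i \<le> l" "c \<in> E i" for i c using submoduleE(1)[OF s[OF that(1)]] that(2) by auto
  show ?thesis
  proof (induction n)
    case 0
    have "\<aa> [^]\<^bsub>ideals_set R\<^esub> (0::nat) = carrier R"
      by (simp add: ideals_set_def)
    then show ?case using R.oneideal submoduleE(4)[OF s] by auto
  next
    case (Suc n)
    let ?A = "\<aa> [^]\<^bsub>ideals_set R\<^esub> n"
    have eq: "\<aa> [^]\<^bsub>ideals_set R\<^esub> Suc n = ideal_prod R ?A \<aa>"
      by (simp add: ideals_set_def)
    have A: "ideal ?A R" using Suc by blast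
    have "r \<in> carrier R \<and> (\<forall>j\<le>l. \<forall>c\<in>E j. r \<odot>\<^bsub>M\<^esub> c \<in> E (j - Suc n))" if "r \<in> ideal_prod R ?A \<aa>" for r
      using that
    proof (induction r rule: ideal_prod.induct)
      case (prod p q)
      have pc: "p \<in> carrier R" and qc: "q \<in> carrier R"
        using ideal.Icarr[OF A] ideal.Icarr[OF E(3)] prod by auto
      have "(p \<otimes> q) \<odot>\<^bsub>M\<^esub> c \<in> E (j - Suc n)" if j: "j \<le> l" "c \<in> E j" for j c
      proof -
        have qE: "q \<odot>\<^bsub>M\<^esub> c \<in> E (j - 1)"
          using simple_series_smult[OF E(1,2) j(1) _ j(2)] prod(2) E(4) by auto
        have "p \<odot>\<^bsub>M\<^esub> (q \<odot>\<^bsub>M\<^esub> c) \<in> E (j - 1 - n)"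
          by (rule Suc[THEN conjunct2, rule_format, OF prod(1) _ qE]) (use j(1) in simp)
        then show ?thesis using pc qc Ec[OF j] by (simp add: smult_assoc1)
      qed
      then show ?case using pc qc by auto
    next
      case (sum p q)
      have "(p \<oplus> q) \<odot>\<^bsub>M\<^esub> c \<in> E (j - Suc n)" if j: "j \<le> l" "c \<in> E j" for j c
        using sum j Ec[OF j] submoduleE(5)[OF s[of "j - Suc n"]] by (auto simp: smult_l_distr)
      then show ?case using sum by auto
    qed
    then show ?case unfolding eq using R.ideal_prod_is_ideal[OF A E(3)] by blast
  qed
qed

text \<open>In dimension zero the Hilbert-Samuel polynomial is the constant \<open>c 0\<close>, and \<open>\<aa>\<^sup>n\<^sup>+\<^sup>1M = 0\<close> for large \<open>n\<close>.\<close>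

theorem (in module) multiplicity_eq_length_dim_zero:
  assumes R: "noetherian_local_ring R \<mm>" and E: "simple_series R \<mm> M E l" "E 0 = {\<zero>\<^bsub>M\<^esub>}" "E l = carrier M"
    and \<aa>: "ideal \<aa> R" "\<aa> \<subseteq> \<mm>" and dim: "module_dim R M = 0"
  shows "enat (multiplicity_wrt R \<aa> M) = module_length R (quot_module M {\<zero>\<^bsub>M\<^esub>})"
proof -
  have "module_length R (quot_module M {\<zero>\<^bsub>M\<^esub>}) \<le> enat l"
    using length_quotient_le_series[OF R E(1,3)] E(2) by simp
  then obtain L where L: "module_length R (quot_module M {\<zero>\<^bsub>M\<^esub>}) = enat L" by (cases "module_length R (quot_module M {\<zero>\<^bsub>M\<^esub>})") auto
  have pow: "ideal_smult R (\<aa> [^]\<^bsub>ideals_set R\<^esub> Suc n) M = {\<zero>\<^bsub>M\<^esub>}" if n: "n \<ge> l" for n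
  proof -
    note p = ideal_power_smult_series[OF E(1) noetherian_local_ringD(5)[OF R] \<aa>, of "Suc n"]
    have "ideal_smult R (\<aa> [^]\<^bsub>ideals_set R\<^esub> Suc n) M \<subseteq> {\<zero>\<^bsub>M\<^esub>}"
    proof (rule ideal_smult_minimal[OF submodule_zero_submodule])
      fix a x assume "a \<in> \<aa> [^]\<^bsub>ideals_set R\<^esub> Suc n" "x \<in> carrier M"
      then have "a \<odot>\<^bsub>M\<^esub> x \<in> E (l - Suc n)" using p E(3) by blast
      then show "a \<odot>\<^bsub>M\<^esub> x \<in> {\<zero>\<^bsub>M\<^esub>}" using n E(2) by simp
    qed
    moreover have "\<aa> [^]\<^bsub>ideals_set R\<^esub> Suc n \<subseteq> carrier R"
      by (rule subsetI) (rule ideal.Icarr[OF conjunct1[OF p]])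
    ultimately show ?thesis using submodule_zero_mem[OF ideal_smult_submodule] by blast
  qed
  have "multiplicity_wrt R \<aa> M = L"
    unfolding multiplicity_wrt_def
  proof (rule the_equality)
    show "\<exists>s c. module_dim R M = enat s \<and> c 0 = int L \<and> (\<exists>n0. \<forall>n\<ge>n0. \<exists>k. module_length R
      (quot_module M (ideal_smult R (\<aa> [^]\<^bsub>ideals_set R\<^esub> Suc n) M)) = enat k \<and>
      int k = (\<Sum>i\<le>s. (- 1) ^ i * c i * int ((n + s - i) choose (s - i))))"
    proof (intro exI conjI allI impI)
      show "module_dim R M = enat 0" using dim by (simp add: zero_enat_def)
      show "(\<lambda>_. int L) 0 = int L" by simp
      fix n assume "n \<ge> l"
      then show "module_length R (quot_module M (ideal_smult R (\<aa> [^]\<^bsub>ideals_set R\<^esub> Suc n) M)) = enat L"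
        using pow[of n] L by simp
      show "int L = (\<Sum>i\<le>0. (- 1) ^ i * (\<lambda>_. int L) i * int ((n + 0 - i) choose (0 - i)))" by simp
    qed
    fix e assume "\<exists>s c. module_dim R M = enat s \<and> c 0 = int e \<and> (\<exists>n0. \<forall>n\<ge>n0. \<exists>k. module_length R
      (quot_module M (ideal_smult R (\<aa> [^]\<^bsub>ideals_set R\<^esub> Suc n) M)) = enat k \<and>
      int k = (\<Sum>i\<le>s. (- 1) ^ i * c i * int ((n + s - i) choose (s - i))))"
    then obtain s c n0 where s: "module_dim R M = enat s" "c 0 = int e"
      and n0: "\<forall>n\<ge>n0. \<exists>k. module_length R
        (quot_module M (ideal_smult R (\<aa> [^]\<^bsub>ideals_set R\<^esub> Suc n) M)) = enat k \<and>
        int k = (\<Sum>i\<le>s. (- 1) ^ i * c i * int ((n + s - i) choose (s - i)))" by blast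
    have s0: "s = 0" using s(1) dim by (simp add: zero_enat_def)
    obtain k where "module_length R
        (quot_module M (ideal_smult R (\<aa> [^]\<^bsub>ideals_set R\<^esub> Suc (max n0 l)) M)) = enat k" "int k = c 0"
      using n0[rule_format, of "max n0 l"] s0 by auto
    then show "e = L" using pow[of "max n0 l"] L s(2) by simp
  qed
  then show ?thesis using L by simp
qed

corollary (in module) ideal_smult_zero_of_multiplicity:
  assumes R: "noetherian_local_ring R \<mm>" and M: "noetherian_module R M" "carrier M \<noteq> {\<zero>\<^bsub>M\<^esub>}"
    and \<aa>: "ideal \<aa> R" "\<aa> \<subseteq> \<mm>" and dim: "module_dim R M = 0"
    and mult: "enat (multiplicity_wrt R \<aa> M) = module_length R (quot_module M (ideal_smult R \<aa> M))"
  shows "ideal_smult R \<aa> M = {\<zero>\<^bsub>M\<^esub>}"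
proof -
  have ann: "annihilator R M = {r \<in> carrier R. \<forall>y\<in>carrier M. r \<odot>\<^bsub>M\<^esub> y \<in> {\<zero>\<^bsub>M\<^esub>}}"
    by (simp add: annihilator_def)
  interpret S: module R "self_module R" by (rule self_module_module[OF R.is_cring])
  have "submodule (annihilator R M) R (self_module R)"
    by (rule S.submoduleI) (auto simp: annihilator_def smult_l_distr smult_l_minus smult_assoc1)
  then have ia: "ideal (annihilator R M) R" by (simp add: submodule_self_module_iff[OF R.is_cring])
  have "\<exists>E l. simple_series R \<mm> M E l \<and> E 0 = {\<zero>\<^bsub>M\<^esub>} \<and> E l = carrier M"
    by (rule simple_series_exists[OF R M(1) submodule_zero_submodule])
       (use prime_over_ideal_dim_zero[OF R ia] dim ann in \<open>auto simp: module_dim_def\<close>)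
  then obtain E l where E: "simple_series R \<mm> M E l" "E 0 = {\<zero>\<^bsub>M\<^esub>}" "E l = carrier M" by blast
  note eq = multiplicity_eq_length_dim_zero[OF R E \<aa> dim]
  have s: "submodule (ideal_smult R \<aa> M) R M"
    by (rule ideal_smult_submodule) (use \<aa> noetherian_local_ringD(5)[OF R] in auto)
  show ?thesis
  proof (rule ccontr)
    assume "ideal_smult R \<aa> M \<noteq> {\<zero>\<^bsub>M\<^esub>}"
    then have "{\<zero>\<^bsub>M\<^esub>} \<subset> ideal_smult R \<aa> M" using submodule_zero_mem[OF s] by auto
    from length_quotient_lt[OF submodule_zero_submodule s this mult[symmetric]] eq
    have "enat (Suc (multiplicity_wrt R \<aa> M)) \<le> enat (multiplicity_wrt R \<aa> M)" by simp
    then show False by simp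
  qed
qed


section \<open>Free modules\<close>

lemma (in module) finsum_submodule_mem:
  assumes "submodule P R M" "finite F" "\<And>i. i \<in> F \<Longrightarrow> f i \<in> P"
  shows "(\<Oplus>\<^bsub>M\<^esub>i\<in>F. f i) \<in> P"
  using assms(2,3)
proof (induction F)
  case empty
  then show ?case using submodule_zero_mem[OF assms(1)] by simp
next
  case (insert i F)
  have "f \<in> insert i F \<rightarrow> carrier M" using insert.prems submoduleE(1)[OF assms(1)] by auto
  then show ?case using insert submoduleE(5)[OF assms(1)] by simp
qed

lemma module_hom_finsum:
  assumes "module R M" "module R N" "h \<in> module_homs R M N" "finite F" "f \<in> F \<rightarrow> carrier M"
  shows "h (\<Oplus>\<^bsub>M\<^esub>i\<in>F. f i) = (\<Oplus>\<^bsub>N\<^esub>i\<in>F. h (f i))"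
proof -
  interpret M: module R M by fact
  interpret N: module R N by fact
  note h = module_homsD[OF assms(3)]
  show ?thesis
    using assms(4,5)
  proof (induction F)
    case empty
    then show ?case using module_hom_zero[OF assms(1-3)] by simp
  next
    case (insert i F)
    then have "f \<in> F \<rightarrow> carrier M" "f i \<in> carrier M" by auto
    moreover from this have "(\<lambda>i. h (f i)) \<in> F \<rightarrow> carrier N" "h (f i) \<in> carrier N" using h(1) by auto
    ultimately show ?case using insert h(2) by (simp add: M.finsum_closed)
  qed
qed

text \<open>A basis, rephrased in terms of arbitrary finite linear combinations instead of coefficient
functions with prescribed support: generation and linear independence.\<close>

definition module_basis :: "('a, 'r) ring_scheme \<Rightarrow> ('a, 'b, 'p) module_scheme \<Rightarrow> 'b set \<Rightarrow> bool" where
  "module_basis R M B \<longleftrightarrow> B \<subseteq> carrier M \<and>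
     (\<forall>x\<in>carrier M. \<exists>F c. finite F \<and> F \<subseteq> B \<and> c \<in> F \<rightarrow> carrier R \<and> x = (\<Oplus>\<^bsub>M\<^esub>b\<in>F. c b \<odot>\<^bsub>M\<^esub> b)) \<and>
     (\<forall>F c. finite F \<and> F \<subseteq> B \<and> c \<in> F \<rightarrow> carrier R \<and> (\<Oplus>\<^bsub>M\<^esub>b\<in>F. c b \<odot>\<^bsub>M\<^esub> b) = \<zero>\<^bsub>M\<^esub> \<longrightarrow>
        (\<forall>b\<in>F. c b = \<zero>\<^bsub>R\<^esub>))"

lemma module_basisD:
  assumes "module_basis R M B"
  shows "B \<subseteq> carrier M"
    and "x \<in> carrier M \<Longrightarrow> \<exists>F c. finite F \<and> F \<subseteq> B \<and> c \<in> F \<rightarrow> carrier R \<and> x = (\<Oplus>\<^bsub>M\<^esub>b\<in>F. c b \<odot>\<^bsub>M\<^esub> b)"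
    and "finite F \<Longrightarrow> F \<subseteq> B \<Longrightarrow> c \<in> F \<rightarrow> carrier R \<Longrightarrow> (\<Oplus>\<^bsub>M\<^esub>b\<in>F. c b \<odot>\<^bsub>M\<^esub> b) = \<zero>\<^bsub>M\<^esub> \<Longrightarrow>
      b \<in> F \<Longrightarrow> c b = \<zero>\<^bsub>R\<^esub>"
  using assms by (simp_all add: module_basis_def)

lemma free_module_basis:
  fixes R (structure)
  assumes "free_module R M"
  shows "\<exists>B. module_basis R M B"
proof -
  interpret module R M using assms by (simp add: free_module_def)
  obtain B where B: "B \<subseteq> carrier M" and ex1: "\<And>x. x \<in> carrier M \<Longrightarrow>
    \<exists>!c. c \<in> B \<rightarrow>\<^sub>E carrier R \<and> finite {b \<in> B. c b \<noteq> \<zero>\<^bsub>R\<^esub>} \<and>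
          x = (\<Oplus>\<^bsub>M\<^esub>b\<in>{b \<in> B. c b \<noteq> \<zero>\<^bsub>R\<^esub>}. c b \<odot>\<^bsub>M\<^esub> b)"
  proof -
    have "\<exists>B\<subseteq>carrier M. \<forall>x\<in>carrier M. \<exists>!c. c \<in> B \<rightarrow>\<^sub>E carrier R \<and>
      finite {b \<in> B. c b \<noteq> \<zero>\<^bsub>R\<^esub>} \<and> x = (\<Oplus>\<^bsub>M\<^esub>b\<in>{b \<in> B. c b \<noteq> \<zero>\<^bsub>R\<^esub>}. c b \<odot>\<^bsub>M\<^esub> b)"
      using assms unfolding free_module_def by (rule conjunct2)
    then show ?thesis by (elim exE conjE) (rule that, assumption, rule bspec)
  qed
  show ?thesis
    unfolding module_basis_def
  proof (rule exI[of _ B], intro conjI allI ballI impI B)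
    fix x assume "x \<in> carrier M"
    then obtain c where c: "c \<in> B \<rightarrow>\<^sub>E carrier R" "finite {b \<in> B. c b \<noteq> \<zero>}"
          "x = (\<Oplus>\<^bsub>M\<^esub>b\<in>{b \<in> B. c b \<noteq> \<zero>}. c b \<odot>\<^bsub>M\<^esub> b)" using ex1 by blast
    then show "\<exists>F c. finite F \<and> F \<subseteq> B \<and> c \<in> F \<rightarrow> carrier R \<and> x = (\<Oplus>\<^bsub>M\<^esub>b\<in>F. c b \<odot>\<^bsub>M\<^esub> b)"
      by (intro exI[of _ "{b \<in> B. c b \<noteq> \<zero>}"] exI[of _ c]) auto
  next
    fix F c a assume "finite F \<and> F \<subseteq> B \<and> c \<in> F \<rightarrow> carrier R \<and> (\<Oplus>\<^bsub>M\<^esub>b\<in>F. c b \<odot>\<^bsub>M\<^esub> b) = \<zero>\<^bsub>M\<^esub>" and a: "a \<in> F"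
    then have F: "finite F" "F \<subseteq> B" "c \<in> F \<rightarrow> carrier R" "(\<Oplus>\<^bsub>M\<^esub>b\<in>F. c b \<odot>\<^bsub>M\<^esub> b) = \<zero>\<^bsub>M\<^esub>" by simp_all
    define c' where "c' = (\<lambda>b\<in>B. if b \<in> F then c b else \<zero>)"
    have supp: "{b \<in> B. c' b \<noteq> \<zero>} = {b \<in> F. c b \<noteq> \<zero>}" using F(2) by (auto simp: c'_def)
    have "(\<Oplus>\<^bsub>M\<^esub>b\<in>{b \<in> B. c' b \<noteq> \<zero>}. c' b \<odot>\<^bsub>M\<^esub> b) = (\<Oplus>\<^bsub>M\<^esub>b\<in>F. c b \<odot>\<^bsub>M\<^esub> b)"
      unfolding supp
      by (rule M.add.finprod_mono_neutral_cong_left) (use F B in \<open>auto simp: c'_def\<close>)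
    then have 1: "\<zero>\<^bsub>M\<^esub> = (\<Oplus>\<^bsub>M\<^esub>b\<in>{b \<in> B. c' b \<noteq> \<zero>}. c' b \<odot>\<^bsub>M\<^esub> b)" using F(4) by simp
    have 2: "c' \<in> B \<rightarrow>\<^sub>E carrier R" using F by (auto simp: c'_def)
    have 3: "finite {b \<in> B. c' b \<noteq> \<zero>}" unfolding supp using F(1) by auto
    let ?z = "\<lambda>b\<in>B. \<zero>"
    have z: "{b \<in> B. ?z b \<noteq> \<zero>} = {}" by auto
    have zz: "?z \<in> B \<rightarrow>\<^sub>E carrier R \<and> finite {b \<in> B. ?z b \<noteq> \<zero>} \<and>
      \<zero>\<^bsub>M\<^esub> = (\<Oplus>\<^bsub>M\<^esub>b\<in>{b \<in> B. ?z b \<noteq> \<zero>}. ?z b \<odot>\<^bsub>M\<^esub> b)" unfolding z by auto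
    define Q where "Q c \<longleftrightarrow> c \<in> B \<rightarrow>\<^sub>E carrier R \<and> finite {b \<in> B. c b \<noteq> \<zero>} \<and>
      \<zero>\<^bsub>M\<^esub> = (\<Oplus>\<^bsub>M\<^esub>b\<in>{b \<in> B. c b \<noteq> \<zero>}. c b \<odot>\<^bsub>M\<^esub> b)" for c
    have "\<exists>!c. Q c" unfolding Q_def by (rule ex1[OF M.zero_closed])
    moreover have "Q c'" unfolding Q_def by (intro conjI 1 2 3)
    moreover have "Q ?z" unfolding Q_def by (rule zz)
    ultimately have "c' = ?z" by blast
    then have "c' a = \<zero>" using F(2) a by (simp add: subset_iff)
    then show "c a = \<zero>" using F(2) a by (simp add: c'_def subset_iff)
  qed
qed

lemma free_module_annihilator:
  fixes R (structure)
  assumes "free_module R M" "carrier M \<noteq> {\<zero>\<^bsub>M\<^esub>}" "r \<in> carrier R"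
    "\<And>x. x \<in> carrier M \<Longrightarrow> r \<odot>\<^bsub>M\<^esub> x = \<zero>\<^bsub>M\<^esub>"
  shows "r = \<zero>\<^bsub>R\<^esub>"
proof -
  interpret module R M using assms(1) by (simp add: free_module_def)
  obtain B where "module_basis R M B" using free_module_basis[OF assms(1)] by blast
  note B = module_basisD[OF this]
  have "B \<noteq> {}"
  proof
    assume "B = {}"
    then have "x = \<zero>\<^bsub>M\<^esub>" if "x \<in> carrier M" for x using B(2)[OF that] by auto
    then show False using assms(2) by auto
  qed
  then obtain b where b: "b \<in> B" by auto
  then have "(\<Oplus>\<^bsub>M\<^esub>x\<in>{b}. r \<odot>\<^bsub>M\<^esub> x) = \<zero>\<^bsub>M\<^esub>"
    using assms(3,4) B(1) by (auto simp: subset_iff)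
  then show ?thesis using B(3)[of "{b}" "\<lambda>_. r" b] b assms(3) by auto
qed

text \<open>The submodule \<open>P\<close> plays the role of \<open>\<mm>M\<close>: if a nonzero scalar kills \<open>w\<close>, then no
coordinate of \<open>w\<close> is a unit.\<close>

lemma free_module_torsion_element:
  fixes R (structure)
  assumes "free_module R M" "w \<in> carrier M" "y \<in> carrier R" "y \<noteq> \<zero>\<^bsub>R\<^esub>" "y \<odot>\<^bsub>M\<^esub> w = \<zero>\<^bsub>M\<^esub>"
    and P: "submodule P R M"
      "\<And>t v. t \<in> carrier R \<Longrightarrow> t \<notin> Units R \<Longrightarrow> v \<in> carrier M \<Longrightarrow> t \<odot>\<^bsub>M\<^esub> v \<in> P"
  shows "w \<in> P"
proof -
  interpret module R M using assms(1) by (simp add: free_module_def)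
  obtain B where "module_basis R M B" using free_module_basis[OF assms(1)] by blast
  note B = module_basisD[OF this]
  obtain F c where F: "finite F" "F \<subseteq> B" "c \<in> F \<rightarrow> carrier R" "w = (\<Oplus>\<^bsub>M\<^esub>b\<in>F. c b \<odot>\<^bsub>M\<^esub> b)"
    using B(2)[OF assms(2)] by (elim exE conjE) (rule that)
  have Fc: "b \<in> carrier M" "c b \<in> carrier R" if "b \<in> F" for b using F B(1) that by auto
  have "y \<odot>\<^bsub>M\<^esub> w = (\<Oplus>\<^bsub>M\<^esub>b\<in>F. y \<odot>\<^bsub>M\<^esub> (c b \<odot>\<^bsub>M\<^esub> b))"
    unfolding F(4) by (rule finsum_smult_ldistr[OF F(1) assms(3)]) (use Fc in auto)
  also have "\<dots> = (\<Oplus>\<^bsub>M\<^esub>b\<in>F. (y \<otimes> c b) \<odot>\<^bsub>M\<^esub> b)"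
    by (rule M.add.finprod_cong') (use Fc assms(3) in \<open>auto simp: smult_assoc1\<close>)
  finally have "(\<Oplus>\<^bsub>M\<^esub>b\<in>F. (y \<otimes> c b) \<odot>\<^bsub>M\<^esub> b) = \<zero>\<^bsub>M\<^esub>" using assms(5) by simp
  then have z: "y \<otimes> c b = \<zero>" if "b \<in> F" for b
    by (rule B(3)[OF F(1,2), rotated]) (use assms(3) Fc that in auto)
  have "c b \<notin> Units R" if b: "b \<in> F" for b
  proof
    assume u: "c b \<in> Units R"
    have "y = y \<otimes> c b \<otimes> inv (c b)" using u assms(3) by (simp add: R.m_assoc R.Units_closed)
    also have "\<dots> = \<zero>" using z b u by simp
    finally show False using assms(4) by simp
  qed
  then show ?thesis unfolding F(4) using Fc by (intro finsum_submodule_mem[OF P(1) F(1)] P(2)) auto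
qed

text \<open>A surjection onto a free module splits. The complement \<open>\<Sigma>\<close> of its kernel consists of the linear
combinations of chosen preimages of the basis elements.\<close>

theorem free_quotient_complement:
  assumes V: "module R V" and W: "free_module R W"
    and h: "h \<in> module_homs R V W" "h ` carrier V = carrier W"
  shows "\<exists>\<Sigma>. submodule \<Sigma> R V \<and> (\<forall>v\<in>carrier V. \<exists>s\<in>\<Sigma>. h s = h v) \<and> (\<forall>s\<in>\<Sigma>. h s = \<zero>\<^bsub>W\<^esub> \<longrightarrow> s = \<zero>\<^bsub>V\<^esub>)"
proof -
  interpret V: module R V by fact
  interpret W: module R W using W by (simp add: free_module_def)
  note hh = module_homsD[OF h(1)]
  obtain B where "module_basis R W B" using free_module_basis[OF W] by blast
  note B = module_basisD[OF this]
  have "\<exists>v. v \<in> carrier V \<and> h v = b" if "b \<in> B" for b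
  proof -
    have "b \<in> h ` carrier V" using that B(1) h(2) by auto
    then show ?thesis by auto
  qed
  then obtain k where k: "\<And>b. b \<in> B \<Longrightarrow> k b \<in> carrier V" "\<And>b. b \<in> B \<Longrightarrow> h (k b) = b" by metis
  define S where "S F c = (\<Oplus>\<^bsub>V\<^esub>b\<in>F. c b \<odot>\<^bsub>V\<^esub> k b)" for F c
  let ?ok = "\<lambda>F c. finite F \<and> F \<subseteq> B \<and> c \<in> F \<rightarrow> carrier R"
  let ?\<Sigma> = "{S F c |F c. ?ok F c}"
  have okD: "b \<in> B" "c b \<in> carrier R" "k b \<in> carrier V" if "?ok F c" "b \<in> F" for F c b
    using that k(1) by (auto simp: subset_iff)
  have tm: "c b \<odot>\<^bsub>V\<^esub> k b \<in> carrier V" if "?ok F c" "b \<in> F" for F c b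
    by (rule V.smult_closed) (use that k in auto)
  have Sc: "S F c \<in> carrier V" if "?ok F c" for F c
    unfolding S_def by (rule V.finsum_closed) (use tm[OF that] in auto)
  have hS: "h (S F c) = (\<Oplus>\<^bsub>W\<^esub>b\<in>F. c b \<odot>\<^bsub>W\<^esub> b)" if "?ok F c" for F c
  proof -
    have "h (S F c) = (\<Oplus>\<^bsub>W\<^esub>b\<in>F. h (c b \<odot>\<^bsub>V\<^esub> k b))"
      unfolding S_def by (rule module_hom_finsum[OF V W.module_axioms h(1)]) (use that tm in auto)
    also have "\<dots> = (\<Oplus>\<^bsub>W\<^esub>b\<in>F. c b \<odot>\<^bsub>W\<^esub> b)"
    proof (rule W.M.add.finprod_cong')
      show "(\<lambda>b. c b \<odot>\<^bsub>W\<^esub> b) \<in> F \<rightarrow> carrier W" using that B(1) by auto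
      fix b assume "b \<in> F"
      then have "b \<in> B" "c b \<in> carrier R" using that by auto
      then show "h (c b \<odot>\<^bsub>V\<^esub> k b) = c b \<odot>\<^bsub>W\<^esub> b" using hh(3) k by simp
    qed simp
    finally show ?thesis .
  qed
  have Sext: "S F c = S G (\<lambda>b. if b \<in> F then c b else \<zero>\<^bsub>R\<^esub>)" if F: "?ok F c" "F \<subseteq> G" and G: "finite G" "G \<subseteq> B" for F c G
  proof -
    have kG: "k b \<in> carrier V" if "b \<in> G" for b using that G(2) k(1) by (simp add: subset_iff)
    have cF: "c b \<in> carrier R" if "b \<in> F" for b using that F(1) by auto
    show ?thesis
      unfolding S_def
      by (rule V.M.add.finprod_mono_neutral_cong_left) (use F(2) G(1) kG cF in auto)
  qed
  have smult: "a \<odot>\<^bsub>V\<^esub> x \<in> ?\<Sigma>" if a: "a \<in> carrier R" and x: "x \<in> ?\<Sigma>" for a x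
  proof -
    obtain F c where F: "?ok F c" "x = S F c" using x by blast
    have "a \<odot>\<^bsub>V\<^esub> x = (\<Oplus>\<^bsub>V\<^esub>b\<in>F. a \<odot>\<^bsub>V\<^esub> (c b \<odot>\<^bsub>V\<^esub> k b))"
      unfolding F(2) S_def by (rule V.finsum_smult_ldistr) (use F a tm in auto)
    also have "\<dots> = S F (\<lambda>b. a \<otimes>\<^bsub>R\<^esub> c b)"
      unfolding S_def
    proof (rule V.M.add.finprod_cong')
      show "(\<lambda>b. (a \<otimes>\<^bsub>R\<^esub> c b) \<odot>\<^bsub>V\<^esub> k b) \<in> F \<rightarrow> carrier V"
        by (intro Pi_I V.smult_closed V.R.m_closed) (use okD[OF F(1)] a in auto)
      fix b assume "b \<in> F"
      then have "b \<in> B" "c b \<in> carrier R" using F by auto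
      then show "a \<odot>\<^bsub>V\<^esub> (c b \<odot>\<^bsub>V\<^esub> k b) = (a \<otimes>\<^bsub>R\<^esub> c b) \<odot>\<^bsub>V\<^esub> k b" using a k by (simp add: V.smult_assoc1)
    qed simp
    finally show ?thesis using F a by blast
  qed
  have sub: "submodule ?\<Sigma> R V"
  proof (rule V.submoduleI)
    show "?\<Sigma> \<subseteq> carrier V" using Sc by auto
    have "\<zero>\<^bsub>V\<^esub> = S {} (\<lambda>_. \<zero>\<^bsub>R\<^esub>)" by (simp add: S_def)
    then show "\<zero>\<^bsub>V\<^esub> \<in> ?\<Sigma>" by blast
  next
    fix x assume x: "x \<in> ?\<Sigma>"
    then have xc: "x \<in> carrier V" using Sc by auto
    have "(\<ominus>\<^bsub>R\<^esub> \<one>\<^bsub>R\<^esub>) \<odot>\<^bsub>V\<^esub> x \<in> ?\<Sigma>" by (rule smult[OF _ x]) simp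
    then show "\<ominus>\<^bsub>V\<^esub> x \<in> ?\<Sigma>" using V.smult_l_minus[OF V.R.one_closed xc] xc by simp
  next
    fix x y assume x: "x \<in> ?\<Sigma>" and y: "y \<in> ?\<Sigma>"
    obtain F c where F: "?ok F c" "x = S F c" using x by blast
    obtain G c' where G: "?ok G c'" "y = S G c'" using y by blast
    let ?c = "\<lambda>b. if b \<in> F then c b else \<zero>\<^bsub>R\<^esub>" and ?c' = "\<lambda>b. if b \<in> G then c' b else \<zero>\<^bsub>R\<^esub>"
    have FG: "finite (F \<union> G)" "F \<union> G \<subseteq> B" using F G by auto
    have cc: "?c b \<in> carrier R" "?c' b \<in> carrier R" for b using F(1) G(1) by auto
    have x': "x = S (F \<union> G) ?c" and y': "y = S (F \<union> G) ?c'"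
      using Sext[OF F(1), of "F \<union> G"] Sext[OF G(1), of "F \<union> G"] F(2) G(2) FG by auto
    have "S (F \<union> G) (\<lambda>b. ?c b \<oplus>\<^bsub>R\<^esub> ?c' b) = (\<Oplus>\<^bsub>V\<^esub>b\<in>F \<union> G. ?c b \<odot>\<^bsub>V\<^esub> k b \<oplus>\<^bsub>V\<^esub> ?c' b \<odot>\<^bsub>V\<^esub> k b)"
      unfolding S_def
    proof (rule V.M.add.finprod_cong')
      show "(\<lambda>b. ?c b \<odot>\<^bsub>V\<^esub> k b \<oplus>\<^bsub>V\<^esub> ?c' b \<odot>\<^bsub>V\<^esub> k b) \<in> F \<union> G \<rightarrow> carrier V"
        using cc k FG(2) by (intro Pi_I V.M.a_closed V.smult_closed) auto
      fix b assume "b \<in> F \<union> G"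
      then have "b \<in> B" using FG(2) by auto
      then show "(?c b \<oplus>\<^bsub>R\<^esub> ?c' b) \<odot>\<^bsub>V\<^esub> k b = ?c b \<odot>\<^bsub>V\<^esub> k b \<oplus>\<^bsub>V\<^esub> ?c' b \<odot>\<^bsub>V\<^esub> k b"
        by (rule V.smult_l_distr[OF cc k(1)])
    qed simp
    also have "\<dots> = x \<oplus>\<^bsub>V\<^esub> y"
      unfolding x' y' S_def
    proof (rule V.finsum_addf)
      show "(\<lambda>b. ?c b \<odot>\<^bsub>V\<^esub> k b) \<in> F \<union> G \<rightarrow> carrier V" "(\<lambda>b. ?c' b \<odot>\<^bsub>V\<^esub> k b) \<in> F \<union> G \<rightarrow> carrier V"
        using cc k FG(2) by (intro Pi_I V.smult_closed; auto)+
    qed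
    finally have "x \<oplus>\<^bsub>V\<^esub> y = S (F \<union> G) (\<lambda>b. ?c b \<oplus>\<^bsub>R\<^esub> ?c' b)" by simp
    moreover have "(\<lambda>b. ?c b \<oplus>\<^bsub>R\<^esub> ?c' b) \<in> F \<union> G \<rightarrow> carrier R"
      using cc by (intro Pi_I V.R.a_closed)
    ultimately show "x \<oplus>\<^bsub>V\<^esub> y \<in> ?\<Sigma>" using FG by blast
  qed (use smult in auto)
  have sur: "\<exists>s\<in>?\<Sigma>. h s = h v" if v: "v \<in> carrier V" for v
  proof -
    obtain F c where "?ok F c" "h v = (\<Oplus>\<^bsub>W\<^esub>b\<in>F. c b \<odot>\<^bsub>W\<^esub> b)" using B(2)[OF hh(1)[OF v]] by (elim exE conjE) (rule that; simp)
    then show ?thesis using hS by (intro bexI[of _ "S F c"]) auto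
  qed
  have ker: "s = \<zero>\<^bsub>V\<^esub>" if s: "s \<in> ?\<Sigma>" "h s = \<zero>\<^bsub>W\<^esub>" for s
  proof -
    obtain F c where F: "?ok F c" "s = S F c" using s(1) by blast
    then have "c b = \<zero>\<^bsub>R\<^esub>" if "b \<in> F" for b using B(3)[of F c b] hS[OF F(1)] s(2) that by simp
    then have "S F c = (\<Oplus>\<^bsub>V\<^esub>b\<in>F. \<zero>\<^bsub>V\<^esub>)"
      unfolding S_def by (intro V.M.add.finprod_cong') (use okD[OF F(1)] in auto)
    then show ?thesis using F by simp
  qed
  show ?thesis
    by (rule exI[of _ ?\<Sigma>], intro conjI ballI impI) (fact sub, erule sur, erule (1) ker)
qed

text \<open>With a complement \<open>\<Sigma>\<close> of the kernel \<open>Rw\<close>, every product of a nonunit and a vector lies in \<open>Nw + \<Sigma>\<close>. If a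
nonzero scalar kills \<open>w\<close>, then \<open>w\<close> itself lies there, so \<open>w = tw + s\<close> with \<open>t \<in> N\<close>; the vector
\<open>s = (1 - t)w\<close> lies in both summands and is zero, and \<open>1 - t\<close> is a unit.\<close>

theorem free_extension_kernel_generator:
  fixes R (structure)
  assumes V: "free_module R V" and W: "free_module R W"
    and h: "h \<in> module_homs R V W" "h ` carrier V = carrier W"
    and w: "w \<in> carrier V" "mod_kernel V W h = (\<lambda>y. y \<odot>\<^bsub>V\<^esub> w) ` carrier R"
    and N: "ideal N R" "\<And>t. t \<in> carrier R \<Longrightarrow> t \<notin> Units R \<Longrightarrow> t \<in> N" "\<And>t. t \<in> N \<Longrightarrow> \<one> \<ominus> t \<in> Units R"
    and y: "y \<in> carrier R" "y \<odot>\<^bsub>V\<^esub> w = \<zero>\<^bsub>V\<^esub>" "y \<noteq> \<zero>"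
  shows "w = \<zero>\<^bsub>V\<^esub>"
proof -
  interpret V: module R V using V by (simp add: free_module_def)
  interpret W: module R W using W by (simp add: free_module_def)
  interpret S: module R "self_module R" by (rule self_module_module[OF V.R.is_cring])
  note hh = module_homsD[OF h(1)]
  obtain \<Sigma> where \<Sigma>: "submodule \<Sigma> R V" "\<And>v. v \<in> carrier V \<Longrightarrow> \<exists>s\<in>\<Sigma>. h s = h v"
    "\<And>s. s \<in> \<Sigma> \<Longrightarrow> h s = \<zero>\<^bsub>W\<^esub> \<Longrightarrow> s = \<zero>\<^bsub>V\<^esub>"
    using free_quotient_complement[OF V.module_axioms W h] by blast
  have \<Sigma>c: "s \<in> carrier V" if "s \<in> \<Sigma>" for s using V.submoduleE(1)[OF \<Sigma>(1)] that by auto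
  have Nc: "t \<in> carrier R" if "t \<in> N" for t using ideal.Icarr[OF N(1) that] .
  note wh = V.smult_element_hom[OF w(1)]
  let ?P = "(\<lambda>t. t \<odot>\<^bsub>V\<^esub> w) ` N <+>\<^bsub>V\<^esub> \<Sigma>"
  have sP: "submodule ?P R V"
    by (rule submodule_set_add[OF V.module_axioms module_homs_image_submodule[OF S.module_axioms
          V.module_axioms wh ideal_submodule[OF V.R.is_cring N(1)]] \<Sigma>(1)])
  have hw: "h (t \<odot>\<^bsub>V\<^esub> w) = \<zero>\<^bsub>W\<^esub>" if "t \<in> carrier R" for t
    using w(2) that by (auto simp: mod_kernel_def)
  have "w \<in> ?P"
  proof (rule free_module_torsion_element[OF V w(1) y(1,3,2) sP])
    fix t v assume t: "t \<in> carrier R" "t \<notin> Units R" and v: "v \<in> carrier V"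
    obtain s where s: "s \<in> \<Sigma>" "h s = h v" using \<Sigma>(2)[OF v] by blast
    have "h (v \<ominus>\<^bsub>V\<^esub> s) = \<zero>\<^bsub>W\<^esub>"
      using module_hom_diff[OF V.module_axioms W.module_axioms h(1) v \<Sigma>c[OF s(1)]] s(2)
        W.diff_eq_zero_iff hh(1)[OF v] by simp
    then have "v \<ominus>\<^bsub>V\<^esub> s \<in> mod_kernel V W h" using v \<Sigma>c[OF s(1)] by (simp add: mod_kernel_def)
    then obtain r where r: "r \<in> carrier R" "v \<ominus>\<^bsub>V\<^esub> s = r \<odot>\<^bsub>V\<^esub> w" unfolding w(2) by auto
    have "v = r \<odot>\<^bsub>V\<^esub> w \<oplus>\<^bsub>V\<^esub> s"
      unfolding r(2)[symmetric] using v \<Sigma>c[OF s(1)] by (simp add: a_minus_def V.M.add.m_assoc V.M.l_neg)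
    then have "t \<odot>\<^bsub>V\<^esub> v = (t \<otimes> r) \<odot>\<^bsub>V\<^esub> w \<oplus>\<^bsub>V\<^esub> t \<odot>\<^bsub>V\<^esub> s"
      using r(1) t(1) w(1) \<Sigma>c[OF s(1)] by (simp add: V.smult_r_distr V.smult_assoc1)
    moreover have "t \<otimes> r \<in> N" using ideal.I_r_closed[OF N(1) N(2)[OF t] r(1)] .
    moreover have "t \<odot>\<^bsub>V\<^esub> s \<in> \<Sigma>" using V.submoduleE(4)[OF \<Sigma>(1) t(1) s(1)] .
    ultimately show "t \<odot>\<^bsub>V\<^esub> v \<in> ?P" by (auto simp: set_add_def')
  qed
  then obtain t s where t: "t \<in> N" "s \<in> \<Sigma>" "w = t \<odot>\<^bsub>V\<^esub> w \<oplus>\<^bsub>V\<^esub> s" by (auto simp: set_add_def')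
  have "\<zero>\<^bsub>W\<^esub> = h w" using hw[OF V.R.one_closed] w(1) by simp
  also have "\<dots> = h (t \<odot>\<^bsub>V\<^esub> w) \<oplus>\<^bsub>W\<^esub> h s"
    using arg_cong[OF t(3), of h] hh(2)[of "t \<odot>\<^bsub>V\<^esub> w" s] Nc[OF t(1)] w(1) \<Sigma>c[OF t(2)] by simp
  also have "\<dots> = h s" using hw[OF Nc[OF t(1)]] hh(1)[OF \<Sigma>c[OF t(2)]] by simp
  finally have "s = \<zero>\<^bsub>V\<^esub>" using \<Sigma>(3)[OF t(2)] by simp
  then have "w = t \<odot>\<^bsub>V\<^esub> w" using t(3) Nc[OF t(1)] w(1) by simp
  then have "(\<one> \<ominus> t) \<odot>\<^bsub>V\<^esub> w = \<zero>\<^bsub>V\<^esub>"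
    using V.diff_smult_distr[OF V.R.one_closed Nc[OF t(1)] w(1)] V.diff_eq_zero_iff[OF w(1), of "t \<odot>\<^bsub>V\<^esub> w"]
      Nc[OF t(1)] w(1) by simp
  then show ?thesis
    using V.unit_smult_mem[OF V.submodule_zero_submodule N(3)[OF t(1)] w(1)] by simp
qed

lemma (in module) reduction_module_simps:
  assumes I: "ideal I R"
  defines "N \<equiv> ideal_smult R I M"
  shows "carrier (reduction_module R I M) = (\<lambda>x. N +>\<^bsub>M\<^esub> x) ` carrier M"
    and "\<zero>\<^bsub>reduction_module R I M\<^esub> = N"
    and "x \<in> carrier M \<Longrightarrow> y \<in> carrier M \<Longrightarrow>
      (N +>\<^bsub>M\<^esub> x) \<oplus>\<^bsub>reduction_module R I M\<^esub> (N +>\<^bsub>M\<^esub> y) = N +>\<^bsub>M\<^esub> (x \<oplus>\<^bsub>M\<^esub> y)"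
    and "a \<in> carrier R \<Longrightarrow> x \<in> carrier M \<Longrightarrow>
      (I +> a) \<odot>\<^bsub>reduction_module R I M\<^esub> (N +>\<^bsub>M\<^esub> x) = N +>\<^bsub>M\<^esub> (a \<odot>\<^bsub>M\<^esub> x)"
proof -
  interpret I: ideal I R by fact
  have N: "submodule N R M" unfolding N_def by (rule ideal_smult_submodule) (use I.Icarr in auto)
  show "carrier (reduction_module R I M) = (\<lambda>x. N +>\<^bsub>M\<^esub> x) ` carrier M" "\<zero>\<^bsub>reduction_module R I M\<^esub> = N"
    by (auto simp: reduction_module_def Let_def N_def A_RCOSETS_def')
  show "x \<in> carrier M \<Longrightarrow> y \<in> carrier M \<Longrightarrow>
      (N +>\<^bsub>M\<^esub> x) \<oplus>\<^bsub>reduction_module R I M\<^esub> (N +>\<^bsub>M\<^esub> y) = N +>\<^bsub>M\<^esub> (x \<oplus>\<^bsub>M\<^esub> y)"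
    using coset_add[OF N] by (simp add: reduction_module_def Let_def N_def)
  assume a: "a \<in> carrier R" and x: "x \<in> carrier M"
  have "(\<Union>y\<in>N +>\<^bsub>M\<^esub> x. N +>\<^bsub>M\<^esub> (b \<odot>\<^bsub>M\<^esub> y)) = N +>\<^bsub>M\<^esub> (a \<odot>\<^bsub>M\<^esub> x)" if b: "b \<in> I +> a" for b
  proof -
    have bc: "b \<in> carrier R" using I.a_elemrcos_carrier[OF a b] .
    have "b \<ominus> a \<in> I" using I.a_rcos_module_imp[OF a b] by (simp add: a_minus_def)
    then have "b \<odot>\<^bsub>M\<^esub> x \<ominus>\<^bsub>M\<^esub> a \<odot>\<^bsub>M\<^esub> x \<in> N"
      using ideal_smult_mem[of "b \<ominus> a" I x M R] x diff_smult_distr[OF bc a x] by (simp add: N_def)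
    then show ?thesis
      using coset_smult[OF N x bc] coset_eq_iff[OF N, of "b \<odot>\<^bsub>M\<^esub> x" "a \<odot>\<^bsub>M\<^esub> x"] a bc x by simp
  qed
  moreover have "a \<in> I +> a" by (rule I.a_rcos_self[OF a])
  ultimately show "(I +> a) \<odot>\<^bsub>reduction_module R I M\<^esub> (N +>\<^bsub>M\<^esub> x) = N +>\<^bsub>M\<^esub> (a \<odot>\<^bsub>M\<^esub> x)"
    by (auto simp: reduction_module_def Let_def N_def[symmetric])
qed


section \<open>Generalized Gorenstein local rings\<close>

lemma quotient_carrier: "carrier (R Quot I) = (+>\<^bsub>R\<^esub>) I ` carrier R"
  by (auto simp: FactRing_def A_RCOSETS_def')

lemma self_module_hom_eq:
  fixes R (structure)
  assumes "cring R" "f \<in> module_homs R (self_module R) M" "r \<in> carrier R"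
  shows "f r = r \<odot>\<^bsub>M\<^esub> f \<one>"
proof -
  interpret cring R by fact
  have "f (r \<odot>\<^bsub>self_module R\<^esub> \<one>) = r \<odot>\<^bsub>M\<^esub> f \<one>"
    by (rule module_homsD(3)[OF assms(2,3)]) simp
  then show ?thesis using assms(3) by simp
qed

text \<open>The nonunits of the quotient ring form the image of \<open>\<mm>\<close>; this is what
\<open>free_extension_kernel_generator\<close> requires of its ideal \<open>N\<close>.\<close>

lemma local_quotient_nonunits:
  fixes R (structure)
  assumes R: "noetherian_local_ring R \<mm>" and I: "ideal I R"
  shows "ideal ((+>) I ` \<mm>) (R Quot I)"
    and "t \<in> carrier (R Quot I) \<Longrightarrow> t \<notin> Units (R Quot I) \<Longrightarrow> t \<in> (+>) I ` \<mm>"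
    and "t \<in> (+>) I ` \<mm> \<Longrightarrow> \<one>\<^bsub>R Quot I\<^esub> \<ominus>\<^bsub>R Quot I\<^esub> t \<in> Units (R Quot I)"
proof -
  note R' = noetherian_local_ringD[OF R]
  interpret cring R by (rule R'(1))
  interpret I: ideal I R by fact
  interpret Q: ring_hom_ring R "R Quot I" "(+>) I" by (rule I.rcos_ring_hom_ring)
  show "ideal ((+>) I ` \<mm>) (R Quot I)" by (rule ring_ideal_imp_quot_ideal[OF I R'(4)])
  have u: "I +> a \<in> Units (R Quot I)" if a: "a \<in> Units R" for a
  proof -
    have ac: "a \<in> carrier R" "inv a \<in> carrier R" using a by (auto simp: Units_closed)
    have "(I +> a) \<otimes>\<^bsub>R Quot I\<^esub> (I +> inv a) = \<one>\<^bsub>R Quot I\<^esub>"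
      "(I +> inv a) \<otimes>\<^bsub>R Quot I\<^esub> (I +> a) = \<one>\<^bsub>R Quot I\<^esub>"
      using a ac by (simp_all flip: Q.hom_mult)
    then show ?thesis using Q.hom_closed[OF ac(1)] Q.hom_closed[OF ac(2)] unfolding Units_def by blast
  qed
  {
    assume t: "t \<in> carrier (R Quot I)" "t \<notin> Units (R Quot I)"
    obtain a where a: "a \<in> carrier R" "t = I +> a" using t(1) unfolding quotient_carrier by (rule imageE)
    have "a \<in> \<mm>"
    proof (rule ccontr)
      assume "a \<notin> \<mm>"
      then have "I +> a \<in> Units (R Quot I)" by (rule u[OF local_ring_unit[OF R a(1)]])
      then show False using t(2) a(2) by simp
    qed
    then show "t \<in> (+>) I ` \<mm>" using a(2) by blast
  }
  assume "t \<in> (+>) I ` \<mm>"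
  then obtain a where a: "a \<in> \<mm>" "t = I +> a" by blast
  have ac: "a \<in> carrier R" using a(1) R'(5) by auto
  have "I +> (\<one> \<ominus> a) = \<one>\<^bsub>R Quot I\<^esub> \<ominus>\<^bsub>R Quot I\<^esub> t"
    unfolding a(2) using ac by (simp add: a_minus_def)
  then show "\<one>\<^bsub>R Quot I\<^esub> \<ominus>\<^bsub>R Quot I\<^esub> t \<in> Units (R Quot I)"
    using u[OF local_ring_one_minus_unit[OF R a(1)]] by simp
qed

lemma free_reduction_annihilator:
  fixes R (structure)
  assumes C: "module R C" "carrier C \<noteq> {\<zero>\<^bsub>C\<^esub>}" and I: "ideal I R" "ideal_smult R I C = {\<zero>\<^bsub>C\<^esub>}"
    and free: "free_module (R Quot I) (reduction_module R I C)"
    and r: "r \<in> carrier R" "\<And>c. c \<in> carrier C \<Longrightarrow> r \<odot>\<^bsub>C\<^esub> c = \<zero>\<^bsub>C\<^esub>"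
  shows "r \<in> I"
proof -
  interpret C: module R C by fact
  interpret I: ideal I R by fact
  note red = C.reduction_module_simps[OF I(1), unfolded I(2)]
  note z = C.coset_eq_self_iff[OF C.submodule_zero_submodule]
  have "I +> r = \<zero>\<^bsub>R Quot I\<^esub>"
  proof (rule free_module_annihilator[OF free])
    obtain c where c: "c \<in> carrier C" "c \<noteq> \<zero>\<^bsub>C\<^esub>" using C(2) C.M.zero_closed by blast
    have "{\<zero>\<^bsub>C\<^esub>} +>\<^bsub>C\<^esub> c \<noteq> {\<zero>\<^bsub>C\<^esub>}" using z[OF c(1)] c(2) by simp
    then show "carrier (reduction_module R I C) \<noteq> {\<zero>\<^bsub>reduction_module R I C\<^esub>}"
      unfolding red(1,2) using c(1) by blast
    show "I +> r \<in> carrier (R Quot I)" using r(1) by (simp add: quotient_carrier)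
    fix X assume "X \<in> carrier (reduction_module R I C)"
    then obtain c where c: "c \<in> carrier C" "X = {\<zero>\<^bsub>C\<^esub>} +>\<^bsub>C\<^esub> c" unfolding red(1) by blast
    then show "(I +> r) \<odot>\<^bsub>reduction_module R I C\<^esub> X = \<zero>\<^bsub>reduction_module R I C\<^esub>"
      using red(2,4) r z[of "\<zero>\<^bsub>C\<^esub>"] by simp
  qed
  then have "I +> r = I" by (simp add: FactRing_def)
  then show ?thesis using I.a_rcos_self[OF r(1)] by simp
qed

text \<open>Apply \<open>free_extension_kernel_generator\<close> to the surjection of \<open>K/IK\<close> onto \<open>C/IC\<close>, whose kernel is
generated by the class of \<open>f 1\<close>.\<close>

lemma free_reduction_kernel:
  fixes R (structure)
  assumes R: "noetherian_local_ring R \<mm>" and I: "ideal I R"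
    and K: "module R K" "free_module (R Quot I) (reduction_module R I K)"
    and C: "module R C" "free_module (R Quot I) (reduction_module R I C)" "ideal_smult R I C = {\<zero>\<^bsub>C\<^esub>}"
    and f: "f \<in> module_homs R (self_module R) K"
    and g: "g \<in> module_homs R K C" "g ` carrier K = carrier C"
    and ex: "f ` carrier R = mod_kernel K C g"
    and w: "f \<one> \<notin> ideal_smult R I K"
    and y: "y \<in> carrier R" "f y \<in> ideal_smult R I K"
  shows "y \<in> I"
proof (rule ccontr)
  assume yI: "y \<notin> I"
  interpret K: module R K by fact
  interpret C: module R C by fact
  interpret I: ideal I R by fact
  let ?N = "ideal_smult R I K"
  let ?V = "reduction_module R I K" and ?W = "reduction_module R I C"
  note V = K.reduction_module_simps[OF I]
  note W = C.reduction_module_simps[OF I, unfolded C(3)]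
  note gh = module_homsD[OF g(1)]
  have Ic: "I \<subseteq> carrier R" using I.Icarr by auto
  have sN: "submodule ?N R K" by (rule K.ideal_smult_submodule[OF Ic])
  note zK = K.coset_eq_self_iff[OF sN] and zC = C.coset_eq_self_iff[OF C.submodule_zero_submodule]
  have fr: "f r = r \<odot>\<^bsub>K\<^esub> f \<one>" if "r \<in> carrier R" for r
    by (rule self_module_hom_eq[OF K.R.is_cring f that])
  have f1: "f \<one> \<in> carrier K" using module_homsD(1)[OF f, of \<one>] by simp
  have gN: "g n = \<zero>\<^bsub>C\<^esub>" if "n \<in> ?N" for n
  proof -
    have "?N \<subseteq> {k \<in> carrier K. g k \<in> {\<zero>\<^bsub>C\<^esub>}}"
    proof (rule ideal_smult_minimal[OF module_homs_vimage_submodule[OF K(1) C(1) g(1) C.submodule_zero_submodule]])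
      fix a k assume a: "a \<in> I" "k \<in> carrier K"
      have "a \<odot>\<^bsub>C\<^esub> g k \<in> {\<zero>\<^bsub>C\<^esub>}" unfolding C(3)[symmetric] by (rule ideal_smult_mem[OF a(1) gh(1)[OF a(2)]])
      then show "a \<odot>\<^bsub>K\<^esub> k \<in> {k \<in> carrier K. g k \<in> {\<zero>\<^bsub>C\<^esub>}}" using gh(3) a Ic by auto
    qed
    then show ?thesis using that by auto
  qed
  \<comment> \<open>As \<open>IC = 0\<close>, a coset in \<open>C\<close> is a singleton, so the induced map sends a coset to its image.\<close>
  define h where "h X = g ` X" for X
  have h: "h (?N +>\<^bsub>K\<^esub> k) = {\<zero>\<^bsub>C\<^esub>} +>\<^bsub>C\<^esub> g k" if k: "k \<in> carrier K" for k
  proof -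
    have gk: "g (n \<oplus>\<^bsub>K\<^esub> k) = g k" if n: "n \<in> ?N" for n
      using gN[OF n] gh(2)[of n k] k K.submoduleE(1)[OF sN] n gh(1)[OF k] by auto
    have "?N +>\<^bsub>K\<^esub> k = (\<lambda>n. n \<oplus>\<^bsub>K\<^esub> k) ` ?N" by (auto simp: a_r_coset_def')
    then have "h (?N +>\<^bsub>K\<^esub> k) = (\<lambda>n. g (n \<oplus>\<^bsub>K\<^esub> k)) ` ?N" by (simp add: h_def image_image)
    also have "\<dots> = (\<lambda>n. g k) ` ?N" by (rule image_cong) (simp_all add: gk)
    also have "\<dots> = {g k}" using submodule_zero_mem[OF sN] by auto
    also have "\<dots> = {\<zero>\<^bsub>C\<^esub>} +>\<^bsub>C\<^esub> g k" using gh(1)[OF k] by (simp add: a_r_coset_def')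
    finally show ?thesis .
  qed
  have hh: "h \<in> module_homs (R Quot I) ?V ?W"
  proof (rule module_homsI)
    fix X assume "X \<in> carrier ?V"
    then obtain k where k: "k \<in> carrier K" "X = ?N +>\<^bsub>K\<^esub> k" unfolding V(1) by blast
    then show "h X \<in> carrier ?W" using h gh(1) by (simp add: W(1))
    {
      fix Y assume "Y \<in> carrier ?V"
      then obtain k' where k': "k' \<in> carrier K" "Y = ?N +>\<^bsub>K\<^esub> k'" unfolding V(1) by blast
      show "h (X \<oplus>\<^bsub>?V\<^esub> Y) = h X \<oplus>\<^bsub>?W\<^esub> h Y" using k k' h gh by (simp add: V(3) W(3))
    }
    fix A assume "A \<in> carrier (R Quot I)"
    then obtain a where a: "a \<in> carrier R" "A = I +> a" unfolding quotient_carrier by blast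
    show "h (A \<odot>\<^bsub>?V\<^esub> X) = A \<odot>\<^bsub>?W\<^esub> h X" using k a h gh by (simp add: V(4) W(4))
  qed
  have hs: "h ` carrier ?V = carrier ?W"
  proof -
    have "h ` carrier ?V = (\<lambda>k. {\<zero>\<^bsub>C\<^esub>} +>\<^bsub>C\<^esub> g k) ` carrier K"
      unfolding V(1) image_image by (rule image_cong) (use h in auto)
    also have "\<dots> = carrier ?W" unfolding W(1) g(2)[symmetric] image_image by simp
    finally show ?thesis .
  qed
  let ?w = "?N +>\<^bsub>K\<^esub> f \<one>"
  have wr: "(I +> r) \<odot>\<^bsub>?V\<^esub> ?w = ?N +>\<^bsub>K\<^esub> f r" if "r \<in> carrier R" for r
    using V(4)[OF that f1] fr[OF that] by simp
  have ker: "mod_kernel ?V ?W h = (\<lambda>A. A \<odot>\<^bsub>?V\<^esub> ?w) ` carrier (R Quot I)"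
  proof -
    have "mod_kernel ?V ?W h = (\<lambda>k. ?N +>\<^bsub>K\<^esub> k) ` {k \<in> carrier K. h (?N +>\<^bsub>K\<^esub> k) = {\<zero>\<^bsub>C\<^esub>}}"
      unfolding mod_kernel_def V(1) W(2) by blast
    also have "{k \<in> carrier K. h (?N +>\<^bsub>K\<^esub> k) = {\<zero>\<^bsub>C\<^esub>}} = f ` carrier R"
      unfolding ex mod_kernel_def using h zC gh(1) by auto
    also have "(\<lambda>k. ?N +>\<^bsub>K\<^esub> k) ` f ` carrier R = (\<lambda>A. A \<odot>\<^bsub>?V\<^esub> ?w) ` (+>) I ` carrier R"
      unfolding image_image using wr by (intro image_cong) auto
    also have "(+>) I ` carrier R = carrier (R Quot I)" by (simp add: quotient_carrier)
    finally show ?thesis .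
  qed
  have "?w = \<zero>\<^bsub>?V\<^esub>"
  proof (rule free_extension_kernel_generator[OF K(2) C(2) hh hs _ ker])
    show "?w \<in> carrier ?V" unfolding V(1) using f1 by blast
    show "ideal ((+>) I ` \<mm>) (R Quot I)" by (rule local_quotient_nonunits(1)[OF R I])
    show "I +> y \<in> carrier (R Quot I)" using y(1) by (simp add: quotient_carrier)
    show "(I +> y) \<odot>\<^bsub>?V\<^esub> ?w = \<zero>\<^bsub>?V\<^esub>"
      using wr[OF y(1)] zK[of "f y"] y(2) K.submoduleE(1)[OF sN] by (auto simp: V(2))
    show "I +> y \<noteq> \<zero>\<^bsub>R Quot I\<^esub>"
      using I.a_rcos_self[OF y(1)] yI by (auto simp: FactRing_def)
  qed (use local_quotient_nonunits(2,3)[OF R I] in auto)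
  then show False using zK[OF f1] w by (simp add: V(2))
qed

text \<open>If all products \<open>ak\<close> with \<open>a \<in> I\<close> were in \<open>f(\<mm>)\<close>, then so would be \<open>f 1\<close>. Hence some product is a unit
multiple of \<open>f 1\<close>, and after rescaling \<open>ak = f 1\<close>. As \<open>f 1\<close> has zero annihilator, \<open>a\<close> is regular on
\<open>f(R)\<close>; it is regular on \<open>K\<close> because a power of the \<open>K\<close>-regular element \<open>x\<close> maps \<open>K\<close> into \<open>f(R)\<close>. From
\<open>az \<in> f(R) = aRk\<close> it follows that \<open>z \<in> Rk\<close>.\<close>

lemma cyclic_of_generator_mem_ideal_smult:
  fixes R (structure)
  assumes R: "noetherian_local_ring R \<mm>" and I: "ideal I R"
    and K: "module R K"
    and f: "f \<in> module_homs R (self_module R) K" "inj_on f (carrier R)"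
    and IK: "\<And>a k. a \<in> I \<Longrightarrow> k \<in> carrier K \<Longrightarrow> a \<odot>\<^bsub>K\<^esub> k \<in> f ` carrier R"
    and x: "x \<in> carrier R" "x [^] (n::nat) \<in> I"
      "\<And>y. y \<in> carrier K \<Longrightarrow> x \<odot>\<^bsub>K\<^esub> y = \<zero>\<^bsub>K\<^esub> \<Longrightarrow> y = \<zero>\<^bsub>K\<^esub>"
    and w: "f \<one> \<in> ideal_smult R I K"
  shows "\<exists>k\<in>carrier K. bij_betw (\<lambda>r. r \<odot>\<^bsub>K\<^esub> k) (carrier R) (carrier K)"
proof -
  note R' = noetherian_local_ringD[OF R]
  interpret K: module R K by fact
  interpret S: module R "self_module R" by (rule self_module_module[OF R'(1)])
  have Ic: "a \<in> carrier R" if "a \<in> I" for a using ideal.Icarr[OF I that] .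
  have fr: "f r = r \<odot>\<^bsub>K\<^esub> f \<one>" if "r \<in> carrier R" for r
    by (rule self_module_hom_eq[OF K.R.is_cring f(1) that])
  have f1: "f \<one> \<in> carrier K" using module_homsD(1)[OF f(1), of \<one>] by simp
  have f0: "f \<zero> = \<zero>\<^bsub>K\<^esub>" using module_hom_zero[OF S.module_axioms K f(1)] by simp
  have fz: "r = \<zero>" if "r \<in> carrier R" "r \<odot>\<^bsub>K\<^esub> f \<one> = \<zero>\<^bsub>K\<^esub>" for r
    using inj_onD[OF f(2), of r \<zero>] fr[OF that(1)] that f0 by simp
  have "\<exists>a\<in>I. \<exists>k\<in>carrier K. \<exists>s\<in>carrier R - \<mm>. a \<odot>\<^bsub>K\<^esub> k = f s"
  proof (rule ccontr)
    assume no: "\<not> ?thesis"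
    have "ideal_smult R I K \<subseteq> f ` \<mm>"
    proof (rule ideal_smult_minimal[OF module_homs_image_submodule[OF S.module_axioms K f(1)
            ideal_submodule[OF R'(1,4)]]])
      fix a k assume ak: "a \<in> I" "k \<in> carrier K"
      then obtain s where "s \<in> carrier R" "a \<odot>\<^bsub>K\<^esub> k = f s" using IK by blast
      then show "a \<odot>\<^bsub>K\<^esub> k \<in> f ` \<mm>" using no ak by blast
    qed
    then obtain s where s: "s \<in> \<mm>" "f \<one> = f s" using w by blast
    then have "\<one> = s" using inj_onD[OF f(2), of \<one> s] R'(5) by auto
    then show False using s(1) local_ring_one_not_mem[OF R] by simp
  qed
  then obtain a k0 s where a: "a \<in> I" and k0: "k0 \<in> carrier K" and s: "s \<in> carrier R - \<mm>"
    and eq: "a \<odot>\<^bsub>K\<^esub> k0 = f s" by blast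
  have ac: "a \<in> carrier R" by (rule Ic[OF a])
  have su: "s \<in> Units R" using local_ring_unit[OF R] s by auto
  define k where "k = inv s \<odot>\<^bsub>K\<^esub> k0"
  have k: "k \<in> carrier K" using su k0 by (simp add: k_def)
  have ak: "a \<odot>\<^bsub>K\<^esub> k = f \<one>"
  proof -
    have "a \<odot>\<^bsub>K\<^esub> k = inv s \<odot>\<^bsub>K\<^esub> (s \<odot>\<^bsub>K\<^esub> f \<one>)"
      using K.smult_commute[OF ac _ k0, of "inv s"] su eq fr[of s] s by (simp add: k_def)
    then show ?thesis using su s f1 by (simp add: K.smult_assoc1[symmetric])
  qed
  have areg: "z = \<zero>\<^bsub>K\<^esub>" if z: "z \<in> carrier K" "a \<odot>\<^bsub>K\<^esub> z = \<zero>\<^bsub>K\<^esub>" for z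
  proof -
    obtain t where t: "t \<in> carrier R" "x [^] n \<odot>\<^bsub>K\<^esub> z = f t" using IK[OF x(2) z(1)] by blast
    have "(a \<otimes> t) \<odot>\<^bsub>K\<^esub> f \<one> = a \<odot>\<^bsub>K\<^esub> (x [^] n \<odot>\<^bsub>K\<^esub> z)"
      using t fr[OF t(1)] ac f1 by (simp add: K.smult_assoc1)
    also have "\<dots> = \<zero>\<^bsub>K\<^esub>" using K.smult_commute[OF ac Ic[OF x(2)] z(1)] z(2) Ic[OF x(2)] by simp
    finally have at: "a \<otimes> t = \<zero>" using fz ac t(1) by simp
    have "t \<odot>\<^bsub>K\<^esub> f \<one> = (a \<otimes> t) \<odot>\<^bsub>K\<^esub> k"
      unfolding ak[symmetric] using ac t(1) k by (simp add: K.smult_assoc1 K.smult_commute)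
    then have "x [^] n \<odot>\<^bsub>K\<^esub> z = \<zero>\<^bsub>K\<^esub>" using at k t fr[OF t(1)] by simp
    then show ?thesis using K.pow_smult_eq_zero[OF x(1) x(3) z(1)] by blast
  qed
  have "inj_on (\<lambda>r. r \<odot>\<^bsub>K\<^esub> k) (carrier R)"
  proof (rule inj_onI)
    fix r r' assume r: "r \<in> carrier R" "r' \<in> carrier R" and eq: "r \<odot>\<^bsub>K\<^esub> k = r' \<odot>\<^bsub>K\<^esub> k"
    have "f r = a \<odot>\<^bsub>K\<^esub> (r \<odot>\<^bsub>K\<^esub> k)" "f r' = a \<odot>\<^bsub>K\<^esub> (r' \<odot>\<^bsub>K\<^esub> k)"
      using fr[OF r(1)] fr[OF r(2)] r K.smult_commute[OF ac _ k] ak by simp_all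
    then show "r = r'" using eq inj_onD[OF f(2)] r by auto
  qed
  moreover have "(\<lambda>r. r \<odot>\<^bsub>K\<^esub> k) ` carrier R = carrier K"
  proof
    show "carrier K \<subseteq> (\<lambda>r. r \<odot>\<^bsub>K\<^esub> k) ` carrier R"
    proof
      fix z assume z: "z \<in> carrier K"
      obtain y where y: "y \<in> carrier R" "a \<odot>\<^bsub>K\<^esub> z = f y" using IK[OF a z] by blast
      have "a \<odot>\<^bsub>K\<^esub> z = a \<odot>\<^bsub>K\<^esub> (y \<odot>\<^bsub>K\<^esub> k)"
        using y fr[OF y(1)] K.smult_commute[OF ac y(1) k] ak by simp
      then have "a \<odot>\<^bsub>K\<^esub> (z \<ominus>\<^bsub>K\<^esub> y \<odot>\<^bsub>K\<^esub> k) = \<zero>\<^bsub>K\<^esub>"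
        using K.smult_diff_distr[OF ac z] y(1) k K.diff_eq_zero_iff[of "a \<odot>\<^bsub>K\<^esub> z"] ac z by simp
      then have "z \<ominus>\<^bsub>K\<^esub> y \<odot>\<^bsub>K\<^esub> k = \<zero>\<^bsub>K\<^esub>" by (rule areg[rotated]) (use y(1) k z in simp)
      then have "z = y \<odot>\<^bsub>K\<^esub> k" using K.diff_eq_zero_iff[OF z] y(1) k by simp
      then show "z \<in> (\<lambda>r. r \<odot>\<^bsub>K\<^esub> k) ` carrier R" using y(1) by blast
    qed
  qed (use k in auto)
  ultimately show ?thesis using k unfolding bij_betw_def by blast
qed

lemma finite_inj_dim_iso:
  assumes "finite_inj_dim R K" and h: "h \<in> module_homs R M K" "bij_betw h (carrier M) (carrier K)"
  shows "finite_inj_dim R M"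
proof -
  obtain I e d n where res: "injective_resolution R K I e d" and n: "\<forall>j>n. carrier (I j) = {\<zero>\<^bsub>I j\<^esub>}"
    using assms(1) unfolding finite_inj_dim_def by blast
  have e: "e \<in> module_homs R K (I 0)" "inj_on e (carrier K)"
    "e ` carrier K = mod_kernel (I 0) (I 1) (d 0)"
    using res unfolding injective_resolution_def by blast+
  have hK: "h ` carrier M = carrier K" "inj_on h (carrier M)" using h(2) by (auto simp: bij_betw_def)
  have "e \<circ> h \<in> module_homs R M (I 0)"
    using module_homsD[OF e(1)] module_homsD[OF h(1)] by (intro module_homsI) auto
  moreover have "inj_on (e \<circ> h) (carrier M)" using comp_inj_on[OF hK(2)] e(2) hK(1) by simp
  moreover have "(e \<circ> h) ` carrier M = mod_kernel (I 0) (I 1) (d 0)"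
    unfolding image_comp[symmetric] hK(1) by (rule e(3))
  ultimately have "injective_resolution R M I (e \<circ> h) d"
    using res unfolding injective_resolution_def by blast
  then show ?thesis using n unfolding finite_inj_dim_def by blast
qed

text \<open>The last step of the argument above. A form \<open>\<phi>\<close> is determined by its value \<open>q\<close> at \<open>f 1\<close>, because \<open>K\<close>
is torsion-free over \<open>f(R)\<close> with respect to powers of \<open>x\<close>.\<close>

lemma trace_ideal_eq:
  fixes R (structure)
  assumes R: "cring R" and I: "ideal I R" and K: "module R K"
    and f: "f \<in> module_homs R (self_module R) K" "inj_on f (carrier R)"
    and x: "x \<in> carrier R" "x [^] (n::nat) \<in> I"
      "\<And>y. y \<in> carrier K \<Longrightarrow> x \<odot>\<^bsub>K\<^esub> y = \<zero>\<^bsub>K\<^esub> \<Longrightarrow> y = \<zero>\<^bsub>K\<^esub>"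
    and IK: "\<And>a k. a \<in> I \<Longrightarrow> k \<in> carrier K \<Longrightarrow> a \<odot>\<^bsub>K\<^esub> k \<in> f ` carrier R"
    and ann: "\<And>r. r \<in> carrier R \<Longrightarrow> (\<And>k. k \<in> carrier K \<Longrightarrow> r \<odot>\<^bsub>K\<^esub> k \<in> f ` carrier R) \<Longrightarrow> r \<in> I"
    and contr: "\<And>y. y \<in> carrier R \<Longrightarrow> f y \<in> ideal_smult R I K \<Longrightarrow> y \<in> I"
  shows "I = trace_ideal R K"
proof -
  interpret K: module R K by fact
  interpret S: module R "self_module R" by (rule self_module_module[OF R])
  have Ic: "a \<in> carrier R" if "a \<in> I" for a using ideal.Icarr[OF I that] .
  have fr: "f r = r \<odot>\<^bsub>K\<^esub> f \<one>" if "r \<in> carrier R" for r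
    by (rule self_module_hom_eq[OF K.R.is_cring f(1) that])
  have f1: "f \<one> \<in> carrier K" using module_homsD(1)[OF f(1), of \<one>] by simp
  note fh = module_homsD[OF f(1), simplified]
  let ?U = "\<Union>\<phi>\<in>module_homs R K (self_module R). \<phi> ` carrier K"
  have Uc: "?U \<subseteq> carrier R" using module_homsD(1) by fastforce
  have "I \<subseteq> trace_ideal R K"
  proof
    fix a assume a: "a \<in> I"
    define \<phi> where "\<phi> k = inv_into (carrier R) f (a \<odot>\<^bsub>K\<^esub> k)" for k
    have \<phi>: "\<phi> k \<in> carrier R" "f (\<phi> k) = a \<odot>\<^bsub>K\<^esub> k" if "k \<in> carrier K" for k
      using inv_into_into[OF IK[OF a that]] f_inv_into_f[OF IK[OF a that]] by (auto simp: \<phi>_def)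
    have "\<phi> \<in> module_homs R K (self_module R)"
    proof (rule module_homsI)
      fix k assume k: "k \<in> carrier K"
      show "\<phi> k \<in> carrier (self_module R)" using \<phi>(1)[OF k] by simp
      {
        fix k' assume k': "k' \<in> carrier K"
        have "f (\<phi> (k \<oplus>\<^bsub>K\<^esub> k')) = f (\<phi> k \<oplus> \<phi> k')"
          using fh(2) \<phi> k k' Ic[OF a] by (simp add: K.smult_r_distr)
        then show "\<phi> (k \<oplus>\<^bsub>K\<^esub> k') = \<phi> k \<oplus>\<^bsub>self_module R\<^esub> \<phi> k'"
          using inj_onD[OF f(2)] \<phi>(1) k k' by simp
      }
      fix r assume r: "r \<in> carrier R"
      have "f (\<phi> (r \<odot>\<^bsub>K\<^esub> k)) = f (r \<otimes> \<phi> k)"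
        using fh(3) \<phi> k r Ic[OF a] by (simp add: K.smult_commute)
      then show "\<phi> (r \<odot>\<^bsub>K\<^esub> k) = r \<odot>\<^bsub>self_module R\<^esub> \<phi> k"
        using inj_onD[OF f(2)] \<phi>(1) k r by simp
    qed
    moreover have "\<phi> (f \<one>) = a"
      using inj_onD[OF f(2), of "\<phi> (f \<one>)" a] \<phi>[OF f1] fr[OF Ic[OF a]] Ic[OF a] by simp
    ultimately have "a \<in> ?U" using f1 by blast
    then show "a \<in> trace_ideal R K"
      unfolding trace_ideal_def using K.R.genideal_self[OF Uc] by blast
  qed
  moreover have "trace_ideal R K \<subseteq> I"
    unfolding trace_ideal_def
  proof (rule K.R.genideal_minimal[OF I], rule subsetI)
    fix r assume "r \<in> ?U"
    then obtain \<phi> k where \<phi>: "\<phi> \<in> module_homs R K (self_module R)" and k: "k \<in> carrier K" "r = \<phi> k" by blast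
    note \<phi>h = module_homsD[OF \<phi>, simplified]
    define q where "q = \<phi> (f \<one>)"
    have q: "q \<in> carrier R" using \<phi>h(1)[OF f1] by (simp add: q_def)
    \<comment> \<open>compare both sides after multiplication by \<open>x\<close> to the power \<open>n\<close>, which moves \<open>z\<close> into \<open>f(R)\<close>\<close>
    have fphi: "f (\<phi> z) = q \<odot>\<^bsub>K\<^esub> z" if z: "z \<in> carrier K" for z
    proof -
      have xn: "x [^] n \<in> carrier R" by (rule Ic[OF x(2)])
      obtain t where t: "t \<in> carrier R" "x [^] n \<odot>\<^bsub>K\<^esub> z = f t" using IK[OF x(2) z] by blast
      have "x [^] n \<odot>\<^bsub>K\<^esub> f (\<phi> z) = f (\<phi> (x [^] n \<odot>\<^bsub>K\<^esub> z))"
        using fh(3)[OF xn \<phi>h(1)[OF z]] \<phi>h(3)[OF xn z] by simp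
      also have "\<dots> = f (t \<otimes> q)" using t fr[OF t(1)] \<phi>h(3)[OF t(1) f1] by (simp add: q_def)
      also have "\<dots> = (q \<otimes> t) \<odot>\<^bsub>K\<^esub> f \<one>" using fr[of "t \<otimes> q"] t(1) q by (simp add: K.R.m_comm)
      also have "\<dots> = q \<odot>\<^bsub>K\<^esub> (x [^] n \<odot>\<^bsub>K\<^esub> z)"
        using t fr[OF t(1)] q f1 by (simp add: K.smult_assoc1)
      also have "\<dots> = x [^] n \<odot>\<^bsub>K\<^esub> (q \<odot>\<^bsub>K\<^esub> z)" by (rule K.smult_commute[OF q xn z])
      finally have "x [^] n \<odot>\<^bsub>K\<^esub> (f (\<phi> z) \<ominus>\<^bsub>K\<^esub> q \<odot>\<^bsub>K\<^esub> z) = \<zero>\<^bsub>K\<^esub>"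
        using K.smult_diff_distr[OF xn fh(1)[OF \<phi>h(1)[OF z]], of "q \<odot>\<^bsub>K\<^esub> z"] q z xn
          K.diff_eq_zero_iff[of "x [^] n \<odot>\<^bsub>K\<^esub> f (\<phi> z)"] fh(1)[OF \<phi>h(1)[OF z]] by simp
      then have "f (\<phi> z) \<ominus>\<^bsub>K\<^esub> q \<odot>\<^bsub>K\<^esub> z = \<zero>\<^bsub>K\<^esub>"
        using K.pow_smult_eq_zero[OF x(1) x(3), of "f (\<phi> z) \<ominus>\<^bsub>K\<^esub> q \<odot>\<^bsub>K\<^esub> z" n] fh(1)[OF \<phi>h(1)[OF z]] q z by simp
      then show ?thesis using K.diff_eq_zero_iff[OF fh(1)[OF \<phi>h(1)[OF z]]] q z by simp
    qed
    have "q \<in> I"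
    proof (rule ann[OF q])
      fix z assume z: "z \<in> carrier K"
      show "q \<odot>\<^bsub>K\<^esub> z \<in> f ` carrier R" using fphi[OF z] \<phi>h(1)[OF z] by (metis imageI)
    qed
    then have "f r \<in> ideal_smult R I K"
      using fphi[OF k(1)] k ideal_smult_mem[of q I k K R] by simp
    then show "r \<in> I" using contr k \<phi>h(1) by simp
  qed
  ultimately show ?thesis by blast
qed

theorem corollary4p2:
  fixes R :: "('a, 'r) ring_scheme"
    and K :: "('a, 'k) module"
    and \<mm> \<aa> :: "'a set"
  assumes "cm_local_ring R \<mm>"
    and "krull_dim R = 1"
    and "canonical_module R \<mm> K"
    and "m_primary R \<mm> \<aa>"
    and "ggl_ring R \<mm> K \<aa>"
    and "\<not> gorenstein_local_ring R \<mm>"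
  shows "\<aa> = trace_ideal R K"
proof -
  have R: "noetherian_local_ring R \<mm>" using assms(1) by (simp add: cm_local_ring_def)
  note R' = noetherian_local_ringD[OF R]
  interpret cring R by (rule R'(1))
  have K: "fin_gen_module R K" "depth R \<mm> K = 1" "has_cm_type R \<mm> K 1" "finite_inj_dim R K"
    using assms(2,3) by (auto simp: canonical_module_def cm_module_def)
  have mK: "module R K" using K(1) by (simp add: fin_gen_module_def)
  interpret K: module R K by (rule mK)
  interpret S: module R "self_module R" by (rule self_module_module[OF R'(1)])
  obtain x where x: "x \<in> \<mm>" "\<And>y. y \<in> carrier K \<Longrightarrow> x \<odot>\<^bsub>K\<^esub> y = \<zero>\<^bsub>K\<^esub> \<Longrightarrow> y = \<zero>\<^bsub>K\<^esub>"
    using K.regular_element_of_depth[of \<mm>] K(2) by auto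
  have xc: "x \<in> carrier R" using x(1) R'(5) by auto
  have \<aa>: "ideal \<aa> R" and rad: "radical_of R \<aa> = \<mm>"
    using assms(4) by (auto simp: m_primary_def primary_ideal_def)
  have am: "\<aa> \<subseteq> \<mm>"
  proof
    fix a assume a: "a \<in> \<aa>"
    have ac: "a \<in> carrier R" by (rule ideal.Icarr[OF \<aa> a])
    have "a [^]\<^bsub>R\<^esub> (1::nat) \<in> \<aa>" using a ac by simp
    then have "a \<in> radical_of R \<aa>" unfolding radical_of_def using ac by blast
    then show "a \<in> \<mm>" using rad by simp
  qed
  obtain n :: nat where n: "x [^]\<^bsub>R\<^esub> n \<in> \<aa>" using x(1) unfolding rad[symmetric] radical_of_def by blast
  obtain C :: "('a, 'k set) module" and f g where C: "module R C" and f: "f \<in> module_homs R (self_module R) K" "inj_on f (carrier R)"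
    and g: "g \<in> module_homs R K C" "g ` carrier K = carrier C"
    and ex: "f ` carrier R = mod_kernel K C g" and U: "ulrich_module R \<mm> \<aa> C"
    and fK: "free_module (R Quot \<aa>) (reduction_module R \<aa> K)"
    using assms(5) unfolding ggl_ring_def by blast
  interpret C: module R C by (rule C)
  have cmC: "fin_gen_module R C" "carrier C \<noteq> {\<zero>\<^bsub>C\<^esub>}" "depth R \<mm> C = module_dim R C"
    and mult: "enat (multiplicity_wrt R \<aa> C) = module_length R (quot_module C (ideal_smult R \<aa> C))"
    and fC: "free_module (R Quot \<aa>) (reduction_module R \<aa> C)"
    using U by (auto simp: ulrich_module_def cm_module_def)
  have nC: "noetherian_module R C" by (rule fin_gen_noetherian_module[OF R'(2) cmC(1)])
  note gh = module_homsD[OF g(1)]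

  have "\<not> 1 \<le> depth R \<mm> C"
  proof
    assume "1 \<le> depth R \<mm> C"
    then obtain d where d: "d \<in> \<mm>" "\<And>c. c \<in> carrier C \<Longrightarrow> d \<odot>\<^bsub>C\<^esub> c = \<zero>\<^bsub>C\<^esub> \<Longrightarrow> c = \<zero>\<^bsub>C\<^esub>"
      using C.regular_element_of_depth[of \<mm>] by auto
    obtain I e \<delta> t where res: "injective_resolution R K I e \<delta>" and t: "depth R \<mm> K = enat t"
      and len: "module_length R (ext_module R (quot_module (self_module R) \<mm>) I \<delta> t) = enat 1"
      using K(3) unfolding has_cm_type_def by blast
    have "t = 1" using t K(2) by (simp add: one_enat_def)
    with len have len1: "module_length R (ext_module R (quot_module (self_module R) \<mm>) I \<delta> 1) = enat 1" by simp
    have "carrier C = {\<zero>\<^bsub>C\<^esub>}"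
      by (rule cokernel_zero_if_regular[OF R assms(2) mK x ext_length_one_simple_socle[OF R mK x res len1] C nC f g ex d])
    then show False using cmC(2) by simp
  qed
  then have dim: "module_dim R C = 0" using cmC(3) by (cases "module_dim R C") (auto simp: one_enat_def zero_enat_def)
  have aC: "ideal_smult R \<aa> C = {\<zero>\<^bsub>C\<^esub>}"
    by (rule C.ideal_smult_zero_of_multiplicity[OF R nC cmC(2) \<aa> am dim mult])
  have aK: "a \<odot>\<^bsub>K\<^esub> k \<in> f ` carrier R" if a: "a \<in> \<aa>" and k: "k \<in> carrier K" for a k
  proof -
    have ac: "a \<in> carrier R" by (rule ideal.Icarr[OF \<aa> a])
    have "a \<odot>\<^bsub>C\<^esub> g k \<in> {\<zero>\<^bsub>C\<^esub>}" unfolding aC[symmetric] by (rule ideal_smult_mem[OF a gh(1)[OF k]])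
    then show ?thesis unfolding ex mod_kernel_def using gh(3)[OF ac k] ac k by simp
  qed
  have ann: "r \<in> \<aa>" if r: "r \<in> carrier R" and rK: "\<And>k. k \<in> carrier K \<Longrightarrow> r \<odot>\<^bsub>K\<^esub> k \<in> f ` carrier R" for r
  proof (rule free_reduction_annihilator[OF C cmC(2) \<aa> aC fC r])
    fix c assume "c \<in> carrier C"
    then obtain k where k: "k \<in> carrier K" "c = g k" using g(2) by blast
    then show "r \<odot>\<^bsub>C\<^esub> c = \<zero>\<^bsub>C\<^esub>" using rK[OF k(1)] gh(3)[OF r k(1)] unfolding ex mod_kernel_def by simp
  qed
  have "f \<one>\<^bsub>R\<^esub> \<notin> ideal_smult R \<aa> K"
  proof
    assume "f \<one>\<^bsub>R\<^esub> \<in> ideal_smult R \<aa> K"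
    then obtain k where k: "k \<in> carrier K" "bij_betw (\<lambda>r. r \<odot>\<^bsub>K\<^esub> k) (carrier R) (carrier K)"
      using cyclic_of_generator_mem_ideal_smult[OF R \<aa> mK f aK xc n x(2)] by blast
    then have "finite_inj_dim R (self_module R)"
      by (intro finite_inj_dim_iso[OF K(4) K.smult_element_hom]) simp_all
    then show False using assms(6) R by (simp add: gorenstein_local_ring_def)
  qed
  then have contr: "y \<in> \<aa>" if "y \<in> carrier R" "f y \<in> ideal_smult R \<aa> K" for y
    using free_reduction_kernel[OF R \<aa> mK fK C fC aC f(1) g ex _ that] by blast
  show ?thesis
    by (rule trace_ideal_eq[OF R'(1) \<aa> mK f xc n x(2) aK ann contr])
qed

end
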